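(* Suppose that $X_1(t)$ is a Pearson diffusion in steady state (of Hermite, Laguerre or Jacobi type, as described in the context), so that its correlation function is given by $\mathrm{corr}[X_1(t),X_1(s)]=\exp(-\theta|t-s|)$, where the correlation parameter $\theta=\lambda_1$ is the smallest positive eigenvalue of the generator $\mathcal{G}$ (in the sign convention $\mathcal{G}Q_n=-\lambda_nQ_n$). Let $D(t)$ be a subordinator with Laplace exponent $\psi(s)=c_1s^{\beta_1}+c_2s^{\beta_2}$, where $c_1,c_2\ge 0$, $c_1+c_2=1$ and $0<\beta_1<\beta_2<1$; that is, $\mathbb{E}[e^{-sD(t)}]=e^{-t\psi(s)}$. Let $E(t)=\inf\{\tau\ge 0: D(\tau)>t\}$ be the inverse subordinator, independent of $X_1$. Then the correlation function of the corresponding time-changed Pearson diffusion $X(t)=X_1(E(t))$ is given by $$\mathrm{corr}[X(t),X(s)]=\theta\int_{y=0}^{s}h(y)\,\Phi_\theta(t-y)\,dy+\Phi_\theta(t),$$ where $$h(y)=\frac{1}{c_2}\,y^{\beta_2-1}E_{\beta_2-\beta_1,\beta_2}\left(-\frac{c_1}{c_2}y^{\beta_2-\beta_1}\right)$$ and $$\Phi_\theta(t)=\sum_{r=0}^{\infty}\left(-\frac{c_1t^{\beta_2-\beta_1}}{c_2}\right)^r E^{r+1}_{\beta_2,(\beta_2-\beta_1)r+1}\left(-\frac{\theta t^{\beta_2}}{c_2}\right)-\sum_{r=0}^{\infty}\left(-\frac{c_1t^{\beta_2-\beta_1}}{c_2}\right)^{r+1}E^{r+1}_{\beta_2,(\beta_2-\beta_1)(r+1)+1}\left(-\frac{\theta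 t^{\beta_2}}{c_2}\right).$$
   Context: Pearson diffusion: the solution $X_1(t)$ of the stochastic differential equation $dX_1(t)=\mu(X_1(t))\,dt+\sigma(X_1(t))\,dW(t)$, with $W$ a standard Brownian motion, $\mu(x)=a_0+a_1x$ and $D(x)=\sigma^2(x)/2=d_0+d_1x+d_2x^2$ (this polynomial $D(x)$ is not to be confused with the subordinator $D(t)$). Its generator is $\mathcal{G}=\mu(y)\frac{\partial}{\partial y}+\frac{\sigma^2(y)}{2}\frac{\partial^2}{\partial y^2}$, and $m$ denotes the density of its steady-state distribution. It is assumed that one of three cases holds: (1) Hermite: $d_1=d_2=0$ and $d_0>0$, $m$ is a normal density, and the $Q_n$ are Hermite polynomials; (2) Laguerre: $d_2=0$, $m$ is a gamma density, and the $Q_n$ are Laguerre polynomials; (3) Jacobi: $D''(y)<0$ with two positive real roots, $m$ is a beta density, and the $Q_n$ are Jacobi polynomials. Here the $Q_n$ are eigenfunctions of the generator, $\mathcal{G}Q_n=-\lambda_nQ_n$ with $0=\lambda_0<\lambda_1<\lambda_2<\cdots$, forming an orthonormal basis of $L^2(m(y)\,dy)$; in these cases all moments exist. The process $X_1(t)$ is in steady state if its probability density is $m$ for all time; the time-changed process $X_1(E(t))$ is in steady state if it starts with the distribution $m$, and then its mean and variance do not vary over time. $\mathrm{corr}$ denotes the correlation coefficient of two random variables. Generalized Mittag-Leffler function: $E^{\gamma}_{\alpha,\beta}(z)=\sum_{j=0}^\infty\frac{(\gamma)_j z^j}{j!\,\Gamma(\alpha j+\beta)}$ for $\alpha,\beta\in\mathbb{C}$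 with $\mathrm{Re}(\alpha),\mathrm{Re}(\beta),\mathrm{Re}(\gamma)>0$, where $(\gamma)_0=1$ and $(\gamma)_j=\gamma(\gamma+1)\cdots(\gamma+j-1)$. The Mittag-Leffler function is $E_{\alpha,\beta}=E^1_{\alpha,\beta}$.
   Formalization: The weight c_2 is taken to be positive, since for c_2=0 (allowed in the statement) h and Φ_θ divide by zero and are undefined; the times are taken with 0≤s≤t, as the formula, not symmetric in s and t, requires. *)

theory Defs
  imports "HOL-Probability.Probability" "HOL-Computational_Algebra.Polynomial"
begin

section \<open>Generalized Mittag-Leffler functions\<close>

text \<open>The class \<open>Gamma\<close> has exactly the two library instances \<open>real\<close> and \<open>complex\<close>.
  The series converges for parameters with positive real parts.\<close>

definition gen_mittag_leffler :: "'a::Gamma \<Rightarrow> 'a \<Rightarrow> 'a \<Rightarrow> 'a \<Rightarrow> 'a" where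
  "gen_mittag_leffler \<gamma> \<alpha> \<beta> z =
     (\<Sum>j. pochhammer \<gamma> j * z ^ j / (fact j * Gamma (\<alpha> * of_nat j + \<beta>)))"

definition mittag_leffler :: "'a::Gamma \<Rightarrow> 'a \<Rightarrow> 'a \<Rightarrow> 'a" where
  "mittag_leffler = gen_mittag_leffler 1"

section \<open>Pearson diffusions\<close>

definition drift :: "real \<Rightarrow> real \<Rightarrow> real \<Rightarrow> real" where
  "drift a0 a1 x = a0 + a1 * x"

definition diffusion_poly :: "real \<Rightarrow> real \<Rightarrow> real \<Rightarrow> real \<Rightarrow> real" where
  "diffusion_poly d0 d1 d2 x = d0 + d1 * x + d2 * x\<^sup>2"

definition pearson_generator ::
  "real \<Rightarrow> real \<Rightarrow> real \<Rightarrow> real \<Rightarrow> real \<Rightarrow> (real \<Rightarrow> real) \<Rightarrow> real \<Rightarrow> real" where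
  "pearson_generator a0 a1 d0 d1 d2 f y =
     drift a0 a1 y * deriv f y + diffusion_poly d0 d1 d2 y * deriv (deriv f) y"

definition gamma_density :: "real \<Rightarrow> real \<Rightarrow> real \<Rightarrow> real" where
  "gamma_density p r x =
     (if x > 0 then r powr p / Gamma p * x powr (p - 1) * exp (- r * x) else 0)"

text \<open>Beta density on an interval with end points \<open>l < u\<close>.\<close>

definition beta_density :: "real \<Rightarrow> real \<Rightarrow> real \<Rightarrow> real \<Rightarrow> real \<Rightarrow> real" where
  "beta_density p q l u x =
     (if l < x \<and> x < u
      then (x - l) powr (p - 1) * (u - x) powr (q - 1) / (Beta p q * (u - l) powr (p + q - 1))
      else 0)"

text \<open>In each case \<open>m\<close> is carried by the interval on which the diffusion coefficient is
  positive. In the Laguerre case that interval is the half-line bounded by \<open>- d0 / d1\<close>,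
  which opens to the right or left according to the sign of \<open>d1\<close>; for \<open>d0 = 0 < d1\<close>, \<open>m\<close> is a
  gamma density on the positive half-line. The parameters of \<open>m\<close> need not be tied to the
  coefficients here, since they are determined by stationarity.\<close>

definition hermite_case :: "real \<Rightarrow> real \<Rightarrow> real \<Rightarrow> (real \<Rightarrow> real) \<Rightarrow> bool" where
  "hermite_case d0 d1 d2 m \<longleftrightarrow>
     d1 = 0 \<and> d2 = 0 \<and> d0 > 0 \<and> (\<exists>\<nu> \<rho>. \<rho> > 0 \<and> m = normal_density \<nu> \<rho>)"

definition laguerre_case :: "real \<Rightarrow> real \<Rightarrow> real \<Rightarrow> (real \<Rightarrow> real) \<Rightarrow> bool" where
  "laguerre_case d0 d1 d2 m \<longleftrightarrow>
     d2 = 0 \<and> d1 \<noteq> 0 \<and>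
     (\<exists>p r. p > 0 \<and> r > 0 \<and> m = (\<lambda>x. gamma_density p r (sgn d1 * (x + d0 / d1))))"

definition jacobi_case :: "real \<Rightarrow> real \<Rightarrow> real \<Rightarrow> (real \<Rightarrow> real) \<Rightarrow> bool" where
  "jacobi_case d0 d1 d2 m \<longleftrightarrow>
     d2 < 0 \<and>
     (\<exists>l u p q. l < u \<and> diffusion_poly d0 d1 d2 l = 0 \<and> diffusion_poly d0 d1 d2 u = 0 \<and>
        p > 0 \<and> q > 0 \<and> m = beta_density p q l u)"

definition orthonormal_basis_L2 :: "real measure \<Rightarrow> (nat \<Rightarrow> real \<Rightarrow> real) \<Rightarrow> bool" where
  "orthonormal_basis_L2 N e \<longleftrightarrow>
     (\<forall>n. e n \<in> borel_measurable N) \<and>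
     (\<forall>i j. (LINT y|N. e i y * e j y) = (if i = j then 1 else 0)) \<and>
     (\<forall>f. f \<in> borel_measurable N \<longrightarrow> integrable N (\<lambda>y. (f y)\<^sup>2) \<longrightarrow>
        (\<lambda>n. LINT y|N. (f y - (\<Sum>i<n. (LINT x|N. f x * e i x) * e i y))\<^sup>2) \<longlonglongrightarrow> 0)"

text \<open>Orthonormal polynomials \<open>Q n\<close> of degree \<open>n\<close> are unique up to sign; for a normal, gamma or
  beta density \<open>m\<close> they are the normalized Hermite, Laguerre or Jacobi polynomials.\<close>

definition pearson_eigensystem ::
  "real \<Rightarrow> real \<Rightarrow> real \<Rightarrow> real \<Rightarrow> real \<Rightarrow> (real \<Rightarrow> real) \<Rightarrow>
   (nat \<Rightarrow> real poly) \<Rightarrow> (nat \<Rightarrow> real) \<Rightarrow> bool" where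
  "pearson_eigensystem a0 a1 d0 d1 d2 m Q lam \<longleftrightarrow>
     (\<forall>n. degree (Q n) = n) \<and>
     orthonormal_basis_L2 (density lborel (\<lambda>y. ennreal (m y))) (\<lambda>n. poly (Q n)) \<and>
     (\<forall>n y. pearson_generator a0 a1 d0 d1 d2 (poly (Q n)) y = - lam n * poly (Q n) y) \<and>
     lam 0 = 0 \<and> strict_mono lam"

section \<open>Brownian motion and stochastic differential equations\<close>

definition brownian_motion ::
  "'a measure \<Rightarrow> (real \<Rightarrow> 'a measure) \<Rightarrow> (real \<Rightarrow> 'a \<Rightarrow> real) \<Rightarrow> bool" where
  "brownian_motion M F W \<longleftrightarrow>
     filtration (space M) F \<and> (\<forall>t\<ge>0. sets (F t) \<subseteq> sets M) \<and>
     (\<forall>t\<ge>0. W t \<in> borel_measurable (F t)) \<and>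
     (AE \<omega> in M. W 0 \<omega> = 0 \<and> continuous_on {0..} (\<lambda>t. W t \<omega>)) \<and>
     (\<forall>s t. 0 \<le> s \<longrightarrow> s < t \<longrightarrow>
        distributed M lborel (\<lambda>\<omega>. W t \<omega> - W s \<omega>) (\<lambda>x. ennreal (normal_density 0 (sqrt (t - s)) x)) \<and>
        prob_space.indep_set M (sets (F s))
          {(\<lambda>\<omega>. W t \<omega> - W s \<omega>) -` B \<inter> space M | B. B \<in> sets borel})"

text \<open>A simple integrand is given by times \<open>\<tau> 0 < \<dots> < \<tau> n\<close> and bounded weights \<open>\<xi> i\<close>,
  measurable at time \<open>\<tau> i\<close>.\<close>

definition simple_integrand ::
  "'a measure \<Rightarrow> (real \<Rightarrow> 'a measure) \<Rightarrow> nat \<Rightarrow> (nat \<Rightarrow> real) \<Rightarrow> (nat \<Rightarrow> 'a \<Rightarrow> real) \<Rightarrow> bool" where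
  "simple_integrand M F n \<tau> \<xi> \<longleftrightarrow>
     0 \<le> \<tau> 0 \<and> (\<forall>i<n. \<tau> i < \<tau> (Suc i)) \<and>
     (\<forall>i<n. \<xi> i \<in> borel_measurable (F (\<tau> i)) \<and> (\<exists>C. \<forall>\<omega>\<in>space M. \<bar>\<xi> i \<omega>\<bar> \<le> C))"

definition simple_process ::
  "nat \<Rightarrow> (nat \<Rightarrow> real) \<Rightarrow> (nat \<Rightarrow> 'a \<Rightarrow> real) \<Rightarrow> real \<Rightarrow> 'a \<Rightarrow> real" where
  "simple_process n \<tau> \<xi> u \<omega> = (\<Sum>i<n. \<xi> i \<omega> * indicator {\<tau> i<..\<tau> (Suc i)} u)"

definition simple_integral ::
  "(real \<Rightarrow> 'a \<Rightarrow> real) \<Rightarrow> nat \<Rightarrow> (nat \<Rightarrow> real) \<Rightarrow> (nat \<Rightarrow> 'a \<Rightarrow> real) \<Rightarrow> real \<Rightarrow> 'a \<Rightarrow> real" where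
  "simple_integral W n \<tau> \<xi> t \<omega> =
     (\<Sum>i<n. \<xi> i \<omega> * (W (min t (\<tau> (Suc i))) \<omega> - W (min t (\<tau> i)) \<omega>))"

text \<open>\<open>I\<close> is (a version of) the Ito integral of \<open>H\<close> against \<open>W\<close> over \<open>[0, t]\<close>, i.e. the
  \<open>L\<^sup>2\<close>-limit of the integrals of simple processes approximating \<open>H\<close> in \<open>L\<^sup>2\<close>.\<close>

definition ito_integral ::
  "'a measure \<Rightarrow> (real \<Rightarrow> 'a measure) \<Rightarrow> (real \<Rightarrow> 'a \<Rightarrow> real) \<Rightarrow> (real \<Rightarrow> 'a \<Rightarrow> real) \<Rightarrow>
   real \<Rightarrow> ('a \<Rightarrow> real) \<Rightarrow> bool" where
  "ito_integral M F W H t I \<longleftrightarrow>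
     I \<in> borel_measurable M \<and>
     (\<exists>n \<tau> \<xi>. (\<forall>k::nat. simple_integrand M F (n k) (\<tau> k) (\<xi> k)) \<and>
        (\<lambda>k. \<integral>\<^sup>+\<omega>. (\<integral>\<^sup>+u\<in>{0..t}.
            ennreal ((H u \<omega> - simple_process (n k) (\<tau> k) (\<xi> k) u \<omega>)\<^sup>2) \<partial>lborel) \<partial>M) \<longlonglongrightarrow> 0 \<and>
        (\<lambda>k. \<integral>\<^sup>+\<omega>. ennreal ((I \<omega> - simple_integral W (n k) (\<tau> k) (\<xi> k) t \<omega>)\<^sup>2) \<partial>M)
            \<longlonglongrightarrow> 0)"

definition sde_solution ::
  "'a measure \<Rightarrow> (real \<Rightarrow> 'a measure) \<Rightarrow> (real \<Rightarrow> 'a \<Rightarrow> real) \<Rightarrow>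
   (real \<Rightarrow> real) \<Rightarrow> (real \<Rightarrow> real) \<Rightarrow> (real \<Rightarrow> 'a \<Rightarrow> real) \<Rightarrow> bool" where
  "sde_solution M F W \<mu> \<sigma> X \<longleftrightarrow>
     (\<forall>t\<ge>0. X t \<in> borel_measurable (F t)) \<and>
     (\<forall>\<omega>\<in>space M. continuous_on {0..} (\<lambda>t. X t \<omega>)) \<and>
     (\<forall>t\<ge>0. \<exists>I. ito_integral M F W (\<lambda>u \<omega>. \<sigma> (X u \<omega>)) t I \<and>
        (AE \<omega> in M. X t \<omega> = X 0 \<omega> + (LINT u:{0..t}|lborel. \<mu> (X u \<omega>)) + I \<omega>))"

text \<open>The condition on \<open>\<sigma>\<close> is only imposed where the polynomial is nonnegative, i.e. on the
  closure of the state space: elsewhere it cannot be met.\<close>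

definition pearson_diffusion ::
  "'a measure \<Rightarrow> (real \<Rightarrow> 'a measure) \<Rightarrow> (real \<Rightarrow> 'a \<Rightarrow> real) \<Rightarrow>
   real \<Rightarrow> real \<Rightarrow> real \<Rightarrow> real \<Rightarrow> real \<Rightarrow> (real \<Rightarrow> 'a \<Rightarrow> real) \<Rightarrow> bool" where
  "pearson_diffusion M F W a0 a1 d0 d1 d2 X \<longleftrightarrow>
     brownian_motion M F W \<and>
     (\<exists>\<sigma>. \<sigma> \<in> borel_measurable borel \<and>
        (\<forall>x. diffusion_poly d0 d1 d2 x \<ge> 0 \<longrightarrow> (\<sigma> x)\<^sup>2 / 2 = diffusion_poly d0 d1 d2 x) \<and>
        sde_solution M F W (drift a0 a1) \<sigma> X)"

definition steady_state :: "'a measure \<Rightarrow> (real \<Rightarrow> real) \<Rightarrow> (real \<Rightarrow> 'a \<Rightarrow> real) \<Rightarrow> bool" where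
  "steady_state M m X \<longleftrightarrow> (\<forall>t\<ge>0. distributed M lborel (X t) (\<lambda>x. ennreal (m x)))"

section \<open>Subordinators and time change\<close>

definition subordinator :: "'a measure \<Rightarrow> (real \<Rightarrow> 'a \<Rightarrow> real) \<Rightarrow> bool" where
  "subordinator M D \<longleftrightarrow>
     (\<forall>t\<ge>0. D t \<in> borel_measurable M) \<and>
     (\<forall>\<omega>\<in>space M. D 0 \<omega> = 0 \<and> mono_on {0..} (\<lambda>t. D t \<omega>) \<and>
        (\<forall>t\<ge>0. continuous (at_right t) (\<lambda>u. D u \<omega>))) \<and>
     (\<forall>t h. 0 \<le> t \<longrightarrow> 0 \<le> h \<longrightarrow>
        distr M borel (\<lambda>\<omega>. D (t + h) \<omega> - D t \<omega>) = distr M borel (D h)) \<and>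
     (\<forall>n \<tau>. 0 \<le> \<tau> 0 \<longrightarrow> (\<forall>i<n. \<tau> i < \<tau> (Suc i)) \<longrightarrow>
        prob_space.indep_vars M (\<lambda>_. borel)
          (\<lambda>i \<omega>. D (\<tau> (Suc i)) \<omega> - D (\<tau> i) \<omega>) {..<n::nat})"

definition laplace_exponent ::
  "'a measure \<Rightarrow> (real \<Rightarrow> 'a \<Rightarrow> real) \<Rightarrow> (real \<Rightarrow> real) \<Rightarrow> bool" where
  "laplace_exponent M D \<psi> \<longleftrightarrow>
     (\<forall>t\<ge>0. \<forall>s\<ge>0. (LINT \<omega>|M. exp (- s * D t \<omega>)) = exp (- t * \<psi> s))"

text \<open>The set is empty only on a null set if the subordinator is not identically zero; there the
  infimum is infinite and the value \<open>0\<close> is an arbitrary choice.\<close>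

definition inverse_subordinator :: "(real \<Rightarrow> 'a \<Rightarrow> real) \<Rightarrow> real \<Rightarrow> 'a \<Rightarrow> real" where
  "inverse_subordinator D t \<omega> =
     (if \<exists>\<tau>\<ge>0. D \<tau> \<omega> > t then Inf {\<tau>. 0 \<le> \<tau> \<and> D \<tau> \<omega> > t} else 0)"

definition indep_processes ::
  "'a measure \<Rightarrow> (real \<Rightarrow> 'a \<Rightarrow> real) \<Rightarrow> (real \<Rightarrow> 'a \<Rightarrow> real) \<Rightarrow> bool" where
  "indep_processes M X Y \<longleftrightarrow>
     prob_space.indep_var M
       (Pi\<^sub>M {0..} (\<lambda>_. borel)) (\<lambda>\<omega>. \<lambda>t\<in>{0..}. X t \<omega>)
       (Pi\<^sub>M {0..} (\<lambda>_. borel)) (\<lambda>\<omega>. \<lambda>t\<in>{0..}. Y t \<omega>)"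

definition time_change ::
  "(real \<Rightarrow> 'a \<Rightarrow> real) \<Rightarrow> (real \<Rightarrow> 'a \<Rightarrow> real) \<Rightarrow> real \<Rightarrow> 'a \<Rightarrow> real" where
  "time_change X E t \<omega> = X (E t \<omega>) \<omega>"

definition corr :: "'a measure \<Rightarrow> ('a \<Rightarrow> real) \<Rightarrow> ('a \<Rightarrow> real) \<Rightarrow> real" where
  "corr M Y Z =
     (LINT \<omega>|M. (Y \<omega> - integral\<^sup>L M Y) * (Z \<omega> - integral\<^sup>L M Z)) /
     sqrt ((LINT \<omega>|M. (Y \<omega> - integral\<^sup>L M Y)\<^sup>2) * (LINT \<omega>|M. (Z \<omega> - integral\<^sup>L M Z)\<^sup>2))"

section \<open>The functions in the correlation formula\<close>

definition h_fun :: "real \<Rightarrow> real \<Rightarrow> real \<Rightarrow> real \<Rightarrow> real \<Rightarrow> real" where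
  "h_fun c1 c2 \<beta>1 \<beta>2 y =
     1 / c2 * y powr (\<beta>2 - 1) *
       mittag_leffler (\<beta>2 - \<beta>1) \<beta>2 (- (c1 / c2) * y powr (\<beta>2 - \<beta>1))"

definition Phi_fun :: "real \<Rightarrow> real \<Rightarrow> real \<Rightarrow> real \<Rightarrow> real \<Rightarrow> real \<Rightarrow> real" where
  "Phi_fun c1 c2 \<beta>1 \<beta>2 \<theta> t =
     (\<Sum>r. (- (c1 * t powr (\<beta>2 - \<beta>1) / c2)) ^ r *
        gen_mittag_leffler (real (r + 1)) \<beta>2 ((\<beta>2 - \<beta>1) * real r + 1) (- (\<theta> * t powr \<beta>2 / c2)))
   - (\<Sum>r. (- (c1 * t powr (\<beta>2 - \<beta>1) / c2)) ^ (r + 1) *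
        gen_mittag_leffler (real (r + 1)) \<beta>2 ((\<beta>2 - \<beta>1) * real (r + 1) + 1)
          (- (\<theta> * t powr \<beta>2 / c2)))"

end

(* The correlation of the stationary Pearson diffusion is exp (- \<theta> |t - s|): by the martingale
   property of the Ito integral, c(t) = E [Y s * Y t], with Y the first eigenfunction evaluated along
   the diffusion, solves c(t) = 1 - \<theta> * (integral of c over [s, t]). By independence the correlation
   of the time-changed process is E [exp (- \<theta> (E(t) - E(s)))]. Writing
   exp (- \<theta> (E(t) - E(s))) = exp (- \<theta> E(t)) + \<theta> * (integral of exp (- \<theta> (E(t) - u)) over u < E(s)),
   where u < E(s) means D(u) <= s up to a null set of u, the simple Markov property of D at the
   deterministic time u turns the expectation into \<Phi>(t) + \<theta> * (integral of \<Phi>(t - y) U(dy) over [0, s])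
   with \<Phi>(t) = E [exp (- \<theta> E(t))] and U the potential measure of D. Both \<Phi> and U are governed
   by the \<theta>-potential measures, whose Laplace transform is 1 / (\<theta> + \<psi>); expanding this as a
   geometric series gives the Mittag-Leffler densities. *)
theory Submission
  imports Defs
begin

section \<open>The inverse Laplace transform of the resolvent\<close>

text \<open>\<open>Q 1\<close> has degree one, so inserting the diffusion into it is linear and no
  Ito formula is involved; orthonormality with \<open>Q 0\<close> makes the resulting process
  centred with variance one. The potential measure of \<open>D\<close> has infinite mass, and the
  geometric series for 1 / (\<theta> + \<psi>(z)) is controlled only for large z. Uniqueness of
  Laplace transforms is therefore used for integrable weights, compared only at the exponents z0 +
  n, and tested against continuous functions cut off at s; the damping exp(-z0 D) is undone on the
  compact interval [0, s]. One series with two parameters serves both functions: b = -\<theta>/c2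
  yields \<Phi>, b = 0 yields h. \<Phi> sums a double series by rows, the density sums it by
  diagonals; on the diagonals the second series of \<Phi> cancels a part of the first. All
  convergence rests on one bound for t^b / Gamma(b + 1) with a free parameter z, which turns the
  binomial sums into geometric series.\<close>

lemma gamma_kernel_laplace:
  assumes b: "b > 0" and z: "z > (0::real)"
  shows "has_bochner_integral lborel
    (\<lambda>y. indicator {0..} y * (exp (- z * y) * (y powr (b - 1) / Gamma b))) (z powr - b)"
proof -
  have "has_bochner_integral lborel (\<lambda>t. indicator {0..} t * t powr (b - 1) / exp t) (Gamma b)"
    using Gamma_conv_nn_integral_real[OF b] b
    by (intro has_bochner_integral_nn_integral) (auto simp: Gamma_real_pos less_imp_le)
  then have "has_bochner_integral lborel
      (\<lambda>y. indicator {0..} (0 + z * y) * (0 + z * y) powr (b - 1) / exp (0 + z * y)) (Gamma b /\<^sub>R \<bar>z\<bar>)"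
    by (subst (asm) lborel_has_bochner_integral_real_affine_iff[of z _ _ 0]) (use z in auto)
  then have "has_bochner_integral lborel
      (\<lambda>y. (z powr (1 - b) / Gamma b) *
        (indicator {0..} (0 + z * y) * (0 + z * y) powr (b - 1) / exp (0 + z * y)))
      ((z powr (1 - b) / Gamma b) * (Gamma b /\<^sub>R \<bar>z\<bar>))"
    by (rule has_bochner_integral_mult_right) 
  moreover have "(z powr (1 - b) / Gamma b) *
        (indicator {0..} (0 + z * y) * (0 + z * y) powr (b - 1) / exp (0 + z * y)) =
      indicator {0..} y * (exp (- z * y) * (y powr (b - 1) / Gamma b))" for y
  proof (cases "y > 0")
    case True
    have "z powr (1 - b) * z powr (b - 1) = 1"
      using z by (simp flip: powr_add)
    then show ?thesis using True z by (simp add: powr_mult exp_minus field_simps)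
  next
    case False
    then show ?thesis using z by (cases "y = 0") (auto simp: indicator_def zero_le_mult_iff)
  qed
  moreover have "(z powr (1 - b) / Gamma b) * (Gamma b /\<^sub>R \<bar>z\<bar>) = z powr - b"
    using z Gamma_real_pos[OF b] by (simp add: powr_diff powr_minus field_simps)
  ultimately show ?thesis by simp
qed

text \<open>The integral of \<open>y\<^sup>b e\<^sup>-\<^sup>z\<^sup>y / \<Gamma>(b + 1)\<close> over \<open>[t, \<infinity>)\<close> alone already gives this bound, which
  replaces Stirling's formula.\<close>

lemma powr_div_Gamma_le:
  assumes b: "b \<ge> 0" and z: "z > (0::real)" and t: "t > 0"
  shows "t powr b / Gamma (b + 1) \<le> exp (z * t) * z powr - b"
proof -
  have G: "Gamma (b + 1) > 0" using b by (simp add: Gamma_real_pos)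
  let ?f = "\<lambda>y. indicator {0..} y * (exp (- z * y) * (y powr b / Gamma (b + 1)))"
  \<comment> \<open>On \<open>{t..}\<close> the factor \<open>y powr b\<close> is at least
    \<open>t powr b\<close>, so \<open>?g\<close> lies below \<open>?f\<close>, and its integral is
    elementary.\<close>
  let ?g = "\<lambda>y. indicator {t..} y * exp (- z * y) * (t powr b / Gamma (b + 1))"
  have f: "has_bochner_integral lborel ?f (z powr - (b + 1))"
    using gamma_kernel_laplace[of "b + 1" z] b z by simp
  have "has_bochner_integral lborel (\<lambda>y. indicator {0..} y * (exp (- z * y) * (y powr (1 - 1) / Gamma 1))) (z powr - 1)"
    using gamma_kernel_laplace[of 1 z] z by simp
  then have "has_bochner_integral lborel (\<lambda>y. indicator {0..} (- t + 1 * y) * (exp (- z * (- t + 1 * y)) * ((- t + 1 * y) powr (1 - 1) / Gamma 1))) (z powr - 1 /\<^sub>R \<bar>1\<bar>)"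
    by (subst (asm) lborel_has_bochner_integral_real_affine_iff[of 1 _ _ "-t"]) auto
  then have "has_bochner_integral lborel (\<lambda>y. (exp (- z * t) * (t powr b / Gamma (b + 1))) *
     (indicator {0..} (- t + 1 * y) * (exp (- z * (- t + 1 * y)) * ((- t + 1 * y) powr (1 - 1) / Gamma 1))))
     ((exp (- z * t) * (t powr b / Gamma (b + 1))) * (z powr - 1 /\<^sub>R \<bar>1\<bar>))"
    by (rule has_bochner_integral_mult_right)
  \<comment> \<open>At \<open>y = t\<close> the two sides differ because
    \<open>0 powr 0 = 0\<close>, so the identity is claimed off this point only.\<close>
  moreover have "AE y in lborel. (exp (- z * t) * (t powr b / Gamma (b + 1))) *
     (indicator {0..} (- t + 1 * y) * (exp (- z * (- t + 1 * y)) * ((- t + 1 * y) powr (1 - 1) / Gamma 1))) = ?g y"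
    using AE_lborel_singleton[of t]
    by eventually_elim (auto simp: indicator_def algebra_simps simp flip: exp_add)
  ultimately have g: "has_bochner_integral lborel ?g (exp (- z * t) * (t powr b / Gamma (b + 1)) * (z powr - 1))"
    by (subst (asm) has_bochner_integral_cong_AE) auto
  have "exp (- z * t) * (t powr b / Gamma (b + 1)) * (z powr - 1) \<le> z powr - (b + 1)"
    unfolding has_bochner_integral_integral_eq[OF f, symmetric] has_bochner_integral_integral_eq[OF g, symmetric]
    using f g t G b by (intro integral_mono) (auto simp: indicator_def has_bochner_integral_iff intro!: divide_right_mono powr_mono2)
  also have "z powr - (b + 1) = z powr - b * z powr - 1"
    using powr_add[of z "- b" "- 1"] by simp
  finally have "exp (- z * t) * (t powr b / Gamma (b + 1)) \<le> z powr - b"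
    by (rule mult_right_le_imp_le) (use z in simp)
  then have "exp (z * t) * (exp (- z * t) * (t powr b / Gamma (b + 1))) \<le> exp (z * t) * z powr - b"
    by (rule mult_left_mono) simp
  then show ?thesis by (simp add: mult.assoc[symmetric] flip: exp_add)
qed

text \<open>The inverse Laplace transform of \<open>z\<^sup>-\<^sup>\<beta> (a z\<^sup>-\<^sup>\<gamma> + b z\<^sup>-\<^sup>\<beta>)\<^sup>n\<close>.\<close>

definition resolvent_term :: "real \<Rightarrow> real \<Rightarrow> real \<Rightarrow> real \<Rightarrow> nat \<Rightarrow> real \<Rightarrow> real" where
  "resolvent_term \<gamma> \<beta> a b n y =
     (\<Sum>j\<le>n. real (n choose j) * a ^ (n - j) * b ^ j *
        (y powr (\<beta> + \<gamma> * real (n - j) + \<beta> * real j - 1) / Gamma (\<beta> + \<gamma> * real (n - j) + \<beta> * real j)))"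

text \<open>Summing the geometric series formally, the Laplace transform of this function is
  z^(-\<beta>) / (1 - a z^(-\<gamma>) - b z^(-\<beta>)). For \<gamma> = \<beta>2 - \<beta>1, \<beta>
  = \<beta>2, a = -c1/c2 and b = -\<theta>/c2 this becomes c2 / (\<theta> + \<psi>(z)).\<close>

definition resolvent_density :: "real \<Rightarrow> real \<Rightarrow> real \<Rightarrow> real \<Rightarrow> real \<Rightarrow> real" where
  "resolvent_density \<gamma> \<beta> a b y = (\<Sum>n. resolvent_term \<gamma> \<beta> a b n y)"

text \<open>Entry (r, j) of the double series obtained by expanding the r-th Mittag-Leffler
  function; the binomial coefficient is the Pochhammer symbol (r + 1)_j over j!. The offset \<delta>
  is 0 for the first series of \<open>Phi_fun\<close>, \<gamma> for the second (up to a factor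
  \<open>a\<close>), and \<beta> for the primitive of \<open>resolvent_density\<close>.\<close>

definition mittag_leffler_coeff :: "real \<Rightarrow> real \<Rightarrow> real \<Rightarrow> real \<Rightarrow> real \<Rightarrow> real \<Rightarrow> nat \<Rightarrow> nat \<Rightarrow> real" where
  "mittag_leffler_coeff \<gamma> \<beta> \<delta> a b t r j = real ((r + j) choose j) * a ^ r * b ^ j *
     (t powr (\<delta> + \<gamma> * real r + \<beta> * real j) / Gamma (\<delta> + \<gamma> * real r + \<beta> * real j + 1))"

text \<open>Fubini for the family f(r, j), reindexed by (r, j) -> (r + j, j). Absolute summability
  is asked for along diagonals because there the binomial theorem gives a geometric bound, whereas
  \<open>Phi_fun\<close> is written by rows.\<close>

lemma suminf_rows_eq_diagonals:
  fixes f :: "nat \<Rightarrow> nat \<Rightarrow> real"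
  assumes s: "summable (\<lambda>n. \<Sum>j\<le>n. \<bar>f (n - j) j\<bar>)"
  shows "summable (f r)" and "summable (\<lambda>n. \<Sum>j\<le>n. f (n - j) j)"
    and "(\<lambda>r. \<Sum>j. f r j) sums (\<Sum>n. \<Sum>j\<le>n. f (n - j) j)"
proof -
  let ?D = "Sigma UNIV (\<lambda>n::nat. {..n})"
  let ?g = "\<lambda>(n, j). f (n - j) j" and ?f = "\<lambda>(r, j). f r j"
  have "(\<lambda>n. \<Sum>j\<le>n. \<bar>f (n - j) j\<bar>) summable_on UNIV"
    using s by (subst summable_on_UNIV_nonneg_real_iff) (auto intro: sum_nonneg)
  then have D: "(\<lambda>x. norm (?g x)) summable_on ?D"
    by (intro summable_on_SigmaI[where g = "\<lambda>n. \<Sum>j\<le>n. \<bar>f (n - j) j\<bar>"]) (auto intro: has_sum_finite)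
  then have D': "?g summable_on ?D" by (rule abs_summable_summable)
  have F: "?f summable_on UNIV \<times> UNIV"
    using D' by (subst summable_on_reindex_bij_witness[where T = ?D and h = ?g and j = "\<lambda>(r, j). (r + j, j)" and i = "\<lambda>(n, j). (n - j, j)"]) auto
  have eq: "infsum ?f (UNIV \<times> UNIV) = infsum ?g ?D"
    by (rule infsum_reindex_bij_witness[where j = "\<lambda>(r, j). (r + j, j)" and i = "\<lambda>(n, j). (n - j, j)"]) auto
  have row: "f r summable_on UNIV" for r
    using summable_on_SigmaD1[OF F] by simp
  show "summable (f r)" using row by (rule summable_on_imp_summable)
  have row': "(\<lambda>j. ?f (r, j)) summable_on UNIV" for r using row by simp
  have rows: "((\<lambda>r. infsum (\<lambda>j. ?f (r, j)) UNIV) has_sum infsum ?f (UNIV \<times> UNIV)) UNIV"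
    by (rule has_sum_SigmaD[OF has_sum_infsum[OF F]]) (use row' in auto)
  have "infsum (\<lambda>j. ?f (r, j)) UNIV = (\<Sum>j. f r j)" for r
    using has_sum_imp_sums[OF has_sum_infsum[OF row]] by (simp add: sums_iff)
  then have 1: "(\<lambda>r. \<Sum>j. f r j) sums infsum ?f (UNIV \<times> UNIV)"
    using has_sum_imp_sums[OF rows] by simp
  have "((\<lambda>n. \<Sum>j\<le>n. f (n - j) j) has_sum infsum ?g ?D) UNIV"
    by (rule has_sum_SigmaD[OF has_sum_infsum[OF D']]) (auto intro: has_sum_finite)
  then have 2: "(\<lambda>n. \<Sum>j\<le>n. f (n - j) j) sums infsum ?g ?D" by (rule has_sum_imp_sums)
  show "summable (\<lambda>n. \<Sum>j\<le>n. f (n - j) j)" using 2 by (rule sums_summable)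
  show "(\<lambda>r. \<Sum>j. f r j) sums (\<Sum>n. \<Sum>j\<le>n. f (n - j) j)"
    using 1 2 unfolding eq by (simp add: sums_iff)
qed

lemma has_bochner_integral_powr_Icc:
  assumes e: "e > 0" and t: "(t::real) \<ge> 0"
  shows "has_bochner_integral lborel (\<lambda>y. indicator {0..t} y * (y powr (e - 1) / Gamma e)) (t powr e / Gamma (e + 1))"
proof -
  have "((\<lambda>x. x powr (e - 1)) has_integral (t powr e / e)) {0..t}"
    using has_integral_powr_from_0[of "e - 1" t] e t by simp
  then have "nn_integral lborel (\<lambda>x. ennreal (indicator {0..t} x * x powr (e - 1))) = ennreal (t powr e / e)"
    using nn_integral_has_integral_lebesgue[of "{0..t}" "\<lambda>x. x powr (e - 1)" "t powr e / e"] by simp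
  then have "has_bochner_integral lborel (\<lambda>x. indicator {0..t} x * x powr (e - 1)) (t powr e / e)"
    using e by (intro has_bochner_integral_nn_integral) auto
  then have "has_bochner_integral lborel (\<lambda>x. (1 / Gamma e) * (indicator {0..t} x * x powr (e - 1))) ((1 / Gamma e) * (t powr e / e))"
    by (rule has_bochner_integral_mult_right)
  moreover have "Gamma (e + 1) = e * Gamma e" using e by (intro Gamma_plus1) auto
  ultimately show ?thesis by (simp add: mult_ac)
qed

section \<open>Convergence and Laplace transform of the resolvent series\<close>

context
  fixes \<gamma> \<beta> :: real
  assumes gam: "\<gamma> > 0" and bet: "\<beta> > 0"
begin

lemma exponent_pos: "\<beta> + \<gamma> * real k + \<beta> * real j > 0"
  using gam bet by (intro add_pos_nonneg) auto

lemma resolvent_term_abs_le: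
  "\<bar>resolvent_term \<gamma> \<beta> a b n y\<bar> \<le> resolvent_term \<gamma> \<beta> \<bar>a\<bar> \<bar>b\<bar> n y"
  unfolding resolvent_term_def
  by (rule order_trans[OF sum_abs])
    (auto intro!: sum_mono simp: abs_mult power_abs Gamma_real_pos[OF exponent_pos] less_imp_le
      simp del: of_nat_diff)

lemma sum_powr_exponent:
  assumes z: "z > 0"
  shows "(\<Sum>j\<le>n. real (n choose j) * a ^ (n - j) * b ^ j * z powr - (\<beta> + \<gamma> * real (n - j) + \<beta> * real j))
    = z powr - \<beta> * (a * z powr - \<gamma> + b * z powr - \<beta>) ^ n"
proof -
  have "z powr - (\<beta> + \<gamma> * real (n - j) + \<beta> * real j) = z powr - \<beta> * (z powr - \<gamma>) ^ (n - j) * (z powr - \<beta>) ^ j" for j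
    using z by (simp add: powr_realpow[symmetric] powr_powr flip: powr_add)
  then show ?thesis
    unfolding add.commute[of "a * _" "b * _"] binomial_ring sum_distrib_left
    by (intro sum.cong refl) (simp add: power_mult_distrib mult_ac del: of_nat_diff minus_add_distrib)
qed

lemma resolvent_term_laplace:
  assumes z: "z > 0"
  shows "has_bochner_integral lborel
    (\<lambda>y. indicator {0..} y * (exp (- z * y) * resolvent_term \<gamma> \<beta> a b n y))
    (z powr - \<beta> * (a * z powr - \<gamma> + b * z powr - \<beta>) ^ n)"
proof -
  let ?e = "\<lambda>j. \<beta> + \<gamma> * real (n - j) + \<beta> * real j"
  let ?c = "\<lambda>j. real (n choose j) * a ^ (n - j) * b ^ j"
  have "has_bochner_integral lborel
     (\<lambda>y. \<Sum>j\<le>n. ?c j * (indicator {0..} y * (exp (- z * y) * (y powr (?e j - 1) / Gamma (?e j)))))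
     (z powr - \<beta> * (a * z powr - \<gamma> + b * z powr - \<beta>) ^ n)"
    unfolding sum_powr_exponent[OF z, symmetric]
    by (intro has_bochner_integral_sum has_bochner_integral_mult_right gamma_kernel_laplace exponent_pos z)
  moreover have "(\<Sum>j\<le>n. ?c j * (indicator {0..} y * (exp (- z * y) * (y powr (?e j - 1) / Gamma (?e j)))))
     = indicator {0..} y * (exp (- z * y) * resolvent_term \<gamma> \<beta> a b n y)" for y
    unfolding resolvent_term_def sum_distrib_left by (intro sum.cong refl) (simp add: mult_ac)
  ultimately show ?thesis by simp
qed

text \<open>\<open>powr_div_Gamma_le\<close> is applied at \<open>exp 1 * z\<close> rather than at
  \<open>z\<close>: passing from Gamma(e + 1) to Gamma(e) costs a factor e, and the factor exp(-e)
  gained from the larger base absorbs it, since e exp(-e) <= 1. The remaining powers of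
  \<open>z\<close> sum to a binomial power.\<close>

lemma resolvent_term_bound:
  assumes a: "a \<ge> 0" and b: "b \<ge> 0" and z: "z > 0" and y: "y > 0"
  shows "resolvent_term \<gamma> \<beta> a b n y
    \<le> exp (exp 1 * z * y) / y * (z powr - \<beta> * (a * z powr - \<gamma> + b * z powr - \<beta>) ^ n)"
proof -
  have *: "y powr (e - 1) / Gamma e \<le> exp (exp 1 * z * y) / y * z powr - e" if e: "e > 0" for e
  proof -
    have "Gamma (e + 1) = e * Gamma e" using e by (intro Gamma_plus1) auto
    then have "y powr (e - 1) / Gamma e = e / y * (y powr e / Gamma (e + 1))"
      using e y Gamma_real_pos[OF e] by (simp add: powr_diff)
    also have "\<dots> \<le> e / y * (exp (exp 1 * z * y) * (exp 1 * z) powr - e)"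
      using e y z by (intro mult_left_mono powr_div_Gamma_le) auto
    also have "(exp 1 * z) powr - e = exp (- e) * z powr - e"
      using z by (simp add: powr_mult exp_powr_real)
    also have "e / y * (exp (exp 1 * z * y) * (exp (- e) * z powr - e)) =
        (e * exp (- e)) * (exp (exp 1 * z * y) / y * z powr - e)" by simp
    also have "\<dots> \<le> 1 * (exp (exp 1 * z * y) / y * z powr - e)"
      using exp_ge_add_one_self[of e] e y
      by (intro mult_right_mono) (auto simp: exp_minus field_simps simp del: exp_ge_add_one_self)
    finally show ?thesis by simp
  qed
  have "resolvent_term \<gamma> \<beta> a b n y \<le> (\<Sum>j\<le>n. real (n choose j) * a ^ (n - j) * b ^ j *
      (exp (exp 1 * z * y) / y * z powr - (\<beta> + \<gamma> * real (n - j) + \<beta> * real j)))"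
    unfolding resolvent_term_def using a b
    by (intro sum_mono mult_left_mono * exponent_pos mult_nonneg_nonneg) auto
  also have "\<dots> = exp (exp 1 * z * y) / y * (z powr - \<beta> * (a * z powr - \<gamma> + b * z powr - \<beta>) ^ n)"
    unfolding sum_powr_exponent[OF z, symmetric] sum_distrib_left by (intro sum.cong refl) simp
  finally show ?thesis .
qed

lemma eventually_ratio_less:
  assumes "c > 0"
  shows "\<forall>\<^sub>F z in at_top. a * z powr - \<gamma> + b * z powr - \<beta> < c"
proof -
  have "((\<lambda>z. a * z powr - \<gamma> + b * z powr - \<beta>) \<longlongrightarrow> a * 0 + b * 0) at_top"
    using gam bet by (intro tendsto_intros tendsto_neg_powr filterlim_ident) auto
  then show ?thesis by (rule order_tendstoD) (use assms in simp)
qed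

text \<open>\<open>resolvent_term_bound\<close> holds for every \<open>z > 0\<close>, so
  \<open>z\<close> is a free parameter: taking it large makes the geometric ratio less than 1,
  whatever \<open>a\<close> and \<open>b\<close> are.\<close>

lemma summable_resolvent_term_abs:
  assumes y: "y > 0"
  shows "summable (\<lambda>n. \<bar>resolvent_term \<gamma> \<beta> a b n y\<bar>)"
proof -
  obtain z where z: "z > 0" and q: "\<bar>a\<bar> * z powr - \<gamma> + \<bar>b\<bar> * z powr - \<beta> < 1"
    using eventually_happens'[OF _ eventually_conj[OF eventually_gt_at_top[of 0] eventually_ratio_less[of 1 "\<bar>a\<bar>" "\<bar>b\<bar>"]]]
    by auto
  have "summable (\<lambda>n. exp (exp 1 * z * y) / y * (z powr - \<beta> * (\<bar>a\<bar> * z powr - \<gamma> + \<bar>b\<bar> * z powr - \<beta>) ^ n))"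
    using q by (intro summable_mult summable_geometric) auto
  then show ?thesis
    by (rule summable_comparison_test')
      (use resolvent_term_bound[OF _ _ z y] in \<open>auto intro!: order_trans[OF resolvent_term_abs_le]\<close>)
qed

lemma borel_measurable_resolvent_term [measurable]: "resolvent_term \<gamma> \<beta> a b n \<in> borel_measurable borel"
  unfolding resolvent_term_def by measurable

lemma borel_measurable_resolvent_density [measurable]: "resolvent_density \<gamma> \<beta> a b \<in> borel_measurable borel"
  unfolding resolvent_density_def by measurable

text \<open>Domination by exp(-z y) bounds the L1 norm of the n-th term by the Laplace transform of
  the same term with |a| and |b|, an explicit geometric sequence; this justifies exchanging sum and
  integral. The weights used are exponentials, for Laplace transforms, and indicators of half-lines
  \<open>{..t}\<close>, for primitives.\<close>

lemma
  assumes z: "z > 0" and q: "\<bar>a\<bar> * z powr - \<gamma> + \<bar>b\<bar> * z powr - \<beta> < 1" and w: "\<And>y. y \<ge> 0 \<Longrightarrow> \<bar>w y\<bar> \<le> C * exp (- z * y)"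
    and [measurable]: "w \<in> borel_measurable borel"
  shows integrable_resolvent_density: "integrable lborel (\<lambda>y. indicator {0..} y * (w y * resolvent_density \<gamma> \<beta> a b y))"
    and sums_resolvent_density: "(\<lambda>n. LINT y|lborel. indicator {0..} y * (w y * resolvent_term \<gamma> \<beta> a b n y)) sums
      (LINT y|lborel. indicator {0..} y * (w y * resolvent_density \<gamma> \<beta> a b y))"
proof -
  let ?f = "\<lambda>n y. indicator {0..} y * (w y * resolvent_term \<gamma> \<beta> a b n y)"
  let ?g = "\<lambda>n y. C * (indicator {0..} y * (exp (- z * y) * resolvent_term \<gamma> \<beta> \<bar>a\<bar> \<bar>b\<bar> n y))"
  have g: "has_bochner_integral lborel (?g n) (C * (z powr - \<beta> * (\<bar>a\<bar> * z powr - \<gamma> + \<bar>b\<bar> * z powr - \<beta>) ^ n))" for n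
    by (intro has_bochner_integral_mult_right resolvent_term_laplace z)
  have le: "\<bar>?f n y\<bar> \<le> ?g n y" for n y
  proof (cases "y \<ge> 0")
    case True
    have "\<bar>w y\<bar> * \<bar>resolvent_term \<gamma> \<beta> a b n y\<bar> \<le> (C * exp (- z * y)) * resolvent_term \<gamma> \<beta> \<bar>a\<bar> \<bar>b\<bar> n y"
      using order_trans[OF abs_ge_zero w[OF True]]
      by (intro mult_mono w True resolvent_term_abs_le) auto
    then show ?thesis using True by (simp add: abs_mult mult_ac)
  qed simp
  have f: "integrable lborel (?f n)" for n
    by (rule Bochner_Integration.integrable_bound[OF integrable.intros, OF g[of n]])
      (use le in \<open>auto intro!: always_eventually simp: order_trans[OF _ abs_ge_self]\<close>)
  have ae: "AE y in lborel. summable (\<lambda>n. norm (?f n y))"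
    using AE_lborel_singleton[of 0]
  proof eventually_elim
    case (elim y)
    show ?case
    proof (cases "y \<ge> 0")
      case True
      then have "summable (\<lambda>n. \<bar>w y\<bar> * \<bar>resolvent_term \<gamma> \<beta> a b n y\<bar>)"
        using elim by (intro summable_mult summable_resolvent_term_abs) auto
      then show ?thesis using True by (simp add: abs_mult)
    qed simp
  qed
  have sm: "summable (\<lambda>n. LINT y|lborel. norm (?f n y))"
  proof (rule summable_comparison_test')
    show "summable (\<lambda>n. C * (z powr - \<beta> * (\<bar>a\<bar> * z powr - \<gamma> + \<bar>b\<bar> * z powr - \<beta>) ^ n))"
      using q by (intro summable_mult summable_geometric) auto
    show "norm (LINT y|lborel. norm (?f n y)) \<le> C * (z powr - \<beta> * (\<bar>a\<bar> * z powr - \<gamma> + \<bar>b\<bar> * z powr - \<beta>) ^ n)" for n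
      unfolding has_bochner_integral_integral_eq[OF g, symmetric]
      by (subst real_norm_def, subst abs_of_nonneg, simp, rule integral_mono)
        (use le f integrable.intros[OF g[of n]] in auto)
  qed
  have eq: "(\<Sum>n. ?f n y) = indicator {0..} y * (w y * resolvent_density \<gamma> \<beta> a b y)" if "y \<noteq> 0" for y
    using summable_rabs_cancel[OF summable_resolvent_term_abs[of y a b]] that
    by (cases "y > 0") (auto simp: resolvent_density_def suminf_mult)
  have ae2: "AE y in lborel. (\<Sum>n. ?f n y) = indicator {0..} y * (w y * resolvent_density \<gamma> \<beta> a b y)"
    using AE_lborel_singleton[of 0] by eventually_elim (rule eq)
  show "integrable lborel (\<lambda>y. indicator {0..} y * (w y * resolvent_density \<gamma> \<beta> a b y))"
    by (rule integrable_cong_AE_imp[OF integrable_suminf[OF f ae sm]]) (use ae2 in \<open>auto elim: AE_mp\<close>)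
  have "(\<lambda>n. integral\<^sup>L lborel (?f n)) sums (LINT y|lborel. (\<Sum>n. ?f n y))"
    by (rule sums_integral[OF f ae sm])
  also have "(LINT y|lborel. (\<Sum>n. ?f n y)) = (LINT y|lborel. indicator {0..} y * (w y * resolvent_density \<gamma> \<beta> a b y))"
    using ae2 by (intro integral_cong_AE) auto
  finally show "(\<lambda>n. integral\<^sup>L lborel (?f n)) sums
      (LINT y|lborel. indicator {0..} y * (w y * resolvent_density \<gamma> \<beta> a b y))" .
qed

lemma resolvent_density_laplace:
  assumes z: "z > 0" and q: "\<bar>a\<bar> * z powr - \<gamma> + \<bar>b\<bar> * z powr - \<beta> < 1"
  shows "(LINT y|lborel. indicator {0..} y * (exp (- z * y) * resolvent_density \<gamma> \<beta> a b y)) =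
    z powr - \<beta> / (1 - (a * z powr - \<gamma> + b * z powr - \<beta>))"
proof -
  have "\<bar>a * z powr - \<gamma> + b * z powr - \<beta>\<bar> < 1"
    using q abs_triangle_ineq[of "a * z powr - \<gamma>" "b * z powr - \<beta>"] by (simp add: abs_mult)
  then have "(\<lambda>n. z powr - \<beta> * (a * z powr - \<gamma> + b * z powr - \<beta>) ^ n) sums
      (z powr - \<beta> * (1 / (1 - (a * z powr - \<gamma> + b * z powr - \<beta>))))"
    by (intro sums_mult geometric_sums) auto
  moreover have "(\<lambda>n. z powr - \<beta> * (a * z powr - \<gamma> + b * z powr - \<beta>) ^ n) sums
      (LINT y|lborel. indicator {0..} y * (exp (- z * y) * resolvent_density \<gamma> \<beta> a b y))"
    using sums_resolvent_density[OF z q, of "\<lambda>y. exp (- z * y)" 1]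
    by (simp add: has_bochner_integral_integral_eq[OF resolvent_term_laplace[OF z], simplified])
  ultimately show ?thesis by (simp add: sums_iff)
qed

text \<open>The same binomial sum as for \<open>resolvent_term\<close>, with the offset \<delta> in
  place of \<beta> in the exponents; the factor \<open>z powr - \<delta> * z powr \<beta>\<close>
  accounts for the change.\<close>

lemma sum_mittag_leffler_coeff_bound:
  assumes a: "a \<ge> 0" and b: "b \<ge> 0" and z: "z > 0" and t: "t > 0" and d: "\<delta> \<ge> 0"
  shows "(\<Sum>j\<le>n. mittag_leffler_coeff \<gamma> \<beta> \<delta> a b t (n - j) j) \<le>
    exp (z * t) * z powr - \<delta> * z powr \<beta> * (z powr - \<beta> * (a * z powr - \<gamma> + b * z powr - \<beta>) ^ n)"
proof -
  have "(\<Sum>j\<le>n. mittag_leffler_coeff \<gamma> \<beta> \<delta> a b t (n - j) j) \<le> (\<Sum>j\<le>n. real (n choose j) * a ^ (n - j) * b ^ j *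
      (exp (z * t) * z powr - (\<delta> + \<gamma> * real (n - j) + \<beta> * real j)))"
  proof (rule sum_mono)
    fix j assume "j \<in> {..n}"
    then have "n - j + j = n" by simp
    then show "mittag_leffler_coeff \<gamma> \<beta> \<delta> a b t (n - j) j \<le> real (n choose j) * a ^ (n - j) * b ^ j *
      (exp (z * t) * z powr - (\<delta> + \<gamma> * real (n - j) + \<beta> * real j))"
      unfolding mittag_leffler_coeff_def \<open>n - j + j = n\<close> using a b z t d gam bet
      by (intro mult_left_mono powr_div_Gamma_le mult_nonneg_nonneg add_nonneg_nonneg) auto
  qed
  also have "\<dots> = exp (z * t) * z powr - \<delta> * z powr \<beta> * (z powr - \<beta> * (a * z powr - \<gamma> + b * z powr - \<beta>) ^ n)"
  proof -
    have "z powr - (\<delta> + e + f) = z powr - \<delta> * z powr \<beta> * z powr - (\<beta> + e + f)" for e f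
      unfolding powr_add[symmetric] by (rule arg_cong[where f = "\<lambda>x. z powr x"]) simp
    then show ?thesis
      unfolding sum_powr_exponent[OF z, symmetric] sum_distrib_left by (intro sum.cong refl) simp
  qed
  finally show ?thesis .
qed

lemma summable_sum_mittag_leffler_coeff:
  assumes t: "t > 0" and d: "\<delta> \<ge> 0"
  shows "summable (\<lambda>n. \<Sum>j\<le>n. \<bar>mittag_leffler_coeff \<gamma> \<beta> \<delta> a b t (n - j) j\<bar>)"
proof -
  obtain z where z: "z > 0" and q: "\<bar>a\<bar> * z powr - \<gamma> + \<bar>b\<bar> * z powr - \<beta> < 1"
    using eventually_happens'[OF _ eventually_conj[OF eventually_gt_at_top[of 0] eventually_ratio_less[of 1 "\<bar>a\<bar>" "\<bar>b\<bar>"]]]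
    by auto
  have G: "Gamma (\<delta> + \<gamma> * real r + \<beta> * real j + 1) > 0" for r j
    using d gam bet by (intro Gamma_real_pos add_nonneg_pos add_nonneg_nonneg) auto
  have eq: "\<bar>mittag_leffler_coeff \<gamma> \<beta> \<delta> a b t r j\<bar> = mittag_leffler_coeff \<gamma> \<beta> \<delta> \<bar>a\<bar> \<bar>b\<bar> t r j" for r j
    using G[of r j] by (simp add: mittag_leffler_coeff_def abs_mult power_abs)
  have "summable (\<lambda>n. exp (z * t) * z powr - \<delta> * z powr \<beta> * (z powr - \<beta> * (\<bar>a\<bar> * z powr - \<gamma> + \<bar>b\<bar> * z powr - \<beta>) ^ n))"
    using q by (intro summable_mult summable_geometric) auto
  moreover have "norm (\<Sum>j\<le>n. \<bar>mittag_leffler_coeff \<gamma> \<beta> \<delta> a b t (n - j) j\<bar>) \<le>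
      exp (z * t) * z powr - \<delta> * z powr \<beta> * (z powr - \<beta> * (\<bar>a\<bar> * z powr - \<gamma> + \<bar>b\<bar> * z powr - \<beta>) ^ n)" for n
    using sum_mittag_leffler_coeff_bound[OF _ _ z t d, of "\<bar>a\<bar>" "\<bar>b\<bar>" n]
    by (simp add: sum_nonneg flip: eq)
  ultimately show ?thesis by (rule summable_comparison_test')
qed

text \<open>Termwise integration: the primitive of y^(e - 1) / Gamma(e) is t^e / Gamma(e + 1), which
  is the coefficient with offset \<beta>. The indicator of \<open>{..t}\<close> is an admissible
  weight because it is at most exp(z t) exp(-z y).\<close>

lemma resolvent_density_integral_Icc:
  assumes t: "t \<ge> 0"
  shows "(LINT y|lborel. indicator {0..t} y * resolvent_density \<gamma> \<beta> a b y) =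
    (\<Sum>n. \<Sum>j\<le>n. mittag_leffler_coeff \<gamma> \<beta> \<beta> a b t (n - j) j)"
proof -
  obtain z where z: "z > 0" and q: "\<bar>a\<bar> * z powr - \<gamma> + \<bar>b\<bar> * z powr - \<beta> < 1"
    using eventually_happens'[OF _ eventually_conj[OF eventually_gt_at_top[of 0] eventually_ratio_less[of 1 "\<bar>a\<bar>" "\<bar>b\<bar>"]]]
    by auto
  have ind: "indicator {0..} y * (indicator {..t} y * u) = indicator {0..t} y * (u::real)" for y u
    by (auto simp: indicator_def)
  have "(\<lambda>n. LINT y|lborel. indicator {0..t} y * resolvent_term \<gamma> \<beta> a b n y) sums
      (LINT y|lborel. indicator {0..t} y * resolvent_density \<gamma> \<beta> a b y)"
    using sums_resolvent_density[OF z q, of "indicator {..t}" "exp (z * t)"] z unfolding ind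
    by (auto simp: indicator_def simp flip: exp_add)
  moreover have "(LINT y|lborel. indicator {0..t} y * resolvent_term \<gamma> \<beta> a b n y) =
      (\<Sum>j\<le>n. mittag_leffler_coeff \<gamma> \<beta> \<beta> a b t (n - j) j)" for n
  proof (rule has_bochner_integral_integral_eq)
    let ?e = "\<lambda>j. \<beta> + \<gamma> * real (n - j) + \<beta> * real j"
    let ?c = "\<lambda>j. real (n choose j) * a ^ (n - j) * b ^ j"
    have "has_bochner_integral lborel
       (\<lambda>y. \<Sum>j\<le>n. ?c j * (indicator {0..t} y * (y powr (?e j - 1) / Gamma (?e j))))
       (\<Sum>j\<le>n. ?c j * (t powr ?e j / Gamma (?e j + 1)))"
      by (intro has_bochner_integral_sum has_bochner_integral_mult_right has_bochner_integral_powr_Icc exponent_pos t)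
    moreover have "(\<Sum>j\<le>n. ?c j * (indicator {0..t} y * (y powr (?e j - 1) / Gamma (?e j)))) =
        indicator {0..t} y * resolvent_term \<gamma> \<beta> a b n y" for y
      unfolding resolvent_term_def sum_distrib_left by (intro sum.cong refl) simp
    moreover have "(\<Sum>j\<le>n. ?c j * (t powr ?e j / Gamma (?e j + 1))) = (\<Sum>j\<le>n. mittag_leffler_coeff \<gamma> \<beta> \<beta> a b t (n - j) j)"
      by (intro sum.cong refl) (simp add: mittag_leffler_coeff_def)
    ultimately show "has_bochner_integral lborel (\<lambda>y. indicator {0..t} y * resolvent_term \<gamma> \<beta> a b n y)
        (\<Sum>j\<le>n. mittag_leffler_coeff \<gamma> \<beta> \<beta> a b t (n - j) j)" by simp
  qed
  ultimately show ?thesis by (simp add: sums_iff)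
qed

text \<open>Pascal's rule on the diagonals of the double series.\<close>

lemma diagonal_mittag_leffler_Suc:
  "(\<Sum>j\<le>Suc n. mittag_leffler_coeff \<gamma> \<beta> 0 a b t (Suc n - j) j) =
    a * (\<Sum>j\<le>n. mittag_leffler_coeff \<gamma> \<beta> \<gamma> a b t (n - j) j) +
    b * (\<Sum>j\<le>n. mittag_leffler_coeff \<gamma> \<beta> \<beta> a b t (n - j) j)"
proof -
  let ?G = "\<lambda>r j. a ^ r * b ^ j * (t powr (\<gamma> * real r + \<beta> * real j) / Gamma (\<gamma> * real r + \<beta> * real j + 1))"
  let ?m = "mittag_leffler_coeff \<gamma> \<beta>"
  have m0: "?m 0 a b t (N - j) j = real (N choose j) * ?G (N - j) j" if "j \<le> N" for N j
    using that by (simp add: mittag_leffler_coeff_def mult.assoc del: of_nat_diff)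
  have mg: "a * ?m \<gamma> a b t (n - j) j = real (n choose j) * ?G (Suc n - j) j" if "j \<le> n" for j
    using that by (simp add: mittag_leffler_coeff_def Suc_diff_le algebra_simps del: of_nat_diff)
  have mb: "b * ?m \<beta> a b t (n - j) j = real (n choose j) * ?G (n - j) (Suc j)" if "j \<le> n" for j
    using that by (simp add: mittag_leffler_coeff_def algebra_simps del: of_nat_diff)
  have "(\<Sum>j\<le>Suc n. ?m 0 a b t (Suc n - j) j) = (\<Sum>j\<le>Suc n. real (Suc n choose j) * ?G (Suc n - j) j)"
    by (intro sum.cong refl m0) auto
  also have "\<dots> = ?G (Suc n) 0 + (\<Sum>j\<le>n. real (Suc n choose Suc j) * ?G (n - j) (Suc j))"
    by (subst sum.atMost_Suc_shift) simp
  also have "(\<Sum>j\<le>n. real (Suc n choose Suc j) * ?G (n - j) (Suc j)) =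
      (\<Sum>j\<le>n. real (n choose Suc j) * ?G (Suc n - Suc j) (Suc j)) + (\<Sum>j\<le>n. real (n choose j) * ?G (n - j) (Suc j))"
    unfolding sum.distrib[symmetric] by (intro sum.cong refl) (simp only: binomial_Suc_Suc of_nat_add diff_Suc_Suc, simp only: algebra_simps)
  \<comment> \<open>The isolated term is the entry \<open>j = 0\<close>, with coefficient
    \<open>n choose 0 = 1\<close>; the entry \<open>j = Suc n\<close> has coefficient 0 and is
    dropped next.\<close>
  also have "?G (Suc n) 0 + ((\<Sum>j\<le>n. real (n choose Suc j) * ?G (Suc n - Suc j) (Suc j)) + (\<Sum>j\<le>n. real (n choose j) * ?G (n - j) (Suc j)))
      = (\<Sum>j\<le>Suc n. real (n choose j) * ?G (Suc n - j) j) + (\<Sum>j\<le>n. real (n choose j) * ?G (n - j) (Suc j))"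
    unfolding sum.atMost_Suc_shift[of "\<lambda>j. real (n choose j) * ?G (Suc n - j) j" n] by simp
  also have "(\<Sum>j\<le>Suc n. real (n choose j) * ?G (Suc n - j) j) = (\<Sum>j\<le>n. real (n choose j) * ?G (Suc n - j) j)"
    by simp
  also have "\<dots> = a * (\<Sum>j\<le>n. ?m \<gamma> a b t (n - j) j)"
    unfolding sum_distrib_left by (intro sum.cong refl mg[symmetric]) auto
  also have "(\<Sum>j\<le>n. real (n choose j) * ?G (n - j) (Suc j)) = b * (\<Sum>j\<le>n. ?m \<beta> a b t (n - j) j)"
    unfolding sum_distrib_left by (intro sum.cong refl mb[symmetric]) auto
  finally show ?thesis .
qed

end

section \<open>The functions h and \<Phi> in terms of the resolvent density\<close>

lemma h_fun_eq_resolvent_density: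
  assumes "c2 > 0" "0 < \<beta>1" "\<beta>1 < \<beta>2" "y > 0"
  shows "h_fun c1 c2 \<beta>1 \<beta>2 y = resolvent_density (\<beta>2 - \<beta>1) \<beta>2 (- (c1 / c2)) 0 y / c2"
proof -
  have gb: "\<beta>2 - \<beta>1 > 0" "\<beta>2 > 0" using assms by auto
  let ?t = "\<lambda>n. (- (c1 / c2) * y powr (\<beta>2 - \<beta>1)) ^ n / Gamma ((\<beta>2 - \<beta>1) * real n + \<beta>2)"
  have eq: "resolvent_term (\<beta>2 - \<beta>1) \<beta>2 (- (c1 / c2)) 0 n y = y powr (\<beta>2 - 1) * ?t n" for n
  proof -
    \<comment> \<open>Here \<open>b = 0\<close>, which is the case \<theta> = 0: since
      \<open>0 ^ 0 = 1\<close>, only the entry \<open>j = 0\<close> survives, and the ordinary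
      Mittag-Leffler series remains.\<close>
    have "resolvent_term (\<beta>2 - \<beta>1) \<beta>2 (- (c1 / c2)) 0 n y =
        (\<Sum>j\<in>{0}. real (n choose j) * (- (c1 / c2)) ^ (n - j) * 0 ^ j *
        (y powr (\<beta>2 + (\<beta>2 - \<beta>1) * real (n - j) + \<beta>2 * real j - 1) / Gamma (\<beta>2 + (\<beta>2 - \<beta>1) * real (n - j) + \<beta>2 * real j)))"
      unfolding resolvent_term_def by (rule sum.mono_neutral_right) auto
    also have "\<dots> = (- (c1 / c2)) ^ n * (y powr ((\<beta>2 - 1) + (\<beta>2 - \<beta>1) * real n) / Gamma (\<beta>2 + (\<beta>2 - \<beta>1) * real n))"
      by (simp add: algebra_simps)
    also have "y powr ((\<beta>2 - 1) + (\<beta>2 - \<beta>1) * real n) = y powr (\<beta>2 - 1) * (y powr (\<beta>2 - \<beta>1)) ^ n"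
      using assms(4) by (simp add: powr_add powr_powr flip: powr_realpow)
    finally show ?thesis by (simp only: power_mult_distrib add.commute[of \<beta>2] times_divide_eq_right mult_ac)
  qed
  have "summable (\<lambda>n. y powr (\<beta>2 - 1) * ?t n)"
    using summable_rabs_cancel[OF summable_resolvent_term_abs[OF gb \<open>y > 0\<close>, of "- (c1 / c2)" 0]] unfolding eq .
  then have "summable ?t" by (rule summable_mult_D) (use assms in auto)
  then have "(\<Sum>n. y powr (\<beta>2 - 1) * ?t n) = y powr (\<beta>2 - 1) * (\<Sum>n. ?t n)" by (rule suminf_mult)
  then show ?thesis
    by (simp add: h_fun_def mittag_leffler_def gen_mittag_leffler_def resolvent_density_def eq
        pochhammer_fact[symmetric])
qed

text \<open>Time 0 is separate because \<open>0 powr 0 = 0\<close> would turn the leading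
  coefficient of the double series, which is 1 for \<open>t > 0\<close>, into 0. In
  \<open>Phi_fun\<close> itself that place is taken by a natural power
  \<open>_ ^ 0 = 1\<close>.\<close>

lemma Phi_fun_0: "Phi_fun c1 c2 \<beta>1 \<beta>2 \<theta> 0 = 1"
proof -
  have "gen_mittag_leffler 1 \<beta>2 1 0 = (1::real)"
    unfolding gen_mittag_leffler_def by (subst suminf_finite[of "{0}"]) auto
  then show ?thesis
    unfolding Phi_fun_def by (subst suminf_finite[of "{0}"]) auto
qed

lemma gen_mittag_leffler_eq_row:
  assumes gb: "\<gamma> > 0" "\<beta> > 0" and t: "t > 0" and d: "\<delta> \<ge> 0"
  shows "(a * t powr \<gamma>) ^ r * gen_mittag_leffler (real (r + 1)) \<beta> (\<delta> + \<gamma> * real r + 1) (b * t powr \<beta>) * t powr \<delta> =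
    (\<Sum>j. mittag_leffler_coeff \<gamma> \<beta> \<delta> a b t r j)"
proof -
  let ?g = "\<lambda>j. pochhammer (real (r + 1)) j * (b * t powr \<beta>) ^ j / (fact j * Gamma (\<beta> * of_nat j + (\<delta> + \<gamma> * real r + 1)))"
  have "real ((r + j) choose j) = pochhammer (real (r + 1)) j / fact j" for j
    unfolding binomial_gbinomial gbinomial_pochhammer' by (simp add: add_ac)
  then have eq: "mittag_leffler_coeff \<gamma> \<beta> \<delta> a b t r j = ((a * t powr \<gamma>) ^ r * t powr \<delta>) * ?g j" for j
    using t by (simp add: mittag_leffler_coeff_def powr_add power_mult_distrib powr_power mult_ac add_ac)
  show ?thesis
  proof (cases "(a * t powr \<gamma>) ^ r = 0")
    \<comment> \<open>With a vanishing prefactor, summability of \<open>?g\<close> cannot be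
      obtained by cancelling it, but both sides are 0.\<close>
    case True
    then show ?thesis by (simp only: eq mult_zero_left suminf_zero)
  next
    case False
    have "summable (\<lambda>j. ((a * t powr \<gamma>) ^ r * t powr \<delta>) * ?g j)"
      using suminf_rows_eq_diagonals(1)[OF summable_sum_mittag_leffler_coeff[OF gb t d], of a b r]
      unfolding eq .
    then have "summable ?g" by (rule summable_mult_D) (use False t in auto)
    then have "(\<Sum>j. c * ?g j) = c * (\<Sum>j. ?g j)" for c :: real by (rule suminf_mult)
    then show ?thesis unfolding eq gen_mittag_leffler_def by simp
  qed
qed

text \<open>Write S_\<delta> for the sum of the double series with offset \<delta>. The first series
  of \<open>Phi_fun\<close> is S_0, the second is a S_\<gamma>, and Pascal's rule on the diagonals
  gives S_0 = 1 + a S_\<gamma> + b S_\<beta>. The difference is 1 + b S_\<beta>, and S_\<beta> is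
  the integral of the resolvent density. On the Laplace side this is (1 - \<theta> / (\<theta> +
  \<psi>(z))) / z.\<close>

lemma Phi_fun_eq_resolvent:
  assumes c2: "c2 > 0" and "0 < \<beta>1" "\<beta>1 < \<beta>2" and t: "t \<ge> 0"
  shows "Phi_fun c1 c2 \<beta>1 \<beta>2 \<theta> t =
    1 - \<theta> / c2 * (LINT y|lborel. indicator {0..t} y * resolvent_density (\<beta>2 - \<beta>1) \<beta>2 (- (c1 / c2)) (- (\<theta> / c2)) y)"
proof (cases "t = 0")
  case True
  have "(LINT y|lborel. indicator {0..0} y * resolvent_density (\<beta>2 - \<beta>1) \<beta>2 (- (c1 / c2)) (- (\<theta> / c2)) y) = 0"
    using AE_lborel_singleton[of 0] by (intro integral_eq_zero_AE) (auto elim: eventually_mono)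
  then show ?thesis using True by (simp add: Phi_fun_0)
next
  case False
  then have t: "t > 0" using t by simp
  define \<gamma> where "\<gamma> = \<beta>2 - \<beta>1"
  define a where "a = - (c1 / c2)"
  define b where "b = - (\<theta> / c2)"
  have gb: "\<gamma> > 0" "\<beta>2 > 0" using assms by (auto simp: \<gamma>_def)
  let ?m = "\<lambda>\<delta>. mittag_leffler_coeff \<gamma> \<beta>2 \<delta> a b t"
  let ?D = "\<lambda>\<delta> n. \<Sum>j\<le>n. ?m \<delta> (n - j) j"
  note sum = summable_sum_mittag_leffler_coeff[OF gb t, where a = a and b = b]
  note rows = suminf_rows_eq_diagonals[OF sum]
  have gam0: "0 \<le> \<gamma>" "0 \<le> \<beta>2" "0 \<le> (0::real)" using gb by auto
  have "(\<Sum>r. (- (c1 * t powr (\<beta>2 - \<beta>1) / c2)) ^ r *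
        gen_mittag_leffler (real (r + 1)) \<beta>2 ((\<beta>2 - \<beta>1) * real r + 1) (- (\<theta> * t powr \<beta>2 / c2))) = (\<Sum>r. \<Sum>j. ?m 0 r j)"
    using t unfolding gen_mittag_leffler_eq_row[OF gb t gam0(3), symmetric]
    by (intro suminf_cong) (simp add: a_def b_def \<gamma>_def)
  also have "\<dots> = (\<Sum>n. ?D 0 n)"
    using rows(3)[OF gam0(3)] by (simp add: sums_iff)
  also have "\<dots> = (\<Sum>n. ?D 0 (Suc n)) + ?D 0 0"
    using suminf_split_head[OF rows(2)[OF gam0(3)]] by simp
  also have "(\<Sum>n. ?D 0 (Suc n)) = a * (\<Sum>n. ?D \<gamma> n) + b * (\<Sum>n. ?D \<beta>2 n)"
    unfolding diagonal_mittag_leffler_Suc[OF gb]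
    using rows(2)[OF gam0(1)] rows(2)[OF gam0(2)]
    by (subst suminf_add[symmetric]) (auto intro: summable_mult simp: suminf_mult)
  also have "?D 0 0 = 1" using t by (simp add: mittag_leffler_coeff_def)
  also have "(\<Sum>n. ?D \<gamma> n) = (\<Sum>r. \<Sum>j. ?m \<gamma> r j)"
    using rows(3)[OF gam0(1)] by (simp add: sums_iff)
  also have "a * \<dots> = (\<Sum>r. a * (\<Sum>j. ?m \<gamma> r j))"
    using rows(3)[OF gam0(1)] by (intro suminf_mult[symmetric]) (simp add: sums_iff)
  also have "\<dots> = (\<Sum>r. (- (c1 * t powr (\<beta>2 - \<beta>1) / c2)) ^ (r + 1) *
        gen_mittag_leffler (real (r + 1)) \<beta>2 ((\<beta>2 - \<beta>1) * real (r + 1) + 1) (- (\<theta> * t powr \<beta>2 / c2)))"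
  proof (intro suminf_cong)
    fix r
    have "\<gamma> + \<gamma> * real r + 1 = (\<beta>2 - \<beta>1) * real (r + 1) + 1" by (simp add: \<gamma>_def algebra_simps)
    then show "a * (\<Sum>j. ?m \<gamma> r j) = (- (c1 * t powr (\<beta>2 - \<beta>1) / c2)) ^ (r + 1) *
        gen_mittag_leffler (real (r + 1)) \<beta>2 ((\<beta>2 - \<beta>1) * real (r + 1) + 1) (- (\<theta> * t powr \<beta>2 / c2))"
      unfolding gen_mittag_leffler_eq_row[OF gb t gam0(1), symmetric] by (simp add: a_def b_def \<gamma>_def)
  qed
  finally have "Phi_fun c1 c2 \<beta>1 \<beta>2 \<theta> t = 1 + b * (\<Sum>n. ?D \<beta>2 n)"
    unfolding Phi_fun_def by linarith
  then show ?thesis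
    using resolvent_density_integral_Icc[OF gb, of t a b] t by (simp add: a_def b_def \<gamma>_def)
qed

section \<open>Uniqueness of Laplace transforms\<close>

lemma integrable_mult_compose_exp:
  fixes w d :: "'b \<Rightarrow> real"
  assumes w: "integrable M w" and d[measurable]: "d \<in> borel_measurable M" and pos: "\<And>x. x \<in> space M \<Longrightarrow> d x \<ge> 0"
    and f: "continuous_on {0..1} f"
  shows "integrable M (\<lambda>x. w x * f (exp (- d x)))"
proof -
  obtain B where "\<forall>x\<in>{0..1}. \<bar>f x\<bar> \<le> B"
    using compact_imp_bounded[OF compact_continuous_image[OF f compact_Icc]] unfolding bounded_iff by auto
  then have B: "\<bar>f x\<bar> \<le> B" if "x \<in> {0..1}" for x using that by blast
  \<comment> \<open>\<open>f\<close> is only known to be continuous on \<open>{0..1}\<close>;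
    cutting it off there yields a Borel function, and exp(-d) never leaves this interval.\<close>
  have "(\<lambda>x. indicator {0..1} x *\<^sub>R f x) \<in> borel_measurable borel"
    using f by (intro borel_measurable_continuous_on_indicator) auto
  then have "(\<lambda>x. indicator {0..1} (exp (- d x)) *\<^sub>R f (exp (- d x))) \<in> borel_measurable M"
    by measurable
  also have "(\<lambda>x. indicator {0..1} (exp (- d x)) *\<^sub>R f (exp (- d x))) \<in> borel_measurable M \<longleftrightarrow>
      (\<lambda>x. f (exp (- d x))) \<in> borel_measurable M"
    using pos by (intro measurable_cong) simp
  finally have [measurable]: "(\<lambda>x. f (exp (- d x))) \<in> borel_measurable M" .
  have "AE x in M. norm (w x * f (exp (- d x))) \<le> norm (B * \<bar>w x\<bar>)"
  proof (rule AE_I2)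
    fix x assume "x \<in> space M"
    then have "exp (- d x) \<in> {0..1}" using pos by auto
    then have "\<bar>w x\<bar> * \<bar>f (exp (- d x))\<bar> \<le> \<bar>w x\<bar> * B" by (intro mult_left_mono B) auto
    then show "norm (w x * f (exp (- d x))) \<le> norm (B * \<bar>w x\<bar>)"
      using order_trans[OF abs_ge_zero B[OF \<open>exp (- d x) \<in> {0..1}\<close>]] by (simp add: abs_mult mult.commute)
  qed
  moreover have "(\<lambda>x. w x * f (exp (- d x))) \<in> borel_measurable M"
    using borel_measurable_integrable[OF w] by measurable
  ultimately show ?thesis
    using w by (intro Bochner_Integration.integrable_bound[where f = "\<lambda>x. B * \<bar>w x\<bar>" and g = "\<lambda>x. w x * f (exp (- d x))"]) simp_all
qed

text \<open>In the variable x = exp(-d), which lies in [0, 1], the hypothesis says that two finite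
  signed measures have the same moments. Weierstrass approximation passes from polynomials to
  continuous \<open>f\<close>; the total masses, collected in \<open>?C\<close>, control the
  error.\<close>

lemma laplace_eq_imp_continuous_eq:
  fixes w1 d1 :: "'b \<Rightarrow> real" and w2 d2 :: "'c \<Rightarrow> real"
  assumes w1: "integrable M1 w1" and d1: "d1 \<in> borel_measurable M1" and pos1: "\<And>x. x \<in> space M1 \<Longrightarrow> d1 x \<ge> 0"
    and w2: "integrable M2 w2" and d2: "d2 \<in> borel_measurable M2" and pos2: "\<And>x. x \<in> space M2 \<Longrightarrow> d2 x \<ge> 0"
    and eq: "\<And>n::nat. (LINT x|M1. w1 x * exp (- real n * d1 x)) = (LINT x|M2. w2 x * exp (- real n * d2 x))"
    and f: "continuous_on {0..1} f"
  shows "(LINT x|M1. w1 x * f (exp (- d1 x))) = (LINT x|M2. w2 x * f (exp (- d2 x)))"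
proof -
  note int1 = integrable_mult_compose_exp[OF w1 d1 pos1] and int2 = integrable_mult_compose_exp[OF w2 d2 pos2]
  have poly: "(LINT x|M1. w1 x * p (exp (- d1 x))) = (LINT x|M2. w2 x * p (exp (- d2 x)))"
    if rp: "real_polynomial_function p" for p
  proof -
    obtain a N where p: "p = (\<lambda>x. \<Sum>i\<le>N. a i * x ^ i)"
      using rp unfolding real_polynomial_function_iff_sum by blast
    have i1: "integrable M1 (\<lambda>x. w1 x * exp (- d1 x) ^ i)" for i :: nat
      by (rule int1[where f = "\<lambda>x. x ^ i"]) (auto intro!: continuous_intros)
    have i2: "integrable M2 (\<lambda>x. w2 x * exp (- d2 x) ^ i)" for i :: nat
      by (rule int2[where f = "\<lambda>x. x ^ i"]) (auto intro!: continuous_intros)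
    have 2: "(LINT x|M1. w1 x * exp (- d1 x) ^ i) = (LINT x|M2. w2 x * exp (- d2 x) ^ i)" for i
      using eq[of i] by (simp add: exp_of_nat_mult[symmetric])
    have 3: "w * p (exp (- d)) = (\<Sum>i\<le>N. a i * (w * exp (- d) ^ i))" for w d
      unfolding p sum_distrib_left by (simp add: mult_ac)
    show ?thesis unfolding 3 by (simp add: i1 i2 2)
  qed
  let ?C = "(LINT x|M1. \<bar>w1 x\<bar>) + (LINT x|M2. \<bar>w2 x\<bar>)"
  have close: "\<bar>(LINT x|M. w x * f (exp (- d x))) - (LINT x|M. w x * p (exp (- d x)))\<bar> \<le> e * (LINT x|M. \<bar>w x\<bar>)"
    if "integrable M w" "d \<in> borel_measurable M" "\<And>x. x \<in> space M \<Longrightarrow> d x \<ge> 0" "continuous_on {0..1} p"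
      "\<And>x. x \<in> {0..1} \<Longrightarrow> \<bar>f x - p x\<bar> < e" for M :: "'d measure" and w d p e
  proof -
    have i: "integrable M (\<lambda>x. w x * f (exp (- d x)))" "integrable M (\<lambda>x. w x * p (exp (- d x)))"
      using integrable_mult_compose_exp[OF that(1,2,3) f] integrable_mult_compose_exp[OF that(1,2,3,4)] by auto
    have "\<bar>(LINT x|M. w x * f (exp (- d x))) - (LINT x|M. w x * p (exp (- d x)))\<bar> =
        \<bar>LINT x|M. w x * f (exp (- d x)) - w x * p (exp (- d x))\<bar>"
      using i by simp
    also have "\<dots> \<le> (LINT x|M. \<bar>w x * f (exp (- d x)) - w x * p (exp (- d x))\<bar>)"
      by (rule integral_abs_bound)
    also have "\<dots> \<le> (LINT x|M. e * \<bar>w x\<bar>)"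
    proof (rule integral_mono)
      fix x assume "x \<in> space M"
      then have "\<bar>f (exp (- d x)) - p (exp (- d x))\<bar> \<le> e"
        using that(3)[of x] that(5)[of "exp (- d x)"] by auto
      then have "\<bar>w x\<bar> * \<bar>f (exp (- d x)) - p (exp (- d x))\<bar> \<le> \<bar>w x\<bar> * e" by (rule mult_left_mono) auto
      then show "\<bar>w x * f (exp (- d x)) - w x * p (exp (- d x))\<bar> \<le> e * \<bar>w x\<bar>"
        by (simp add: abs_mult[symmetric] right_diff_distrib mult.commute)
    qed (use i that in auto)
    finally show ?thesis by simp
  qed
  have bound: "\<bar>(LINT x|M1. w1 x * f (exp (- d1 x))) - (LINT x|M2. w2 x * f (exp (- d2 x)))\<bar> \<le> e * ?C" if e: "e > 0" for e
  proof -
    obtain p where p: "real_polynomial_function p" "\<And>x. x \<in> {0..1} \<Longrightarrow> \<bar>f x - p x\<bar> < e"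
      using Stone_Weierstrass_real_polynomial_function[OF compact_Icc f e] by blast
    then have "continuous_on {0..1} p"
      by (intro continuous_on_polymonial_function) (simp add: real_polynomial_function_eq)
    from close[OF w1 d1 pos1 this p(2)] close[OF w2 d2 pos2 this p(2)] poly[OF p(1)]
    show ?thesis by (simp add: algebra_simps)
  qed
  have "\<bar>(LINT x|M1. w1 x * f (exp (- d1 x))) - (LINT x|M2. w2 x * f (exp (- d2 x)))\<bar> \<le> 0"
  proof (rule field_le_epsilon)
    fix e :: real assume "e > 0"
    have C: "?C \<ge> 0" by (intro add_nonneg_nonneg integral_nonneg) auto
    have "\<bar>(LINT x|M1. w1 x * f (exp (- d1 x))) - (LINT x|M2. w2 x * f (exp (- d2 x)))\<bar> \<le> (e / (?C + 1)) * ?C"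
      using \<open>e > 0\<close> by (intro bound divide_pos_pos add_nonneg_pos C) auto
    also have "\<dots> = e * (?C / (?C + 1))" by simp
    also have "\<dots> \<le> e * 1"
      using \<open>e > 0\<close> add_nonneg_pos[OF C zero_less_one] by (intro mult_left_mono) (auto simp: pos_divide_le_eq)
    finally show "\<bar>(LINT x|M1. w1 x * f (exp (- d1 x))) - (LINT x|M2. w2 x * f (exp (- d2 x)))\<bar> \<le> 0 + e"
      by (simp only: mult_1_right add_0)
  qed
  then show ?thesis by simp
qed

text \<open>The cut-off at \<open>s\<close> is discontinuous, so it is approximated by continuous
  ramps falling from 1 to 0 just to the right of \<open>s\<close>. They converge pointwise to the
  indicator of the closed condition d <= s, and dominated convergence concludes.\<close>

lemma laplace_eq_imp_truncated_eq:
  fixes w1 d1 :: "'b \<Rightarrow> real" and w2 d2 :: "'c \<Rightarrow> real"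
  assumes w1: "integrable M1 w1" and d1: "d1 \<in> borel_measurable M1" and pos1: "\<And>x. x \<in> space M1 \<Longrightarrow> d1 x \<ge> 0"
    and w2: "integrable M2 w2" and d2: "d2 \<in> borel_measurable M2" and pos2: "\<And>x. x \<in> space M2 \<Longrightarrow> d2 x \<ge> 0"
    and eq: "\<And>n::nat. (LINT x|M1. w1 x * exp (- real n * d1 x)) = (LINT x|M2. w2 x * exp (- real n * d2 x))"
    and \<phi>: "continuous_on {0..s} \<phi>" and s: "s \<ge> 0"
  shows "(LINT x|M1. w1 x * (if d1 x \<le> s then \<phi> (d1 x) else 0)) = (LINT x|M2. w2 x * (if d2 x \<le> s then \<phi> (d2 x) else 0))"
proof -
  \<comment> \<open>In terms of d = -ln x the first factor is \<phi>(min d s), and the second falls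
    linearly from 1 at s to 0 at s + 1/(n + 1). The caps exp(-s) and exp(-s - 1) keep
    \<open>ln\<close> away from 0; the second cap is harmless because every ramp has ended by s +
    1.\<close>
  define f where "f n x = \<phi> (- ln (max x (exp (- s)))) *
      max 0 (1 - real (Suc n) * max 0 (- ln (max x (exp (- s - 1))) - s))" for n x
  obtain B where "\<forall>x\<in>{0..s}. \<bar>\<phi> x\<bar> \<le> B"
    using compact_imp_bounded[OF compact_continuous_image[OF \<phi> compact_Icc]] unfolding bounded_iff by auto
  then have B: "\<bar>\<phi> x\<bar> \<le> B" if "x \<in> {0..s}" for x using that by blast
  have cont: "continuous_on {0..1} (f n)" for n
  proof -
    have ne: "max x (exp (- s)) \<noteq> 0" "max x (exp (- s - 1)) \<noteq> 0" for x :: real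
      using exp_gt_zero[of "- s"] exp_gt_zero[of "- s - 1"] by linarith+
    have "- ln (max x (exp (- s))) \<in> {0..s}" if "x \<in> {0..1}" for x
      using that s ln_le_cancel_iff[of "exp (- s)" "max x (exp (- s))"] ln_le_zero_iff[of "max x (exp (- s))"]
      by (auto simp: less_max_iff_disj)
    then have "continuous_on {0..1} (\<lambda>x. \<phi> (- ln (max x (exp (- s)))))"
      using ne by (intro continuous_on_compose2[OF \<phi>] continuous_intros) auto
    then show ?thesis unfolding f_def using ne by (intro continuous_intros) auto
  qed
  have f_exp: "f n (exp (- d)) = \<phi> (min d s) * max 0 (1 - real (Suc n) * max 0 (min d (s + 1) - s))" for n d
  proof -
    have "max (exp (- d)) (exp (- s)) = exp (- min d s)" "max (exp (- d)) (exp (- s - 1)) = exp (- min d (s + 1))"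
      by (auto simp: max_def min_def)
    then show ?thesis by (simp add: f_def)
  qed
  have lim: "(\<lambda>n. f n (exp (- d))) \<longlonglongrightarrow> (if d \<le> s then \<phi> d else 0)" for d
  proof (cases "d \<le> s")
    case True
    then show ?thesis by (simp add: f_exp min_def)
  next
    case False
    let ?\<delta> = "min d (s + 1) - s"
    have \<delta>: "?\<delta> > 0" using False by auto
    have "\<forall>\<^sub>F n in sequentially. real (Suc n) * max 0 ?\<delta> \<ge> 1"
    proof -
      have "\<forall>\<^sub>F n in sequentially. real n \<ge> 1 / ?\<delta>"
        using filterlim_real_sequentially unfolding filterlim_at_top by auto
      then show ?thesis
      proof eventually_elim
        case (elim n)
        then have "1 / ?\<delta> \<le> real (Suc n)" by simp
        then show ?case using \<delta> by (simp add: pos_divide_le_eq)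
      qed
    qed
    then have "\<forall>\<^sub>F n in sequentially. f n (exp (- d)) = 0"
      by eventually_elim (simp add: f_exp)
    then have "(\<lambda>n. f n (exp (- d))) \<longlonglongrightarrow> 0" by (rule tendsto_eventually)
    then show ?thesis using False by simp
  qed
  have bd: "\<bar>f n (exp (- d))\<bar> \<le> B" if "d \<ge> 0" for n d
  proof -
    have "\<bar>\<phi> (min d s)\<bar> * \<bar>max 0 (1 - real (Suc n) * max 0 (min d (s + 1) - s))\<bar> \<le> B * 1"
      using that s order_trans[OF abs_ge_zero B[of 0]] by (intro mult_mono B) auto
    then show ?thesis unfolding f_exp abs_mult by simp
  qed
  have conv: "(\<lambda>n. LINT x|M. w x * f n (exp (- d x))) \<longlonglongrightarrow> (LINT x|M. w x * (if d x \<le> s then \<phi> (d x) else 0))"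
    if w: "integrable M w" and d: "d \<in> borel_measurable M" and pos: "\<And>x. x \<in> space M \<Longrightarrow> d x \<ge> 0" for M :: "'d measure" and w d
  proof (rule integral_dominated_convergence[where w = "\<lambda>x. B * \<bar>w x\<bar>"])
    have m: "(\<lambda>x. w x * f n (exp (- d x))) \<in> borel_measurable M" for n
      using integrable_mult_compose_exp[OF w d pos cont] by auto
    then show "\<And>n. (\<lambda>x. w x * f n (exp (- d x))) \<in> borel_measurable M" .
    have l: "(\<lambda>n. w x * f n (exp (- d x))) \<longlonglongrightarrow> w x * (if d x \<le> s then \<phi> (d x) else 0)" for x
      by (intro tendsto_mult tendsto_const lim)
    then show "AE x in M. (\<lambda>n. w x * f n (exp (- d x))) \<longlonglongrightarrow> w x * (if d x \<le> s then \<phi> (d x) else 0)" by simp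
    show "(\<lambda>x. w x * (if d x \<le> s then \<phi> (d x) else 0)) \<in> borel_measurable M"
      by (rule borel_measurable_LIMSEQ_real[OF l m])
    show "integrable M (\<lambda>x. B * \<bar>w x\<bar>)" using w by auto
    show "AE x in M. norm (w x * f n (exp (- d x))) \<le> B * \<bar>w x\<bar>" for n
    proof (rule AE_I2)
      fix x assume "x \<in> space M"
      then have "\<bar>w x\<bar> * \<bar>f n (exp (- d x))\<bar> \<le> \<bar>w x\<bar> * B"
        by (intro mult_left_mono bd pos) auto
      then show "norm (w x * f n (exp (- d x))) \<le> B * \<bar>w x\<bar>" by (simp add: abs_mult mult.commute)
    qed
  qed
  have eqn: "(LINT x|M1. w1 x * f n (exp (- d1 x))) = (LINT x|M2. w2 x * f n (exp (- d2 x)))" for n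
    by (intro laplace_eq_imp_continuous_eq[OF w1 d1 pos1 w2 d2 pos2 eq cont])
  have l1: "(\<lambda>n. LINT x|M1. w1 x * f n (exp (- d1 x))) \<longlonglongrightarrow> (LINT x|M1. w1 x * (if d1 x \<le> s then \<phi> (d1 x) else 0))"
    by (rule conv[OF w1 d1 pos1])
  have l2: "(\<lambda>n. LINT x|M2. w2 x * f n (exp (- d2 x))) \<longlonglongrightarrow> (LINT x|M2. w2 x * (if d2 x \<le> s then \<phi> (d2 x) else 0))"
    by (rule conv[OF w2 d2 pos2])
  show ?thesis by (rule LIMSEQ_unique[OF l1[unfolded eqn] l2])
qed

section \<open>Joint measurability of right-continuous processes\<close>

text \<open>The summand 1 puts the grid point strictly to the right of \<open>t\<close>, as
  convergence within \<open>at_right t\<close> demands, while for each \<open>n\<close> only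
  countably many values occur.\<close>

lemma grid_above:
  assumes "t \<ge> (0::real)"
  defines "r \<equiv> \<lambda>n. (real (nat \<lfloor>real (Suc n) * t\<rfloor>) + 1) / real (Suc n)"
  shows "filterlim r (at_right t) sequentially"
proof -
  have r1: "r n > t" for n
  proof -
    have "real (Suc n) * t < real (nat \<lfloor>real (Suc n) * t\<rfloor>) + 1" by linarith
    then show ?thesis unfolding r_def by (simp only: pos_less_divide_eq of_nat_0_less_iff zero_less_Suc mult.commute)
  qed
  have r2: "r n \<le> t + 1 / real (Suc n)" for n
  proof -
    have "real (nat \<lfloor>real (Suc n) * t\<rfloor>) \<le> real (Suc n) * t" using assms(1) by (intro of_nat_floor) simp
    then have "r n \<le> (real (Suc n) * t + 1) / real (Suc n)" unfolding r_def by (intro divide_right_mono) auto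
    also have "\<dots> = t + 1 / real (Suc n)" by (simp add: add_divide_distrib del: of_nat_Suc)
    finally show ?thesis .
  qed
  have "r \<longlonglongrightarrow> t"
  proof (rule tendsto_sandwich)
    show "(\<lambda>n. t) \<longlonglongrightarrow> t" by simp
    have "(\<lambda>n. t + 1 / real (Suc n)) \<longlonglongrightarrow> t + 0"
      using LIMSEQ_inverse_real_of_nat_add[of t] by (simp add: inverse_eq_divide)
    then show "(\<lambda>n. t + 1 / real (Suc n)) \<longlonglongrightarrow> t" by simp
  qed (use r1 r2 in \<open>auto intro!: always_eventually simp: less_imp_le simp del: of_nat_Suc\<close>)
  then show ?thesis unfolding filterlim_at using r1 by (auto simp: less_imp_neq[symmetric] intro: always_eventually)
qed

text \<open>Along the grid the time argument takes countably many values, so each approximation is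
  measurable, and right continuity supplies the limit. \<open>max 0 t\<close> extends the process to
  all real times, so that the time axis is the plain Borel space.\<close>

lemma right_continuous_jointly_measurable:
  fixes X :: "real \<Rightarrow> 'b \<Rightarrow> real"
  assumes X: "\<And>t. t \<ge> 0 \<Longrightarrow> X t \<in> borel_measurable M"
    and cont: "\<And>t \<omega>. t \<ge> 0 \<Longrightarrow> \<omega> \<in> space M \<Longrightarrow> continuous (at_right t) (\<lambda>u. X u \<omega>)"
  shows "(\<lambda>(t, \<omega>). X (max 0 t) \<omega>) \<in> borel_measurable (borel \<Otimes>\<^sub>M M)"
proof -
  let ?k = "\<lambda>n (t::real). nat \<lfloor>real (Suc n) * max 0 t\<rfloor>"
  have m: "(\<lambda>x. X ((real (?k n (fst x)) + 1) / real (Suc n)) (snd x)) \<in> borel_measurable (borel \<Otimes>\<^sub>M M)" for n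
  proof (rule measurable_compose_countable[where g = "\<lambda>x. ?k n (fst x)" and f = "\<lambda>k x. X ((real k + 1) / real (Suc n)) (snd x)"])
    show "(\<lambda>x. X ((real k + 1) / real (Suc n)) (snd x)) \<in> borel_measurable ((borel :: real measure) \<Otimes>\<^sub>M M)" for k
      using X[of "(real k + 1) / real (Suc n)"] by (intro measurable_compose[OF measurable_snd]) auto
  qed measurable
  show ?thesis
  proof (rule borel_measurable_LIMSEQ_real[OF _ m])
    fix x assume "x \<in> space ((borel :: real measure) \<Otimes>\<^sub>M M)"
    then have \<omega>: "snd x \<in> space M" by (auto simp: space_pair_measure)
    have "((\<lambda>u. X u (snd x)) \<longlongrightarrow> X (max 0 (fst x)) (snd x)) (at_right (max 0 (fst x)))"
      using cont[OF _ \<omega>, of "max 0 (fst x)"] by (simp add: continuous_within)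
    then show "(\<lambda>n. X ((real (?k n (fst x)) + 1) / real (Suc n)) (snd x)) \<longlonglongrightarrow> (case x of (t, \<omega>) \<Rightarrow> X (max 0 t) \<omega>)"
      unfolding case_prod_beta by (rule filterlim_compose[OF _ grid_above]) simp
  qed
qed

section \<open>Inverse subordinators\<close>

lemma has_bochner_integral_exp_Ici:
  assumes z: "z > (0::real)"
  shows "has_bochner_integral lborel (\<lambda>u. indicator {0..} u * exp (- z * u)) (1 / z)"
proof (rule has_bochner_integral_nn_integral)
  have "(\<integral>\<^sup>+ u. ennreal (exp (- z * u)) * indicator {0..} u \<partial>lborel) = ennreal (0 - (- exp (- z * 0) / z))"
  proof (rule nn_integral_FTC_atLeast)
    have "((\<lambda>u. exp (- z * u)) \<longlongrightarrow> 0) at_top"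
      using z by real_asymp
    then show "((\<lambda>u. - exp (- z * u) / z) \<longlongrightarrow> 0) at_top" using tendsto_minus[OF tendsto_divide[OF _ tendsto_const[of z]]] z by fastforce
  qed (use z in \<open>auto intro!: derivative_eq_intros\<close>)
  then show "(\<integral>\<^sup>+ u. ennreal (indicator {0..} u * exp (- z * u)) \<partial>lborel) = ennreal (1 / z)"
    using z by (simp add: ennreal_mult'' ennreal_indicator mult.commute)
qed (use z in auto)

lemma integral_exp_Icc:
  assumes "\<theta> \<noteq> (0::real)" "c \<ge> 0"
  shows "(LINT v|lborel. indicator {0..c} v * exp (- \<theta> * v)) = (1 - exp (- \<theta> * c)) / \<theta>"
proof -
  have "(LINT v|lborel. exp (- \<theta> * v) * indicator {0..c} v) = - exp (- \<theta> * c) / \<theta> - (- exp (- \<theta> * 0) / \<theta>)"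
    using assms by (intro integral_FTC_Icc_real) (auto intro!: derivative_eq_intros)
  then show ?thesis by (simp add: mult.commute diff_divide_distrib)
qed

lemma integral_exp_Icc':
  assumes "\<theta> \<noteq> (0::real)" "a \<ge> 0"
  shows "(LINT v|lborel. indicator {0..a} v * exp (- \<theta> * (b - v))) = (exp (- \<theta> * (b - a)) - exp (- \<theta> * b)) / \<theta>"
proof -
  have "(LINT v|lborel. exp (- \<theta> * (b - v)) * indicator {0..a} v) = exp (- \<theta> * (b - a)) / \<theta> - exp (- \<theta> * (b - 0)) / \<theta>"
    using assms by (intro integral_FTC_Icc_real) (auto intro!: derivative_eq_intros)
  then show ?thesis by (simp add: mult.commute diff_divide_distrib)
qed

lemma (in pair_sigma_finite) integrable_pair_nonneg:
  fixes f :: "'a \<Rightarrow> 'b \<Rightarrow> real"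
  assumes "case_prod f \<in> borel_measurable (M1 \<Otimes>\<^sub>M M2)" "\<And>x y. f x y \<ge> 0"
    "\<And>x. x \<in> space M1 \<Longrightarrow> integrable M2 (f x)" "integrable M1 (\<lambda>x. LINT y|M2. f x y)"
  shows "integrable (M1 \<Otimes>\<^sub>M M2) (case_prod f)"
  using assms by (intro Fubini_integrable) auto

section \<open>Subordinators and their potential measures\<close>

locale subordinator_exponent = prob_space M for M :: "'a measure" +
  fixes D :: "real \<Rightarrow> 'a \<Rightarrow> real" and \<psi> :: "real \<Rightarrow> real"
  assumes sub: "subordinator M D" and lap: "laplace_exponent M D \<psi>"
    and \<psi>_pos: "\<And>z. z > 0 \<Longrightarrow> \<psi> z > 0"
begin

sublocale P: pair_sigma_finite lborel M by unfold_locales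

lemma random_variable_D: "t \<ge> 0 \<Longrightarrow> D t \<in> borel_measurable M"
  using sub unfolding subordinator_def by blast

lemma indep_increments: "0 \<le> \<tau> 0 \<Longrightarrow> (\<And>i. i < n \<Longrightarrow> \<tau> i < \<tau> (Suc i)) \<Longrightarrow>
    indep_vars (\<lambda>_. borel) (\<lambda>i \<omega>. D (\<tau> (Suc i)) \<omega> - D (\<tau> i) \<omega>) {..<n::nat}"
  using sub unfolding subordinator_def by blast

lemma D_0: "\<omega> \<in> space M \<Longrightarrow> D 0 \<omega> = 0"
  using sub unfolding subordinator_def by blast

lemma D_mono: "\<omega> \<in> space M \<Longrightarrow> 0 \<le> u \<Longrightarrow> u \<le> v \<Longrightarrow> D u \<omega> \<le> D v \<omega>"
  using sub mono_onD[of "{0..}" "\<lambda>t. D t \<omega>" u v] unfolding subordinator_def by auto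

lemma D_nonneg: "\<omega> \<in> space M \<Longrightarrow> 0 \<le> u \<Longrightarrow> 0 \<le> D u \<omega>"
  using D_mono[of \<omega> 0 u] D_0 by simp

lemma jointly_measurable_D [measurable]: "(\<lambda>(t, \<omega>). D (max 0 t) \<omega>) \<in> borel_measurable (borel \<Otimes>\<^sub>M M)"
  using sub unfolding subordinator_def by (intro right_continuous_jointly_measurable) auto

lemma jointly_measurable_D' [measurable (raw)]:
  assumes [measurable]: "f \<in> borel_measurable N" "g \<in> measurable N M"
  shows "(\<lambda>x. D (max 0 (f x)) (g x)) \<in> borel_measurable N"
  using measurable_compose[OF measurable_Pair[OF assms] jointly_measurable_D] by simp

lemma expectation_exp_D: "t \<ge> 0 \<Longrightarrow> z \<ge> 0 \<Longrightarrow> expectation (\<lambda>\<omega>. exp (- z * D t \<omega>)) = exp (- t * \<psi> z)"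
  using lap unfolding laplace_exponent_def by blast

lemma integrable_bounded: "f \<in> borel_measurable M \<Longrightarrow> (\<And>\<omega>. \<omega> \<in> space M \<Longrightarrow> \<bar>f \<omega>\<bar> \<le> (B::real)) \<Longrightarrow> integrable M f"
  by (rule integrable_const_bound[where B = B]) auto

text \<open>This integrates exp(-\<theta> u) E[exp(-z D(u))] = exp(-(\<theta> + \<psi>(z)) u) over
  u. The case \<theta> = 0 is included because \<psi>(z) > 0; it concerns the potential measure of
  \<open>D\<close>.\<close>

lemma potential_laplace:
  assumes "\<theta> \<ge> 0" "z > 0"
  shows "has_bochner_integral (lborel \<Otimes>\<^sub>M M)
    (\<lambda>x. indicator {0..} (fst x) * exp (- \<theta> * fst x) * exp (- z * D (max 0 (fst x)) (snd x))) (1 / (\<theta> + \<psi> z))"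
proof -
  let ?f = "\<lambda>u \<omega>. indicator {0..} u * exp (- \<theta> * u) * exp (- z * D (max 0 u) \<omega>)"
  have pos: "\<theta> + \<psi> z > 0" using assms \<psi>_pos[of z] by simp
  have inner: "integrable M (?f u)" for u
    using assms
    by (intro integrable_bounded[where B = "exp (- \<theta> * u)"])
      (auto simp: indicator_def abs_mult D_nonneg mult_le_cancel_left1 zero_le_mult_iff)
  have eq: "(LINT \<omega>|M. ?f u \<omega>) = indicator {0..} u * exp (- (\<theta> + \<psi> z) * u)" for u
  proof (cases "u \<ge> 0")
    case True
    have "(LINT \<omega>|M. ?f u \<omega>) = exp (- \<theta> * u) * expectation (\<lambda>\<omega>. exp (- z * D u \<omega>))"
      using True by (simp add: max_def)
    also have "\<dots> = exp (- (\<theta> + \<psi> z) * u)"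
      using True assms by (subst expectation_exp_D) (auto simp: algebra_simps simp flip: exp_add)
    finally show ?thesis using True by simp
  qed simp
  have I: "has_bochner_integral lborel (\<lambda>u. LINT \<omega>|M. ?f u \<omega>) (1 / (\<theta> + \<psi> z))"
    unfolding eq by (rule has_bochner_integral_exp_Ici[OF pos])
  have int: "integrable (lborel \<Otimes>\<^sub>M M) (case_prod ?f)"
    by (intro P.integrable_pair_nonneg inner integrable.intros[OF I]) auto
  then show ?thesis
    using P.integral_fst[OF int] has_bochner_integral_integral_eq[OF I]
    unfolding has_bochner_integral_iff by (simp add: case_prod_beta')
qed

text \<open>On the event that D(n) <= N for all n, exp(-D(n)) is at least exp(-N), while its
  expectation exp(-n \<psi>(1)) tends to 0. Off the resulting null set the default value in
  \<open>inverse_subordinator\<close> never occurs.\<close>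

lemma AE_unbounded: "AE \<omega> in M. \<forall>t. \<exists>\<tau>\<ge>0. D \<tau> \<omega> > t"
proof -
  have "AE \<omega> in M. \<exists>n. D (real n) \<omega> > real N" for N :: nat
  proof -
    have [measurable]: "D (real n) \<in> borel_measurable M" for n by (rule random_variable_D) simp
    let ?A = "{\<omega> \<in> space M. \<forall>n. D (real n) \<omega> \<le> real N}"
    have le: "prob ?A * exp (- real N) \<le> exp (- \<psi> 1) ^ n" for n
    proof -
      have "prob ?A * exp (- real N) = expectation (\<lambda>\<omega>. exp (- real N) * indicator ?A \<omega>)" by simp
      also have "\<dots> \<le> expectation (\<lambda>\<omega>. exp (- 1 * D (real n) \<omega>))"
        by (intro integral_mono integrable_bounded[where B = 1]) (auto simp: indicator_def D_nonneg)
      also have "\<dots> = exp (- \<psi> 1) ^ n" by (subst expectation_exp_D) (auto simp flip: exp_of_nat_mult)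
      finally show ?thesis .
    qed
    have "(\<lambda>n. exp (- \<psi> 1) ^ n) \<longlonglongrightarrow> 0" using \<psi>_pos[of 1] by (intro LIMSEQ_realpow_zero) auto
    then have "prob ?A * exp (- real N) \<le> 0" using le by (intro LIMSEQ_le_const) auto
    then have "prob ?A = 0" by (simp add: mult_le_0_iff measure_le_0_iff)
    then show ?thesis
      by (intro AE_I[where N = ?A]) (auto simp: emeasure_eq_measure not_less)
  qed
  then have "AE \<omega> in M. \<forall>N::nat. \<exists>n. D (real n) \<omega> > real N" unfolding AE_all_countable by auto
  then show ?thesis
  proof eventually_elim
    case (elim \<omega>)
    show ?case
    proof
      fix t
      obtain N where "t \<le> real N" using real_arch_simple by blast
      moreover obtain n where "D (real n) \<omega> > real N" using elim by blast
      ultimately show "\<exists>\<tau>\<ge>0. D \<tau> \<omega> > t" by (intro exI[of _ "real n"]) auto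
    qed
  qed
qed

section \<open>Level sets of the paths and the inverse process\<close>

abbreviation E :: "real \<Rightarrow> 'a \<Rightarrow> real" where "E \<equiv> inverse_subordinator D"

lemma E_eq: "\<exists>\<tau>\<ge>0. D \<tau> \<omega> > t \<Longrightarrow> E t \<omega> = Inf {\<tau>. 0 \<le> \<tau> \<and> D \<tau> \<omega> > t}"
  by (simp add: inverse_subordinator_def)

lemma E_nonneg: "0 \<le> E t \<omega>"
  unfolding inverse_subordinator_def by (auto intro!: cInf_greatest)

text \<open>Together with \<open>le_E_if_D_le\<close> this places the set of u with D(u) <= t
  between u < E(t) and u <= E(t). The undecided point u = E(t) is a null set for every integral over
  u.\<close>

lemma D_le_if_less_E:
  assumes "\<exists>\<tau>\<ge>0. D \<tau> \<omega> > t" "0 \<le> u" "u < E t \<omega>"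
  shows "D u \<omega> \<le> t"
proof (rule ccontr)
  assume "\<not> D u \<omega> \<le> t"
  then have "Inf {\<tau>. 0 \<le> \<tau> \<and> D \<tau> \<omega> > t} \<le> u"
    using assms by (intro cInf_lower bdd_belowI[of _ 0]) auto
  then show False using assms by (simp add: E_eq)
qed

lemma le_E_if_D_le:
  assumes "\<omega> \<in> space M" "\<exists>\<tau>\<ge>0. D \<tau> \<omega> > t" "0 \<le> u" "D u \<omega> \<le> t"
  shows "u \<le> E t \<omega>"
  unfolding E_eq[OF assms(2)]
proof (rule cInf_greatest)
  fix \<tau> assume "\<tau> \<in> {\<tau>. 0 \<le> \<tau> \<and> t < D \<tau> \<omega>}"
  then show "u \<le> \<tau>" using D_mono[OF assms(1), of \<tau> u] assms by (cases "u \<le> \<tau>") auto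
qed (use assms in auto)

text \<open>Unboundedness above \<open>t\<close> excludes the default value 0 of \<open>E t\<close>,
  which could lie below \<open>E s\<close>. Testing u < E(s) lets the two inclusions of level sets
  be chained.\<close>

lemma E_mono: "\<omega> \<in> space M \<Longrightarrow> \<exists>\<tau>\<ge>0. D \<tau> \<omega> > t \<Longrightarrow> s \<le> t \<Longrightarrow> E s \<omega> \<le> E t \<omega>"
proof (rule dense_le)
  fix u assume \<omega>: "\<omega> \<in> space M" "\<exists>\<tau>\<ge>0. D \<tau> \<omega> > t" "s \<le> t" and u: "u < E s \<omega>"
  show "u \<le> E t \<omega>"
  proof (cases "u \<ge> 0")
    case True
    have "D u \<omega> \<le> s" using \<omega> u True by (intro D_le_if_less_E) (auto intro: le_less_trans)
    then show ?thesis using \<omega> True by (intro le_E_if_D_le) auto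
  qed (use E_nonneg[of t \<omega>] in auto)
qed

text \<open>A pathwise identity: it turns the exponential of E(t) - u into an integral over the
  events D(u + v) <= t, which can be handled through the increment of \<open>D\<close> over
  [u, u + v].\<close>

lemma integral_exp_level:
  assumes \<omega>: "\<omega> \<in> space M" "\<exists>\<tau>\<ge>0. D \<tau> \<omega> > t" and u: "0 \<le> u" "D u \<omega> \<le> t" and \<theta>: "\<theta> > 0"
  shows "(LINT v|lborel. indicator {0..} v * exp (- \<theta> * v) * indicator {..t} (D (max 0 (u + v)) \<omega>)) =
    (1 - exp (- \<theta> * (E t \<omega> - u))) / \<theta>"
proof -
  have uE: "u \<le> E t \<omega>" using \<omega> u by (intro le_E_if_D_le)
  have "AE v in lborel. indicator {0..} v * exp (- \<theta> * v) * indicator {..t} (D (max 0 (u + v)) \<omega>)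
      = indicator {0..E t \<omega> - u} v * exp (- \<theta> * v)"
    using AE_lborel_singleton[of "E t \<omega> - u"]
  proof eventually_elim
    case (elim v)
    show ?case
      using elim u D_le_if_less_E[OF \<omega>(2), of "u + v"] le_E_if_D_le[OF \<omega>, of "u + v"]
      by (cases "v \<ge> 0"; cases "u + v < E t \<omega>") (auto simp: indicator_def)
  qed
  then have "(LINT v|lborel. indicator {0..} v * exp (- \<theta> * v) * indicator {..t} (D (max 0 (u + v)) \<omega>)) =
      (LINT v|lborel. indicator {0..E t \<omega> - u} v * exp (- \<theta> * v))"
    using \<omega>(1) by (intro integral_cong_AE) auto
  then show ?thesis using integral_exp_Icc[of \<theta> "E t \<omega> - u"] uE \<theta> by simp
qed

text \<open>Where D(u) <= s one has u <= E(s) <= E(t), so \<open>max 0\<close> changes nothing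
  there; it keeps the exponential at most 1 for all u, which is used for domination later.\<close>

lemma exp_increment_E_eq:
  assumes \<omega>: "\<omega> \<in> space M" "\<exists>\<tau>\<ge>0. D \<tau> \<omega> > s" "\<exists>\<tau>\<ge>0. D \<tau> \<omega> > t" and st: "s \<le> t" and \<theta>: "\<theta> > 0"
  shows "exp (- \<theta> * (E t \<omega> - E s \<omega>)) = exp (- \<theta> * E t \<omega>) +
    \<theta> * (LINT u|lborel. indicator {0..} u * indicator {..s} (D (max 0 u) \<omega>) * exp (- \<theta> * max 0 (E t \<omega> - u)))"
proof -
  have le: "E s \<omega> \<le> E t \<omega>" using \<omega> st by (intro E_mono)
  have "AE u in lborel. indicator {0..} u * indicator {..s} (D (max 0 u) \<omega>) * exp (- \<theta> * max 0 (E t \<omega> - u))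
      = indicator {0..E s \<omega>} u * exp (- \<theta> * (E t \<omega> - u))"
    using AE_lborel_singleton[of "E s \<omega>"]
  proof eventually_elim
    case (elim u)
    show ?case
      using elim le D_le_if_less_E[OF \<omega>(2), of u] le_E_if_D_le[OF \<omega>(1,2), of u]
      by (cases "u \<ge> 0"; cases "u < E s \<omega>") (auto simp: indicator_def)
  qed
  then have "(LINT u|lborel. indicator {0..} u * indicator {..s} (D (max 0 u) \<omega>) * exp (- \<theta> * max 0 (E t \<omega> - u))) =
      (LINT u|lborel. indicator {0..E s \<omega>} u * exp (- \<theta> * (E t \<omega> - u)))"
    using \<omega>(1) by (intro integral_cong_AE) auto
  then show ?thesis using integral_exp_Icc'[of \<theta> "E s \<omega>" "E t \<omega>"] E_nonneg[of s \<omega>] \<theta> by (simp add: field_simps)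
qed

text \<open>The weight exp(-z0 D) makes the potential measure finite, even for \<theta> = 0, and
  shifts the exponents n = 0, 1, ... to z0 + n, where the transform of \<open>h\<close> is known.
  The test function \<phi>(y) exp(z0 y), cut off at \<open>s\<close>, removes the weight
  again.\<close>

lemma potential_truncated_eq:
  assumes \<theta>: "\<theta> \<ge> 0" and z0: "z0 > 0"
    and h: "integrable lborel (\<lambda>y. indicator {0..} y * (exp (- z0 * y) * h y))"
    and lap_h: "\<And>z. z \<ge> z0 \<Longrightarrow> (LINT y|lborel. indicator {0..} y * (exp (- z * y) * h y)) = 1 / (\<theta> + \<psi> z)"
    and \<phi>: "continuous_on {0..s} \<phi>" and s: "s \<ge> 0"
  shows "(LINT x|(lborel \<Otimes>\<^sub>M M). indicator {0..} (fst x) * exp (- \<theta> * fst x) *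
      (indicator {..s} (D (max 0 (fst x)) (snd x)) * \<phi> (D (max 0 (fst x)) (snd x)))) =
    (LINT y|lborel. indicator {0..s} y * (\<phi> y * h y))"
proof -
  let ?w1 = "\<lambda>x. indicator {0..} (fst x) * exp (- \<theta> * fst x) * exp (- z0 * D (max 0 (fst x)) (snd x))"
  let ?d1 = "\<lambda>x. D (max 0 (fst x)) (snd x)"
  let ?w2 = "\<lambda>y. indicator {0..} y * (exp (- z0 * y) * h y)"
  have "(LINT x|(lborel \<Otimes>\<^sub>M M). ?w1 x * (if ?d1 x \<le> s then \<phi> (?d1 x) * exp (z0 * ?d1 x) else 0)) =
    (LINT y|lborel. ?w2 y * (if max 0 y \<le> s then \<phi> (max 0 y) * exp (z0 * max 0 y) else 0))"
  proof (rule laplace_eq_imp_truncated_eq[where \<phi> = "\<lambda>y. \<phi> y * exp (z0 * y)"])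
    show "integrable (lborel \<Otimes>\<^sub>M M) ?w1"
      using potential_laplace[OF \<theta> z0] by (rule integrable.intros)
    show "0 \<le> ?d1 x" if "x \<in> space (lborel \<Otimes>\<^sub>M M)" for x
      using that by (auto simp: space_pair_measure intro!: D_nonneg)
    show "(LINT x|(lborel \<Otimes>\<^sub>M M). ?w1 x * exp (- real n * ?d1 x)) = (LINT y|lborel. ?w2 y * exp (- real n * max 0 y))" for n
    proof -
      have z: "z0 + real n > 0" using z0 by simp
      have "(LINT x|(lborel \<Otimes>\<^sub>M M). ?w1 x * exp (- real n * ?d1 x)) =
          (LINT x|(lborel \<Otimes>\<^sub>M M). indicator {0..} (fst x) * exp (- \<theta> * fst x) * exp (- (z0 + real n) * ?d1 x))"
        by (intro Bochner_Integration.integral_cong refl) (simp add: algebra_simps flip: exp_add)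
      also have "\<dots> = 1 / (\<theta> + \<psi> (z0 + real n))"
        by (rule has_bochner_integral_integral_eq[OF potential_laplace[OF \<theta> z]])
      also have "\<dots> = (LINT y|lborel. indicator {0..} y * (exp (- (z0 + real n) * y) * h y))"
        by (rule lap_h[symmetric]) simp
      also have "\<dots> = (LINT y|lborel. ?w2 y * exp (- real n * max 0 y))"
        by (intro Bochner_Integration.integral_cong refl) (auto simp: indicator_def algebra_simps mult_exp_exp max_def)
      finally show ?thesis .
    qed
  qed (use h s \<phi> in \<open>auto intro!: continuous_intros\<close>)
  moreover have "?w1 x * (if ?d1 x \<le> s then \<phi> (?d1 x) * exp (z0 * ?d1 x) else 0) =
      indicator {0..} (fst x) * exp (- \<theta> * fst x) * (indicator {..s} (?d1 x) * \<phi> (?d1 x))" for x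
    by (auto simp: indicator_def mult_exp_exp exp_minus field_simps)
  moreover have "?w2 y * (if max 0 y \<le> s then \<phi> (max 0 y) * exp (z0 * max 0 y) else 0) = indicator {0..s} y * (\<phi> y * h y)" for y
    by (auto simp: indicator_def exp_minus max_def field_simps)
  ultimately show ?thesis by (simp only:)
qed

text \<open>For r >= 0 this is E[exp(-\<theta> E(r))], see \<open>expectation_exp_E\<close>, written
  through the \<theta>-potential of [0, r]; in this form \<open>potential_truncated_eq\<close> can
  evaluate it.\<close>

definition Phi :: "real \<Rightarrow> real \<Rightarrow> real" where
  "Phi \<theta> r = 1 - \<theta> * (LINT x|(lborel \<Otimes>\<^sub>M M). indicator {0..} (fst x) * exp (- \<theta> * fst x) * indicator {..r} (D (max 0 (fst x)) (snd x)))"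

definition cdf_D :: "real \<Rightarrow> real \<Rightarrow> real" where
  "cdf_D v r = (LINT \<omega>|M. indicator {..r} (D (max 0 v) \<omega>))"

lemma measurable_cdf_D [measurable (raw)]:
  assumes [measurable]: "f \<in> borel_measurable N" "g \<in> borel_measurable N"
  shows "(\<lambda>x. cdf_D (f x) (g x)) \<in> borel_measurable N"
proof -
  have "(\<lambda>p. LINT \<omega>|M. indicator {x. x \<le> snd p} (D (max 0 (fst p)) \<omega>) :: real) \<in> borel_measurable (borel \<Otimes>\<^sub>M borel)"
    unfolding indicator_def mem_Collect_eq by measurable
  then have "(\<lambda>p. cdf_D (fst p) (snd p)) \<in> borel_measurable (borel \<Otimes>\<^sub>M borel)"
    by (simp add: cdf_D_def atMost_def)
  from measurable_compose[OF measurable_Pair[OF assms] this] show ?thesis by simp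
qed

lemma cdf_D_nonneg: "0 \<le> cdf_D v r"
  unfolding cdf_D_def by (intro Bochner_Integration.integral_nonneg) auto

lemma cdf_D_le_1: "cdf_D v r \<le> 1"
proof -
  have "cdf_D v r \<le> (LINT \<omega>|M. 1)"
    unfolding cdf_D_def by (intro integral_mono integrable_bounded[where B = 1]) (auto simp: indicator_def)
  then show ?thesis by (simp add: prob_space)
qed

lemma integrable_exp_weight:
  assumes \<theta>: "\<theta> > 0" and m: "(\<lambda>(u, \<omega>). f u \<omega>) \<in> borel_measurable (lborel \<Otimes>\<^sub>M M)"
    and b: "\<And>u \<omega>. \<omega> \<in> space M \<Longrightarrow> \<bar>f u \<omega>\<bar> \<le> (1::real)"
  shows "integrable (lborel \<Otimes>\<^sub>M M) (\<lambda>(u, \<omega>). indicator {0..} u * exp (- \<theta> * u) * f u \<omega>)"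
proof (rule Bochner_Integration.integrable_bound)
  show "integrable (lborel \<Otimes>\<^sub>M M) (\<lambda>(u, \<omega>). indicator {0..} u * exp (- \<theta> * u))"
    using integrable.intros[OF has_bochner_integral_exp_Ici[OF \<theta>]]
    by (intro P.integrable_pair_nonneg) (auto simp: prob_space)
  show "(\<lambda>(u, \<omega>). indicator {0..} u * exp (- \<theta> * u) * f u \<omega>) \<in> borel_measurable (lborel \<Otimes>\<^sub>M M)"
    using m by measurable
  show "AE x in lborel \<Otimes>\<^sub>M M. norm (case x of (u, \<omega>) \<Rightarrow> indicator {0..} u * exp (- \<theta> * u) * f u \<omega>)
      \<le> norm (case x of (u, \<omega>) \<Rightarrow> indicator {0..} u * exp (- \<theta> * u))"
    using b by (intro AE_I2) (auto simp: space_pair_measure abs_mult indicator_def mult_le_cancel_left2)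
qed

lemma Phi_eq_cdf:
  assumes \<theta>: "\<theta> > 0"
  shows "Phi \<theta> r = 1 - \<theta> * (LINT v|lborel. indicator {0..} v * exp (- \<theta> * v) * cdf_D v r)"
proof -
  have int: "integrable (lborel \<Otimes>\<^sub>M M) (\<lambda>(u, \<omega>). indicator {0..} u * exp (- \<theta> * u) * indicator {..r} (D (max 0 u) \<omega>))"
    by (intro integrable_exp_weight[OF \<theta>]) (auto simp: indicator_def)
  show ?thesis
    using P.integral_fst[OF int] by (simp add: Phi_def cdf_D_def case_prod_beta')
qed

lemma abs_Phi_le_1:
  assumes \<theta>: "\<theta> > 0"
  shows "\<bar>Phi \<theta> r\<bar> \<le> 1"
proof -
  let ?w = "\<lambda>v. indicator {0..} v * exp (- \<theta> * v) :: real"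
  note w = has_bochner_integral_exp_Ici[OF \<theta>]
  have "integrable lborel (\<lambda>v. ?w v * cdf_D v r)"
    by (rule Bochner_Integration.integrable_bound[OF integrable.intros[OF w]])
      (auto simp: abs_mult cdf_D_nonneg cdf_D_le_1 mult_left_le)
  then have "(LINT v|lborel. ?w v * cdf_D v r) \<le> (LINT v|lborel. ?w v)"
    using integrable.intros[OF w] by (intro integral_mono) (auto simp: cdf_D_le_1 mult_left_le)
  also have "\<dots> = 1 / \<theta>" by (rule has_bochner_integral_integral_eq[OF w])
  finally have "\<theta> * (LINT v|lborel. ?w v * cdf_D v r) \<le> \<theta> * (1 / \<theta>)"
    by (rule mult_left_mono) (use \<theta> in simp)
  moreover have "(LINT v|lborel. ?w v * cdf_D v r) \<ge> 0"
    by (intro Bochner_Integration.integral_nonneg) (auto simp: cdf_D_nonneg)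
  ultimately show ?thesis using \<theta> by (simp add: Phi_eq_cdf[OF \<theta>] abs_le_iff)
qed

text \<open>Independence and stationarity of the increments over \<open>[0, u]\<close> and \<open>[u, u + v]\<close>.\<close>

lemma expectation_two_levels:
  assumes u: "u \<ge> 0" and v: "v > 0"
  shows "(LINT \<omega>|M. indicator {..s} (D u \<omega>) * indicator {..t} (D (u + v) \<omega>)) =
    (LINT \<omega>|M. indicator {..s} (D u \<omega>) * cdf_D v (t - D u \<omega>))"
proof (cases "u = 0")
  \<comment> \<open>Independence of increments is available for strictly increasing times, so
    \<open>u = 0\<close> is treated apart.\<close>
  case True
  have "(LINT \<omega>|M. indicator {..s} (D u \<omega>) * indicator {..t} (D (u + v) \<omega>)) =
      (LINT \<omega>|M. indicator {..s} 0 * indicator {..t} (D (max 0 v) \<omega>))"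
    using v True by (intro Bochner_Integration.integral_cong refl) (auto simp: D_0 max_def)
  also have "\<dots> = (LINT \<omega>|M. indicator {..s} 0 * cdf_D v t)" by (simp add: cdf_D_def prob_space)
  also have "\<dots> = (LINT \<omega>|M. indicator {..s} (D u \<omega>) * cdf_D v (t - D u \<omega>))"
    using True by (intro Bochner_Integration.integral_cong refl) (auto simp: D_0)
  finally show ?thesis .
next
  case False
  then have u: "u > 0" using u by simp
  have [measurable]: "D u \<in> borel_measurable M" "D v \<in> borel_measurable M" "D (u + v) \<in> borel_measurable M"
    using u v by (auto intro!: random_variable_D)
  define \<tau> :: "nat \<Rightarrow> real" where "\<tau> = (\<lambda>i. if i = 0 then 0 else if i = 1 then u else u + v)"
  let ?X = "\<lambda>i \<omega>. D (\<tau> (Suc i)) \<omega> - D (\<tau> i) \<omega>"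
  have "indep_vars (\<lambda>_. borel) ?X {..<2}"
    using u v by (intro indep_increments) (auto simp: \<tau>_def less_2_cases_iff)
  then have "indep_var (PiM {0} (\<lambda>_. borel)) (\<lambda>\<omega>. restrict (\<lambda>i. ?X i \<omega>) {0}) (PiM {1} (\<lambda>_. borel)) (\<lambda>\<omega>. restrict (\<lambda>i. ?X i \<omega>) {1})"
    by (rule indep_var_restrict) auto
  then have "indep_var borel ((\<lambda>f. f 0) \<circ> (\<lambda>\<omega>. restrict (\<lambda>i. ?X i \<omega>) {0})) borel ((\<lambda>f. f 1) \<circ> (\<lambda>\<omega>. restrict (\<lambda>i. ?X i \<omega>) {1}))"
    by (rule indep_var_compose) auto
  then have "indep_var borel (\<lambda>\<omega>. D u \<omega> - D 0 \<omega>) borel (\<lambda>\<omega>. D (u + v) \<omega> - D u \<omega>)"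
    by (simp add: comp_def \<tau>_def)
  then have "distr M borel (\<lambda>\<omega>. D u \<omega> - D 0 \<omega>) \<Otimes>\<^sub>M distr M borel (\<lambda>\<omega>. D (u + v) \<omega> - D u \<omega>) =
      distr M (borel \<Otimes>\<^sub>M borel) (\<lambda>\<omega>. (D u \<omega> - D 0 \<omega>, D (u + v) \<omega> - D u \<omega>))"
    by (simp add: indep_var_distribution_eq)
  moreover have "distr M borel (\<lambda>\<omega>. D u \<omega> - D 0 \<omega>) = distr M borel (D u)"
    by (intro distr_cong) (auto simp: D_0)
  moreover have "distr M (borel \<Otimes>\<^sub>M borel) (\<lambda>\<omega>. (D u \<omega> - D 0 \<omega>, D (u + v) \<omega> - D u \<omega>)) =
      distr M (borel \<Otimes>\<^sub>M borel) (\<lambda>\<omega>. (D u \<omega>, D (u + v) \<omega> - D u \<omega>))"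
    by (intro distr_cong) (auto simp: D_0)
  moreover have "distr M borel (\<lambda>\<omega>. D (u + v) \<omega> - D u \<omega>) = distr M borel (D v)"
    using sub u v unfolding subordinator_def by auto
  ultimately have eq: "distr M borel (D u) \<Otimes>\<^sub>M distr M borel (D v) =
      distr M (borel \<Otimes>\<^sub>M borel) (\<lambda>\<omega>. (D u \<omega>, D (u + v) \<omega> - D u \<omega>))" by simp
  interpret U: prob_space "distr M borel (D u)" by (rule prob_space_distr) measurable
  interpret V: prob_space "distr M borel (D v)" by (rule prob_space_distr) measurable
  interpret UV: pair_prob_space "distr M borel (D u)" "distr M borel (D v)" ..
  let ?f = "\<lambda>x y. indicator {..s} x * indicator {..t} (x + y) :: real"
  have fm[measurable]: "case_prod ?f \<in> borel_measurable (borel \<Otimes>\<^sub>M borel)" by measurable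
  have int: "integrable (distr M borel (D u) \<Otimes>\<^sub>M distr M borel (D v)) (case_prod ?f)"
    by (rule UV.P.integrable_const_bound[where B = 1]) (auto simp: indicator_def)
  have "(LINT \<omega>|M. indicator {..s} (D u \<omega>) * indicator {..t} (D (u + v) \<omega>)) =
      (LINT p|(distr M (borel \<Otimes>\<^sub>M borel) (\<lambda>\<omega>. (D u \<omega>, D (u + v) \<omega> - D u \<omega>))). case_prod ?f p)"
    by (subst integral_distr) auto
  also have "\<dots> = (LINT x|(distr M borel (D u)). LINT y|(distr M borel (D v)). ?f x y)"
    unfolding eq[symmetric] using UV.integral_fst[OF int] by simp
  also have "\<dots> = (LINT x|(distr M borel (D u)). indicator {..s} x * cdf_D v (t - x))"
  proof (intro Bochner_Integration.integral_cong refl)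
    fix x
    have "(LINT y|(distr M borel (D v)). ?f x y) = (LINT \<omega>|M. ?f x (D v \<omega>))"
      by (subst integral_distr) auto
    also have "\<dots> = indicator {..s} x * (LINT \<omega>|M. indicator {..t} (x + D v \<omega>))" by simp
    also have "(LINT \<omega>|M. indicator {..t} (x + D v \<omega>)) = cdf_D v (t - x)"
      unfolding cdf_D_def using v by (intro Bochner_Integration.integral_cong refl) (auto simp: indicator_def max_def)
    finally show "(LINT y|(distr M borel (D v)). ?f x y) = indicator {..s} x * cdf_D v (t - x)" .
  qed
  also have "\<dots> = (LINT \<omega>|M. indicator {..s} (D u \<omega>) * cdf_D v (t - D u \<omega>))"
    by (subst integral_distr) auto
  finally show ?thesis .
qed

text \<open>The simple Markov property of \<open>D\<close> at time \<open>u\<close>.\<close>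

lemma expectation_exp_E_level:
  assumes \<theta>: "\<theta> > 0" and u: "u \<ge> 0" and st: "s \<le> t" and [measurable]: "E t \<in> borel_measurable M"
  shows "(LINT \<omega>|M. indicator {..s} (D u \<omega>) * exp (- \<theta> * max 0 (E t \<omega> - u))) =
    (LINT \<omega>|M. indicator {..s} (D u \<omega>) * Phi \<theta> (t - D u \<omega>))"
proof -
  have [measurable]: "D u \<in> borel_measurable M" by (rule random_variable_D[OF u])
  let ?w = "\<lambda>v. indicator {0..} v * exp (- \<theta> * v) :: real"
  let ?f = "\<lambda>v \<omega>. indicator {..s} (D u \<omega>) * indicator {..t} (D (max 0 (u + v)) \<omega>) :: real"
  let ?g = "\<lambda>v \<omega>. indicator {..s} (D u \<omega>) * cdf_D v (t - D u \<omega>)"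
  have f: "integrable (lborel \<Otimes>\<^sub>M M) (\<lambda>(v, \<omega>). ?w v * ?f v \<omega>)"
    by (intro integrable_exp_weight[OF \<theta>]) (auto simp: indicator_def)
  have g: "integrable (lborel \<Otimes>\<^sub>M M) (\<lambda>(v, \<omega>). ?w v * ?g v \<omega>)"
    by (intro integrable_exp_weight[OF \<theta>]) (auto simp: indicator_def cdf_D_nonneg cdf_D_le_1)
  have "(LINT \<omega>|M. LINT v|lborel. ?w v * ?f v \<omega>) = (LINT v|lborel. LINT \<omega>|M. ?w v * ?f v \<omega>)"
    by (rule P.Fubini_integral[OF f])
  also have "\<dots> = (LINT v|lborel. LINT \<omega>|M. ?w v * ?g v \<omega>)"
  proof (rule integral_cong_AE)
    show "AE v in lborel. (LINT \<omega>|M. ?w v * ?f v \<omega>) = (LINT \<omega>|M. ?w v * ?g v \<omega>)"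
      using AE_lborel_singleton[of 0]
    proof eventually_elim
      case (elim v)
      show ?case using elim u expectation_two_levels[OF u, of v s t] by (cases "v > 0") auto
    qed
  qed (use borel_measurable_integrable[OF P.integrable_fst[OF f]] borel_measurable_integrable[OF P.integrable_fst[OF g]] in auto)
  also have "\<dots> = (LINT \<omega>|M. LINT v|lborel. ?w v * ?g v \<omega>)"
    by (rule P.Fubini_integral[OF g, symmetric])
  finally have fg: "(LINT \<omega>|M. LINT v|lborel. ?w v * ?f v \<omega>) = (LINT \<omega>|M. LINT v|lborel. ?w v * ?g v \<omega>)" .
  have ind: "integrable M (\<lambda>\<omega>. indicator {..s} (D u \<omega>) :: real)"
    by (intro integrable_bounded[where B = 1]) (auto simp: indicator_def)
  \<comment> \<open>Where D(u) <= s <= t the inner integral is the one of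
    \<open>integral_exp_level\<close>; where D(u) > s both sides vanish.\<close>
  have "(LINT \<omega>|M. indicator {..s} (D u \<omega>) * exp (- \<theta> * max 0 (E t \<omega> - u))) =
      (LINT \<omega>|M. indicator {..s} (D u \<omega>) - \<theta> * (LINT v|lborel. ?w v * ?f v \<omega>))"
  proof (rule integral_cong_AE)
    show "AE \<omega> in M. indicator {..s} (D u \<omega>) * exp (- \<theta> * max 0 (E t \<omega> - u)) =
        indicator {..s} (D u \<omega>) - \<theta> * (LINT v|lborel. ?w v * ?f v \<omega>)"
      using AE_unbounded AE_space
    proof eventually_elim
      case (elim \<omega>)
      show ?case
      proof (cases "D u \<omega> \<le> s")
        case True
        then have "D u \<omega> \<le> t" using st by simp
        then show ?thesis
          using integral_exp_level[OF elim(2) elim(1)[rule_format, of t] u _ \<theta>] le_E_if_D_le[OF elim(2) elim(1)[rule_format, of t] u] True \<theta>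
          by simp
      qed simp
    qed
  qed (use borel_measurable_integrable[OF P.integrable_snd[OF f]] in measurable)
  also have "\<dots> = (LINT \<omega>|M. indicator {..s} (D u \<omega>) - \<theta> * (LINT v|lborel. ?w v * ?g v \<omega>))"
    using P.integrable_snd[OF f] P.integrable_snd[OF g] ind fg by simp
  also have "\<dots> = (LINT \<omega>|M. indicator {..s} (D u \<omega>) * Phi \<theta> (t - D u \<omega>))"
  proof (intro Bochner_Integration.integral_cong refl)
    fix \<omega>
    have "?w v * ?g v \<omega> = indicator {..s} (D u \<omega>) * (?w v * cdf_D v (t - D u \<omega>))" for v by simp
    then have "(LINT v|lborel. ?w v * ?g v \<omega>) = indicator {..s} (D u \<omega>) * (LINT v|lborel. ?w v * cdf_D v (t - D u \<omega>))"
      by (simp only: integral_mult_right_zero)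
    then show "indicator {..s} (D u \<omega>) - \<theta> * (LINT v|lborel. ?w v * ?g v \<omega>) = indicator {..s} (D u \<omega>) * Phi \<theta> (t - D u \<omega>)"
      by (simp only: Phi_eq_cdf[OF \<theta>] right_diff_distrib mult_1_right mult.left_commute)
  qed
  finally show ?thesis .
qed

text \<open>The Markov identity at \<open>u = 0\<close>, where \<open>D 0 = 0\<close> makes the
  event trivial.\<close>

lemma expectation_exp_E:
  assumes \<theta>: "\<theta> > 0" and t: "t \<ge> 0" and E: "E t \<in> borel_measurable M"
  shows "(LINT \<omega>|M. exp (- \<theta> * E t \<omega>)) = Phi \<theta> t"
proof -
  have "(LINT \<omega>|M. indicator {..0} (D 0 \<omega>) * exp (- \<theta> * max 0 (E t \<omega> - 0))) = (LINT \<omega>|M. exp (- \<theta> * E t \<omega>))"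
    using E_nonneg by (intro Bochner_Integration.integral_cong refl) (auto simp: D_0 max_def)
  moreover have "(LINT \<omega>|M. indicator {..0} (D 0 \<omega>) * Phi \<theta> (t - D 0 \<omega>)) = (LINT \<omega>|M. Phi \<theta> t)"
    by (intro Bochner_Integration.integral_cong refl) (auto simp: D_0)
  ultimately show ?thesis
    using expectation_exp_E_level[OF \<theta> order_refl t E] by (simp add: prob_space)
qed

lemma expectation_exp_E_increment:
  assumes \<theta>: "\<theta> > 0" and st: "0 \<le> s" "s \<le> t" and [measurable]: "E s \<in> borel_measurable M" "E t \<in> borel_measurable M"
  shows "(LINT \<omega>|M. exp (- \<theta> * (E t \<omega> - E s \<omega>))) = Phi \<theta> t +
    \<theta> * (LINT x|(lborel \<Otimes>\<^sub>M M). indicator {0..} (fst x) * (indicator {..s} (D (max 0 (fst x)) (snd x)) * Phi \<theta> (t - D (max 0 (fst x)) (snd x))))"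
proof -
  let ?f = "\<lambda>u \<omega>. indicator {0..} u * indicator {..s} (D (max 0 u) \<omega>) * exp (- \<theta> * max 0 (E t \<omega> - u))"
  let ?g = "\<lambda>u \<omega>. indicator {0..} u * (indicator {..s} (D (max 0 u) \<omega>) * Phi \<theta> (t - D (max 0 u) \<omega>))"
  \<comment> \<open>Where D(u) <= s the factor exp(s - D(u)) is at least 1, so the finite damped
    potential dominates the indicator. This permits Fubini although u carries no exponential
    weight.\<close>
  have pot: "integrable (lborel \<Otimes>\<^sub>M M) (\<lambda>x. exp s * (indicator {0..} (fst x) * exp (- 0 * fst x) * exp (- 1 * D (max 0 (fst x)) (snd x))))"
    using integrable.intros[OF potential_laplace[of 0 1]] by simp
  have dom: "integrable (lborel \<Otimes>\<^sub>M M) (\<lambda>x. indicator {0..} (fst x) * indicator {..s} (D (max 0 (fst x)) (snd x)) :: real)"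
    by (rule Bochner_Integration.integrable_bound[OF pot])
      (auto simp: indicator_def mult_exp_exp intro!: AE_I2)
  have f: "integrable (lborel \<Otimes>\<^sub>M M) (case_prod ?f)"
    by (rule Bochner_Integration.integrable_bound[OF dom]) (use \<theta> in \<open>auto simp: indicator_def intro!: AE_I2\<close>)
  have Phi01: "\<bar>Phi \<theta> r\<bar> \<le> 1" for r by (rule abs_Phi_le_1[OF \<theta>])
  have [measurable]: "Phi \<theta> \<in> borel_measurable borel"
    unfolding Phi_eq_cdf[OF \<theta>, abs_def] by measurable
  have g: "integrable (lborel \<Otimes>\<^sub>M M) (case_prod ?g)"
    by (rule Bochner_Integration.integrable_bound[OF dom]) (use Phi01 in \<open>auto simp: indicator_def abs_mult intro!: AE_I2\<close>)
  have "(LINT \<omega>|M. exp (- \<theta> * (E t \<omega> - E s \<omega>))) = (LINT \<omega>|M. exp (- \<theta> * E t \<omega>) + \<theta> * (LINT u|lborel. ?f u \<omega>))"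
  proof (rule integral_cong_AE)
    show "AE \<omega> in M. exp (- \<theta> * (E t \<omega> - E s \<omega>)) = exp (- \<theta> * E t \<omega>) + \<theta> * (LINT u|lborel. ?f u \<omega>)"
      using AE_unbounded AE_space
      by eventually_elim (rule exp_increment_E_eq, use st \<theta> in simp_all)
  qed (use borel_measurable_integrable[OF P.integrable_snd[OF f]] in measurable)
  also have "\<dots> = (LINT \<omega>|M. exp (- \<theta> * E t \<omega>)) + \<theta> * (LINT \<omega>|M. LINT u|lborel. ?f u \<omega>)"
    using P.integrable_snd[OF f] \<theta> E_nonneg[of t]
    by (subst Bochner_Integration.integral_add) (auto intro!: integrable_bounded[where B = 1])
  also have "(LINT \<omega>|M. LINT u|lborel. ?f u \<omega>) = (LINT u|lborel. LINT \<omega>|M. ?f u \<omega>)"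
    by (rule P.Fubini_integral[OF f])
  also have "\<dots> = (LINT u|lborel. LINT \<omega>|M. ?g u \<omega>)"
  proof (rule Bochner_Integration.integral_cong[OF refl])
    fix u :: real
    show "(LINT \<omega>|M. ?f u \<omega>) = (LINT \<omega>|M. ?g u \<omega>)"
      using expectation_exp_E_level[OF \<theta> _ st(2), of u] by (cases "u \<ge> 0") (simp_all add: max.absorb2)
  qed
  also have "\<dots> = (LINT x|(lborel \<Otimes>\<^sub>M M). indicator {0..} (fst x) * (indicator {..s} (D (max 0 (fst x)) (snd x)) * Phi \<theta> (t - D (max 0 (fst x)) (snd x))))"
    using P.integral_fst[OF g] by (simp add: case_prod_beta')
  also have "(LINT \<omega>|M. exp (- \<theta> * E t \<omega>)) = Phi \<theta> t"
    using st by (intro expectation_exp_E[OF \<theta>]) auto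
  finally show ?thesis .
qed

end

section \<open>The Ito isometry\<close>

lemma abs_mult_le_sum_squares: "\<bar>x * y\<bar> \<le> x\<^sup>2 + (y\<^sup>2 :: real)"
proof -
  have "2 * (\<bar>x\<bar> * \<bar>y\<bar>) \<le> x\<^sup>2 + y\<^sup>2"
    using zero_le_power2[of "\<bar>x\<bar> - \<bar>y\<bar>"] by (simp add: power2_diff)
  moreover have "0 \<le> \<bar>x\<bar> * \<bar>y\<bar>" by simp
  ultimately show ?thesis unfolding abs_mult by linarith
qed

lemma integrable_mult_squares:
  fixes f g :: "'b \<Rightarrow> real"
  assumes [measurable]: "f \<in> borel_measurable M" "g \<in> borel_measurable M"
    and "integrable M (\<lambda>x. (f x)\<^sup>2)" "integrable M (\<lambda>x. (g x)\<^sup>2)"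
  shows "integrable M (\<lambda>x. f x * g x)"
proof (rule Bochner_Integration.integrable_bound)
  show "integrable M (\<lambda>x. (f x)\<^sup>2 + (g x)\<^sup>2)" using assms by simp
  show "AE x in M. norm (f x * g x) \<le> norm ((f x)\<^sup>2 + (g x)\<^sup>2)"
    using abs_mult_le_sum_squares[of "f _" "g _"] by (auto intro!: AE_I2)
qed measurable

lemma integrable_square_diff:
  fixes f g :: "'b \<Rightarrow> real"
  assumes "f \<in> borel_measurable M" "g \<in> borel_measurable M"
    and "integrable M (\<lambda>x. (f x)\<^sup>2)" "integrable M (\<lambda>x. (g x)\<^sup>2)"
  shows "integrable M (\<lambda>x. (f x - g x)\<^sup>2)" "integrable M (\<lambda>x. (f x + g x)\<^sup>2)"
  using assms integrable_mult_squares[OF assms] by (simp_all add: power2_diff power2_sum mult.assoc)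

lemma (in prob_space) integrable_of_square:
  fixes f :: "'a \<Rightarrow> real"
  assumes "f \<in> borel_measurable M" "integrable M (\<lambda>x. (f x)\<^sup>2)"
  shows "integrable M f"
  using integrable_mult_squares[of f M "\<lambda>_. 1"] assms by simp

section \<open>Increments of Brownian motion\<close>

locale brownian_space = prob_space M for M :: "'a measure" +
  fixes F :: "real \<Rightarrow> 'a measure" and W :: "real \<Rightarrow> 'a \<Rightarrow> real"
  assumes bm: "brownian_motion M F W"
begin

lemma space_F: "space (F t) = space M"
  using bm unfolding brownian_motion_def filtration_def by blast

lemma sets_F_mono: "s \<le> t \<Longrightarrow> sets (F s) \<subseteq> sets (F t)"
  using bm unfolding brownian_motion_def filtration_def by blast

lemma sets_F_events: "t \<ge> 0 \<Longrightarrow> sets (F t) \<subseteq> events"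
  using bm unfolding brownian_motion_def by blast

lemma measurable_F_mono: "f \<in> borel_measurable (F s) \<Longrightarrow> s \<le> t \<Longrightarrow> f \<in> borel_measurable (F t)"
  using measurable_mono[OF order_refl refl sets_F_mono] by (auto simp: space_F)

lemma measurable_F_M: "f \<in> borel_measurable (F s) \<Longrightarrow> 0 \<le> s \<Longrightarrow> f \<in> borel_measurable M"
  using measurable_mono[OF order_refl refl sets_F_events] by (auto simp: space_F)

lemma W_measurable: "t \<ge> 0 \<Longrightarrow> W t \<in> borel_measurable (F t)"
  using bm unfolding brownian_motion_def by blast

lemma W_incr_measurable: "0 \<le> a \<Longrightarrow> a \<le> b \<Longrightarrow> (\<lambda>\<omega>. W b \<omega> - W a \<omega>) \<in> borel_measurable (F b)"
  using W_measurable[of b] measurable_F_mono[OF W_measurable[of a]] by (intro borel_measurable_diff) auto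

lemma indep_incr:
  assumes ab: "0 \<le> a" "a < b" and \<eta>: "\<eta> \<in> borel_measurable (F a)"
  shows "indep_var borel \<eta> borel (\<lambda>\<omega>. W b \<omega> - W a \<omega>)"
proof -
  let ?\<Delta> = "\<lambda>\<omega>. W b \<omega> - W a \<omega>"
  have m: "\<eta> \<in> borel_measurable M" "?\<Delta> \<in> borel_measurable M"
    using ab measurable_F_M[OF \<eta>] measurable_F_M[OF W_incr_measurable[of a b]] by auto
  have "indep_set (sets (F a)) {?\<Delta> -` B \<inter> space M | B. B \<in> sets borel}"
    using bm ab unfolding brownian_motion_def by blast
  moreover have "{\<eta> -` A \<inter> space M | A. A \<in> sets borel} \<subseteq> sets (F a)"
    using measurable_sets[OF \<eta>] by (auto simp: space_F)
  ultimately have "indep_set {\<eta> -` A \<inter> space M | A. A \<in> sets borel} {?\<Delta> -` B \<inter> space M | B. B \<in> sets borel}"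
    unfolding indep_set_def by (elim indep_sets_mono_sets) (auto split: bool.split)
  then have "indep_sets (\<lambda>i. {case_bool \<eta> ?\<Delta> i -` A \<inter> space M | A. A \<in> sets (case_bool borel borel i)}) UNIV"
    unfolding indep_set_def by (rule indep_sets_mono_sets) (auto split: bool.split)
  then show ?thesis
    unfolding indep_var_def indep_vars_def2 using m by (auto split: bool.split)
qed

lemma incr_moments:
  assumes ab: "0 \<le> a" "a \<le> b"
  shows integrable_incr: "integrable M (\<lambda>\<omega>. W b \<omega> - W a \<omega>)"
    and integrable_incr_square: "integrable M (\<lambda>\<omega>. (W b \<omega> - W a \<omega>)\<^sup>2)"
    and expectation_incr: "expectation (\<lambda>\<omega>. W b \<omega> - W a \<omega>) = 0"
    and expectation_incr_square: "expectation (\<lambda>\<omega>. (W b \<omega> - W a \<omega>)\<^sup>2) = b - a"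
proof -
  let ?\<Delta> = "\<lambda>\<omega>. W b \<omega> - W a \<omega>"
  have "integrable M ?\<Delta> \<and> integrable M (\<lambda>\<omega>. (?\<Delta> \<omega>)\<^sup>2) \<and> expectation ?\<Delta> = 0 \<and> expectation (\<lambda>\<omega>. (?\<Delta> \<omega>)\<^sup>2) = b - a"
  proof (cases "a = b")
    case False
    then have ab': "a < b" using ab by simp
    define \<sigma> where "\<sigma> = sqrt (b - a)"
    have \<sigma>: "\<sigma> > 0" "\<sigma>\<^sup>2 = b - a" using ab' by (auto simp: \<sigma>_def)
    have D: "distributed M lborel ?\<Delta> (\<lambda>x. ennreal (normal_density 0 \<sigma> x))"
      using bm ab(1) ab' unfolding brownian_motion_def \<sigma>_def by blast
    have "integrable M ?\<Delta>"
      using distributed_integrable[OF D, of "\<lambda>x. x"] integrable_normal_moment[OF \<sigma>(1), of 0 1] by simp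
    moreover have "integrable M (\<lambda>\<omega>. (?\<Delta> \<omega>)\<^sup>2)"
      using distributed_integrable[OF D, of "\<lambda>x. x\<^sup>2"] integrable_normal_moment[OF \<sigma>(1), of 0 2] by simp
    moreover have "expectation ?\<Delta> = 0" by (rule normal_distributed_expectation[OF \<sigma>(1) D])
    moreover have "variance ?\<Delta> = \<sigma>\<^sup>2" by (rule normal_distributed_variance[OF \<sigma>(1) D])
    ultimately show ?thesis using \<sigma> by simp
  qed simp
  then show "integrable M ?\<Delta>" "integrable M (\<lambda>\<omega>. (?\<Delta> \<omega>)\<^sup>2)" "expectation ?\<Delta> = 0" "expectation (\<lambda>\<omega>. (?\<Delta> \<omega>)\<^sup>2) = b - a"
    by blast+
qed

lemma
  assumes ab: "0 \<le> a" "a \<le> b" and \<eta>: "\<eta> \<in> borel_measurable (F a)" "integrable M \<eta>"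
  shows integrable_mult_incr: "integrable M (\<lambda>\<omega>. \<eta> \<omega> * (W b \<omega> - W a \<omega>))"
    and expectation_mult_incr: "expectation (\<lambda>\<omega>. \<eta> \<omega> * (W b \<omega> - W a \<omega>)) = 0"
    and expectation_mult_incr_square: "expectation (\<lambda>\<omega>. \<eta> \<omega> * (W b \<omega> - W a \<omega>)\<^sup>2) = expectation \<eta> * (b - a)"
proof -
  let ?\<Delta> = "\<lambda>\<omega>. W b \<omega> - W a \<omega>"
  have "integrable M (\<lambda>\<omega>. \<eta> \<omega> * ?\<Delta> \<omega>) \<and> expectation (\<lambda>\<omega>. \<eta> \<omega> * ?\<Delta> \<omega>) = 0 \<and>
    expectation (\<lambda>\<omega>. \<eta> \<omega> * (?\<Delta> \<omega>)\<^sup>2) = expectation \<eta> * (b - a)"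
  proof (cases "a = b")
    case False
    then have I: "indep_var borel \<eta> borel ?\<Delta>" using ab \<eta> by (intro indep_incr) auto
    have "indep_var borel ((\<lambda>x. x) \<circ> \<eta>) borel ((\<lambda>x. x\<^sup>2) \<circ> ?\<Delta>)"
      by (rule indep_var_compose[OF I]) auto
    then have I2: "indep_var borel \<eta> borel (\<lambda>\<omega>. (?\<Delta> \<omega>)\<^sup>2)" by (simp add: comp_def)
    show ?thesis
      using indep_var_integrable[OF I \<eta>(2)] indep_var_lebesgue_integral[OF I \<eta>(2)]
        indep_var_lebesgue_integral[OF I2 \<eta>(2)] incr_moments[OF ab] by simp
  qed simp
  then show "integrable M (\<lambda>\<omega>. \<eta> \<omega> * ?\<Delta> \<omega>)" "expectation (\<lambda>\<omega>. \<eta> \<omega> * ?\<Delta> \<omega>) = 0"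
    "expectation (\<lambda>\<omega>. \<eta> \<omega> * (?\<Delta> \<omega>)\<^sup>2) = expectation \<eta> * (b - a)" by blast+
qed

text \<open>The data of one summand \<xi> (W b - W a) of a simple integral; a family of blocks need
  not come from one partition.\<close>

definition block :: "('a \<Rightarrow> real) \<Rightarrow> real \<Rightarrow> real \<Rightarrow> bool" where
  "block \<xi> a b \<longleftrightarrow> 0 \<le> a \<and> a \<le> b \<and> \<xi> \<in> borel_measurable (F a) \<and> (\<exists>C. \<forall>\<omega>\<in>space M. \<bar>\<xi> \<omega>\<bar> \<le> C)"

lemma integrable_bounded_mult:
  assumes "\<xi> \<in> borel_measurable M" "\<forall>\<omega>\<in>space M. \<bar>\<xi> \<omega>\<bar> \<le> C" "integrable M f"
  shows "integrable M (\<lambda>\<omega>. \<xi> \<omega> * f \<omega> :: real)"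
proof (rule Bochner_Integration.integrable_bound)
  show "integrable M (\<lambda>\<omega>. C * f \<omega>)" using assms by simp
  show "AE \<omega> in M. norm (\<xi> \<omega> * f \<omega>) \<le> norm (C * f \<omega>)"
    using assms(2) by (auto intro!: AE_I2 mult_right_mono simp: abs_mult intro: order_trans[OF _ abs_ge_self])
qed (use assms in measurable)

lemma block_measurable: "block \<xi> a b \<Longrightarrow> \<xi> \<in> borel_measurable M"
  unfolding block_def by (auto intro: measurable_F_M)

lemma block_incr:
  assumes "block \<xi> a b"
  shows "(\<lambda>\<omega>. \<xi> \<omega> * (W b \<omega> - W a \<omega>)) \<in> borel_measurable M"
    and "integrable M (\<lambda>\<omega>. (\<xi> \<omega> * (W b \<omega> - W a \<omega>))\<^sup>2)"
proof -
  obtain C where C: "\<forall>\<omega>\<in>space M. \<bar>\<xi> \<omega>\<bar> \<le> C" and ab: "0 \<le> a" "a \<le> b" using assms by (auto simp: block_def)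
  note [measurable] = block_measurable[OF assms] 
  have [measurable]: "(\<lambda>\<omega>. W b \<omega> - W a \<omega>) \<in> borel_measurable M"
    using integrable_incr[OF ab] by simp
  show "(\<lambda>\<omega>. \<xi> \<omega> * (W b \<omega> - W a \<omega>)) \<in> borel_measurable M" by measurable
  have "integrable M (\<lambda>\<omega>. \<xi> \<omega> * (\<xi> \<omega> * (W b \<omega> - W a \<omega>)\<^sup>2))"
    by (intro integrable_bounded_mult[OF _ C] integrable_incr_square ab) measurable
  then show "integrable M (\<lambda>\<omega>. (\<xi> \<omega> * (W b \<omega> - W a \<omega>))\<^sup>2)"
    by (simp add: power2_eq_square mult_ac)
qed

text \<open>Two increments over arbitrary, possibly overlapping intervals are treated at once, so that no
  common refinement of partitions is needed.\<close>

lemma expectation_block_mult_aux: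
  assumes 1: "block \<xi> a b" and 2: "block \<zeta> c d" and ac: "a \<le> c"
  shows "expectation (\<lambda>\<omega>. (\<xi> \<omega> * (W b \<omega> - W a \<omega>)) * (\<zeta> \<omega> * (W d \<omega> - W c \<omega>))) =
    expectation (\<lambda>\<omega>. \<xi> \<omega> * \<zeta> \<omega>) * max 0 (min b d - max a c)"
proof -
  obtain C C' where C: "\<forall>\<omega>\<in>space M. \<bar>\<xi> \<omega>\<bar> \<le> C" and C': "\<forall>\<omega>\<in>space M. \<bar>\<zeta> \<omega>\<bar> \<le> C'"
    using 1 2 by (auto simp: block_def)
  have ab: "0 \<le> a" "a \<le> b" "0 \<le> c" "c \<le> d" and m: "\<xi> \<in> borel_measurable (F a)" "\<zeta> \<in> borel_measurable (F c)"
    using 1 2 by (auto simp: block_def)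
  note [measurable] = block_measurable[OF 1] block_measurable[OF 2]
  have m': "\<xi> \<in> borel_measurable (F c)" using m(1) ac by (rule measurable_F_mono)
  have bdd: "integrable M (\<lambda>\<omega>. \<xi> \<omega> * (\<zeta> \<omega> * f \<omega>))" if "integrable M f" for f
    by (intro integrable_bounded_mult[OF _ C] integrable_bounded_mult[OF _ C'] that) measurable
  have sep: "integrable M (\<lambda>\<omega>. (\<xi> \<omega> * (\<zeta> \<omega> * (W q \<omega> - W p \<omega>))) * (W v \<omega> - W q \<omega>))"
     "expectation (\<lambda>\<omega>. (\<xi> \<omega> * (\<zeta> \<omega> * (W q \<omega> - W p \<omega>))) * (W v \<omega> - W q \<omega>)) = 0"
    if "0 \<le> p" "p \<le> q" "q \<le> v" "c \<le> q" for p q v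
    using that ab measurable_F_mono[OF m' \<open>c \<le> q\<close>] measurable_F_mono[OF m(2) \<open>c \<le> q\<close>] W_incr_measurable[of p q]
    by (intro integrable_mult_incr expectation_mult_incr bdd integrable_incr borel_measurable_times; simp)+
  show ?thesis
  proof (cases "b \<le> c")
    case True
    have "(\<lambda>\<omega>. \<xi> \<omega> * (\<zeta> \<omega> * (W b \<omega> - W a \<omega>))) \<in> borel_measurable (F c)"
      using m' m(2) measurable_F_mono[OF W_incr_measurable[OF ab(1,2)] True] by simp
    then have "expectation (\<lambda>\<omega>. (\<xi> \<omega> * (\<zeta> \<omega> * (W b \<omega> - W a \<omega>))) * (W d \<omega> - W c \<omega>)) = 0"
      using ab by (intro expectation_mult_incr bdd integrable_incr) auto
    then show ?thesis using True ab by (simp add: mult_ac)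
  next
    case False
    let ?e = "min b d"
    have inc: "c \<le> ?e" "?e \<le> b" "?e \<le> d" using False ab by auto
    have sq: "expectation (\<lambda>\<omega>. (\<xi> \<omega> * \<zeta> \<omega>) * (W ?e \<omega> - W c \<omega>)\<^sup>2) = expectation (\<lambda>\<omega>. \<xi> \<omega> * \<zeta> \<omega>) * (?e - c)"
      using bdd[of "\<lambda>_. 1"] m' m(2) ab inc by (intro expectation_mult_incr_square) auto
    have sqi: "integrable M (\<lambda>\<omega>. (\<xi> \<omega> * \<zeta> \<omega>) * (W ?e \<omega> - W c \<omega>)\<^sup>2)"
      using bdd[OF integrable_incr_square[of c ?e]] ab inc by (simp add: mult.assoc)
    have s1: "integrable M (\<lambda>\<omega>. (\<xi> \<omega> * (\<zeta> \<omega> * (W c \<omega> - W a \<omega>))) * (W d \<omega> - W c \<omega>))"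
        "expectation (\<lambda>\<omega>. (\<xi> \<omega> * (\<zeta> \<omega> * (W c \<omega> - W a \<omega>))) * (W d \<omega> - W c \<omega>)) = 0"
      using sep[of a c d] ab ac by auto
    have s2: "integrable M (\<lambda>\<omega>. (\<xi> \<omega> * (\<zeta> \<omega> * (W ?e \<omega> - W c \<omega>))) * (W (max b d) \<omega> - W ?e \<omega>))"
        "expectation (\<lambda>\<omega>. (\<xi> \<omega> * (\<zeta> \<omega> * (W ?e \<omega> - W c \<omega>))) * (W (max b d) \<omega> - W ?e \<omega>)) = 0"
      using sep[of c ?e "max b d"] ab ac inc by auto
    \<comment> \<open>Splitting both increments at \<open>c\<close> and at the end \<open>?e\<close>
      of the overlap leaves the square over the overlap and two products in which the last increment
      starts when all other factors are known; these have expectation 0.\<close>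
    have "(\<xi> \<omega> * (W b \<omega> - W a \<omega>)) * (\<zeta> \<omega> * (W d \<omega> - W c \<omega>)) =
        (\<xi> \<omega> * \<zeta> \<omega>) * (W ?e \<omega> - W c \<omega>)\<^sup>2 + (\<xi> \<omega> * (\<zeta> \<omega> * (W c \<omega> - W a \<omega>))) * (W d \<omega> - W c \<omega>) +
        (\<xi> \<omega> * (\<zeta> \<omega> * (W ?e \<omega> - W c \<omega>))) * (W (max b d) \<omega> - W ?e \<omega>)" for \<omega>
      by (cases "b \<le> d") (simp_all add: min_def max_def power2_eq_square algebra_simps)
    then show ?thesis using s1 s2 sq sqi inc ac by (simp add: max.absorb2)
  qed
qed

lemma expectation_block_mult:
  assumes 1: "block \<xi> a b" and 2: "block \<zeta> c d"
  shows "expectation (\<lambda>\<omega>. (\<xi> \<omega> * (W b \<omega> - W a \<omega>)) * (\<zeta> \<omega> * (W d \<omega> - W c \<omega>))) =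
    expectation (\<lambda>\<omega>. \<xi> \<omega> * \<zeta> \<omega>) * max 0 (min b d - max a c)"
proof (cases "a \<le> c")
  case False
  have "expectation (\<lambda>\<omega>. (\<xi> \<omega> * (W b \<omega> - W a \<omega>)) * (\<zeta> \<omega> * (W d \<omega> - W c \<omega>))) =
      expectation (\<lambda>\<omega>. (\<zeta> \<omega> * (W d \<omega> - W c \<omega>)) * (\<xi> \<omega> * (W b \<omega> - W a \<omega>)))"
    by (rule Bochner_Integration.integral_cong[OF refl]) (rule mult.commute)
  also have "\<dots> = expectation (\<lambda>\<omega>. \<zeta> \<omega> * \<xi> \<omega>) * max 0 (min d b - max c a)"
    using False by (intro expectation_block_mult_aux[OF 2 1]) simp
  also have "\<dots> = expectation (\<lambda>\<omega>. \<xi> \<omega> * \<zeta> \<omega>) * max 0 (min b d - max a c)"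
    by (simp only: mult.commute[of "\<zeta> _"] min.commute[of d] max.commute[of c])
  finally show ?thesis .
qed (rule expectation_block_mult_aux[OF assms])

text \<open>Both sides expand to the double sum of E[\<xi>_i \<xi>_j] times the length of the
  overlap of the intervals i and j. Since overlaps are allowed, the index set can merge two
  unrelated partitions.\<close>

lemma block_isometry:
  assumes I: "finite I" and bl: "\<And>i. i \<in> I \<Longrightarrow> block (\<xi> i) (a i) (b i)"
  shows "(\<integral>\<^sup>+\<omega>. ennreal ((\<Sum>i\<in>I. \<xi> i \<omega> * (W (b i) \<omega> - W (a i) \<omega>))\<^sup>2) \<partial>M) =
    (\<integral>\<^sup>+\<omega>. (\<integral>\<^sup>+u. ennreal ((\<Sum>i\<in>I. \<xi> i \<omega> * indicator {a i<..b i} u)\<^sup>2) \<partial>lborel) \<partial>M)"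
proof -
  let ?l = "\<lambda>i j. max 0 (min (b i) (b j) - max (a i) (a j))"
  have step: "has_bochner_integral lborel (\<lambda>u. (\<Sum>i\<in>I. \<xi> i \<omega> * indicator {a i<..b i} u)\<^sup>2)
        (\<Sum>i\<in>I. \<Sum>j\<in>I. \<xi> i \<omega> * \<xi> j \<omega> * ?l i j)" for \<omega>
  proof -
    have ind: "indicator {a i<..b i} u * indicator {a j<..b j} u = (indicator {max (a i) (a j)<..min (b i) (b j)} u :: real)" for i j u
      by (auto simp: indicator_def)
    have "has_bochner_integral lborel (\<lambda>u. \<Sum>i\<in>I. \<Sum>j\<in>I. \<xi> i \<omega> * \<xi> j \<omega> * indicator {max (a i) (a j)<..min (b i) (b j)} u)
        (\<Sum>i\<in>I. \<Sum>j\<in>I. \<xi> i \<omega> * \<xi> j \<omega> * ?l i j)"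
    proof (intro has_bochner_integral_sum has_bochner_integral_mult_right)
      fix i j
      show "has_bochner_integral lborel (\<lambda>u. indicator {max (a i) (a j)<..min (b i) (b j)} u :: real) (?l i j)"
      proof (cases "max (a i) (a j) \<le> min (b i) (b j)")
        case True
        then have "has_bochner_integral lborel (indicator {max (a i) (a j)<..min (b i) (b j)})
            (measure lborel {max (a i) (a j)<..min (b i) (b j)})"
          by (intro has_bochner_integral_real_indicator) auto
        then show ?thesis using True by simp
      next
        case False
        then have e: "{max (a i) (a j)<..min (b i) (b j)} = {}" "?l i j = 0" by auto
        show ?thesis unfolding e by (simp add: has_bochner_integral_zero)
      qed
    qed
    moreover have "(\<Sum>i\<in>I. \<Sum>j\<in>I. \<xi> i \<omega> * \<xi> j \<omega> * indicator {max (a i) (a j)<..min (b i) (b j)} u) =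
        (\<Sum>i\<in>I. \<xi> i \<omega> * indicator {a i<..b i} u)\<^sup>2" for u
      unfolding power2_eq_square sum_product ind[symmetric] by (simp add: mult_ac)
    ultimately show ?thesis by simp
  qed
  have inner: "(\<integral>\<^sup>+u. ennreal ((\<Sum>i\<in>I. \<xi> i \<omega> * indicator {a i<..b i} u)\<^sup>2) \<partial>lborel) =
      ennreal (\<Sum>i\<in>I. \<Sum>j\<in>I. \<xi> i \<omega> * \<xi> j \<omega> * ?l i j)" for \<omega>
    using step[of \<omega>] by (simp add: has_bochner_integral_iff nn_integral_eq_integral)
  have int_xi: "integrable M (\<lambda>\<omega>. \<xi> i \<omega> * \<xi> j \<omega>)" if i: "i \<in> I" and j: "j \<in> I" for i j
  proof -
    obtain C C' where C: "\<forall>\<omega>\<in>space M. \<bar>\<xi> i \<omega>\<bar> \<le> C" and C': "\<forall>\<omega>\<in>space M. \<bar>\<xi> j \<omega>\<bar> \<le> C'"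
      using bl[OF i] bl[OF j] by (auto simp: block_def)
    have "integrable M (\<lambda>\<omega>. \<xi> i \<omega> * (\<xi> j \<omega> * 1))"
      using i j by (intro integrable_bounded_mult[OF _ C] integrable_bounded_mult[OF _ C'] block_measurable[OF bl]) auto
    then show ?thesis by simp
  qed
  have int_W: "integrable M (\<lambda>\<omega>. (\<xi> i \<omega> * (W (b i) \<omega> - W (a i) \<omega>)) * (\<xi> j \<omega> * (W (b j) \<omega> - W (a j) \<omega>)))"
    if "i \<in> I" "j \<in> I" for i j
    using block_incr[OF bl] that by (intro integrable_mult_squares) auto
  have sq: "(\<Sum>i\<in>I. \<xi> i \<omega> * (W (b i) \<omega> - W (a i) \<omega>))\<^sup>2 =
      (\<Sum>i\<in>I. \<Sum>j\<in>I. (\<xi> i \<omega> * (W (b i) \<omega> - W (a i) \<omega>)) * (\<xi> j \<omega> * (W (b j) \<omega> - W (a j) \<omega>)))" for \<omega>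
    by (simp only: power2_eq_square sum_product)
  have "(\<integral>\<^sup>+\<omega>. ennreal ((\<Sum>i\<in>I. \<xi> i \<omega> * (W (b i) \<omega> - W (a i) \<omega>))\<^sup>2) \<partial>M) =
      ennreal (expectation (\<lambda>\<omega>. (\<Sum>i\<in>I. \<xi> i \<omega> * (W (b i) \<omega> - W (a i) \<omega>))\<^sup>2))"
  proof (rule nn_integral_eq_integral)
    show "integrable M (\<lambda>\<omega>. (\<Sum>i\<in>I. \<xi> i \<omega> * (W (b i) \<omega> - W (a i) \<omega>))\<^sup>2)"
      unfolding sq by (intro Bochner_Integration.integrable_sum int_W)
  qed simp
  also have "expectation (\<lambda>\<omega>. (\<Sum>i\<in>I. \<xi> i \<omega> * (W (b i) \<omega> - W (a i) \<omega>))\<^sup>2) =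
      (\<Sum>i\<in>I. \<Sum>j\<in>I. expectation (\<lambda>\<omega>. \<xi> i \<omega> * \<xi> j \<omega>) * ?l i j)"
    unfolding sq using int_W expectation_block_mult[OF bl bl] by simp
  also have "\<dots> = expectation (\<lambda>\<omega>. \<Sum>i\<in>I. \<Sum>j\<in>I. \<xi> i \<omega> * \<xi> j \<omega> * ?l i j)"
    using int_xi by simp
  also have "ennreal \<dots> = (\<integral>\<^sup>+\<omega>. ennreal (\<Sum>i\<in>I. \<Sum>j\<in>I. \<xi> i \<omega> * \<xi> j \<omega> * ?l i j) \<partial>M)"
  proof (rule nn_integral_eq_integral[symmetric])
    show "integrable M (\<lambda>\<omega>. \<Sum>i\<in>I. \<Sum>j\<in>I. \<xi> i \<omega> * \<xi> j \<omega> * ?l i j)" using int_xi by simp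
    \<comment> \<open>The quadratic form is nonnegative because it is the integral of a square over
      \<open>u\<close>.\<close>
    have "0 \<le> (\<Sum>i\<in>I. \<Sum>j\<in>I. \<xi> i \<omega> * \<xi> j \<omega> * ?l i j)" for \<omega>
      unfolding has_bochner_integral_integral_eq[OF step, symmetric]
      by (intro Bochner_Integration.integral_nonneg) auto
    then show "AE \<omega> in M. 0 \<le> (\<Sum>i\<in>I. \<Sum>j\<in>I. \<xi> i \<omega> * \<xi> j \<omega> * ?l i j)" by simp
  qed
  finally show ?thesis unfolding inner .
qed

section \<open>Simple integrals as sums of blocks\<close>

lemma simple_integrand_nonneg:
  assumes "simple_integrand M F n \<tau> \<xi>" "i \<le> n"
  shows "0 \<le> \<tau> i"
  using assms(2)
proof (induction i)
  case (Suc i)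
  then have "0 \<le> \<tau> i" "\<tau> i < \<tau> (Suc i)" using assms(1) by (auto simp: simple_integrand_def)
  then show ?case by simp
qed (use assms(1) in \<open>simp add: simple_integrand_def\<close>)

lemma simple_integrand_block:
  assumes "simple_integrand M F n \<tau> \<xi>" "i < n" "\<tau> i < t"
  shows "block (\<xi> i) (\<tau> i) (min t (\<tau> (Suc i)))"
  using assms simple_integrand_nonneg[OF assms(1), of i] by (auto simp: simple_integrand_def block_def less_imp_le)

text \<open>Blocks beginning at or after \<open>t\<close> contribute nothing; they are dropped
  because for them \<open>min t (\<tau> (Suc i))\<close> can precede \<open>\<tau> i\<close>, which
  \<open>block\<close> forbids.\<close>

lemma simple_integral_eq:
  assumes "simple_integrand M F n \<tau> \<xi>"
  shows "simple_integral W n \<tau> \<xi> t \<omega> = (\<Sum>i | i < n \<and> \<tau> i < t. \<xi> i \<omega> * (W (min t (\<tau> (Suc i))) \<omega> - W (\<tau> i) \<omega>))"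
proof -
  have "simple_integral W n \<tau> \<xi> t \<omega> = (\<Sum>i | i < n \<and> \<tau> i < t. \<xi> i \<omega> * (W (min t (\<tau> (Suc i))) \<omega> - W (min t (\<tau> i)) \<omega>))"
    unfolding simple_integral_def
  proof (rule sum.mono_neutral_right)
    show "\<forall>i\<in>{..<n} - {i. i < n \<and> \<tau> i < t}. \<xi> i \<omega> * (W (min t (\<tau> (Suc i))) \<omega> - W (min t (\<tau> i)) \<omega>) = 0"
    proof
      fix i assume "i \<in> {..<n} - {i. i < n \<and> \<tau> i < t}"
      then have "t \<le> \<tau> i" "\<tau> i \<le> \<tau> (Suc i)" using assms by (auto simp: simple_integrand_def less_imp_le)
      then have "min t (\<tau> (Suc i)) = min t (\<tau> i)" by simp
      then show "\<xi> i \<omega> * (W (min t (\<tau> (Suc i))) \<omega> - W (min t (\<tau> i)) \<omega>) = 0" by simp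
    qed
  qed auto
  also have "\<dots> = (\<Sum>i | i < n \<and> \<tau> i < t. \<xi> i \<omega> * (W (min t (\<tau> (Suc i))) \<omega> - W (\<tau> i) \<omega>))"
    by (intro sum.cong) auto
  finally show ?thesis .
qed

lemma simple_process_eq:
  assumes "simple_integrand M F n \<tau> \<xi>"
  shows "indicator {0..t} u * simple_process n \<tau> \<xi> u \<omega> =
    (\<Sum>i | i < n \<and> \<tau> i < t. \<xi> i \<omega> * indicator {\<tau> i<..min t (\<tau> (Suc i))} u)"
proof -
  have "indicator {0..t} u * simple_process n \<tau> \<xi> u \<omega> = (\<Sum>i<n. \<xi> i \<omega> * indicator {\<tau> i<..min t (\<tau> (Suc i))} u)"
    unfolding simple_process_def sum_distrib_left
  proof (rule sum.cong[OF refl])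
    fix i assume "i \<in> {..<n}"
    then have "0 \<le> \<tau> i" using simple_integrand_nonneg[OF assms, of i] by simp
    then show "indicator {0..t} u * (\<xi> i \<omega> * indicator {\<tau> i<..\<tau> (Suc i)} u) = \<xi> i \<omega> * indicator {\<tau> i<..min t (\<tau> (Suc i))} u"
      by (auto simp: indicator_def)
  qed
  also have "\<dots> = (\<Sum>i | i < n \<and> \<tau> i < t. \<xi> i \<omega> * indicator {\<tau> i<..min t (\<tau> (Suc i))} u)"
    by (rule sum.mono_neutral_right) (auto simp: indicator_def)
  finally show ?thesis .
qed

lemma simple_integral_square:
  assumes "simple_integrand M F n \<tau> \<xi>"
  shows "simple_integral W n \<tau> \<xi> t \<in> borel_measurable M"
    and "integrable M (\<lambda>\<omega>. (simple_integral W n \<tau> \<xi> t \<omega>)\<^sup>2)"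
proof -
  note bl = block_incr[OF simple_integrand_block[OF assms]]
  show "simple_integral W n \<tau> \<xi> t \<in> borel_measurable M"
    unfolding simple_integral_eq[OF assms, abs_def] using bl(1) by (intro borel_measurable_sum) auto
  show "integrable M (\<lambda>\<omega>. (simple_integral W n \<tau> \<xi> t \<omega>)\<^sup>2)"
    unfolding simple_integral_eq[OF assms] power2_eq_square sum_product
    by (intro Bochner_Integration.integrable_sum integrable_mult_squares bl) simp_all
qed

text \<open>The difference is a single family of blocks indexed by the disjoint sum
  \<open>?A <+> ?B\<close>, with the weights of the second group negated, so
  \<open>block_isometry\<close> applies directly.\<close>

lemma simple_integral_diff_isometry:
  assumes 1: "simple_integrand M F n \<tau> \<xi>" and 2: "simple_integrand M F n' \<tau>' \<xi>'"
  shows "(\<integral>\<^sup>+\<omega>. ennreal ((simple_integral W n \<tau> \<xi> t \<omega> - simple_integral W n' \<tau>' \<xi>' t \<omega>)\<^sup>2) \<partial>M) =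
    (\<integral>\<^sup>+\<omega>. (\<integral>\<^sup>+u\<in>{0..t}. ennreal ((simple_process n \<tau> \<xi> u \<omega> - simple_process n' \<tau>' \<xi>' u \<omega>)\<^sup>2) \<partial>lborel) \<partial>M)"
proof -
  let ?A = "{i. i < n \<and> \<tau> i < t}" and ?B = "{i. i < n' \<and> \<tau>' i < t}"
  let ?\<xi> = "case_sum \<xi> (\<lambda>i \<omega>. - \<xi>' i \<omega>)" and ?a = "case_sum \<tau> \<tau>'"
    and ?b = "case_sum (\<lambda>i. min t (\<tau> (Suc i))) (\<lambda>i. min t (\<tau>' (Suc i)))"
  have bl: "block (?\<xi> i) (?a i) (?b i)" if "i \<in> ?A <+> ?B" for i
  proof -
    have "block (\<lambda>\<omega>. - \<xi>' j \<omega>) (\<tau>' j) (min t (\<tau>' (Suc j)))" if "j \<in> ?B" for j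
    proof -
      have "block (\<xi>' j) (\<tau>' j) (min t (\<tau>' (Suc j)))" using that by (intro simple_integrand_block[OF 2]) auto
      then show ?thesis by (simp add: block_def)
    qed
    moreover have "block (\<xi> j) (\<tau> j) (min t (\<tau> (Suc j)))" if "j \<in> ?A" for j
      using that by (intro simple_integrand_block[OF 1]) auto
    ultimately show ?thesis using that by (elim PlusE) simp_all
  qed
  have "(\<Sum>i\<in>?A <+> ?B. ?\<xi> i \<omega> * (W (?b i) \<omega> - W (?a i) \<omega>)) =
      simple_integral W n \<tau> \<xi> t \<omega> - simple_integral W n' \<tau>' \<xi>' t \<omega>" for \<omega>
    unfolding simple_integral_eq[OF 1] simple_integral_eq[OF 2] by (subst sum.Plus) (auto simp: sum_negf)
  moreover have "ennreal ((\<Sum>i\<in>?A <+> ?B. ?\<xi> i \<omega> * indicator {?a i<..?b i} u)\<^sup>2) =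
      ennreal ((simple_process n \<tau> \<xi> u \<omega> - simple_process n' \<tau>' \<xi>' u \<omega>)\<^sup>2) * indicator {0..t} u" for u \<omega>
  proof -
    have "(\<Sum>i\<in>?A <+> ?B. ?\<xi> i \<omega> * indicator {?a i<..?b i} u) =
       indicator {0..t} u * simple_process n \<tau> \<xi> u \<omega> - indicator {0..t} u * simple_process n' \<tau>' \<xi>' u \<omega>"
      unfolding simple_process_eq[OF 1] simple_process_eq[OF 2] by (subst sum.Plus) (auto simp: sum_negf)
    then show ?thesis by (simp split: split_indicator)
  qed
  ultimately show ?thesis
    using block_isometry[of "?A <+> ?B" ?\<xi> ?a ?b, OF _ bl] by simp
qed

text \<open>The martingale property for simple integrals. Clamping the partition to [s, t] turns the
  difference into increments after time \<open>s\<close>, and the weight \<xi>_i Y is known when its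
  increment starts. \<open>Y\<close> may be unbounded, so these weights are merely
  integrable.\<close>

lemma expectation_mult_simple_integral_diff:
  assumes si: "simple_integrand M F n \<tau> \<xi>" and st: "0 \<le> s" "s \<le> t"
    and Y: "Y \<in> borel_measurable (F s)" "integrable M (\<lambda>\<omega>. (Y \<omega>)\<^sup>2)"
  shows "expectation (\<lambda>\<omega>. Y \<omega> * (simple_integral W n \<tau> \<xi> t \<omega> - simple_integral W n \<tau> \<xi> s \<omega>)) = 0"
proof -
  let ?a = "\<lambda>i. max s (min t (\<tau> i))"
  let ?g = "\<lambda>i \<omega>. (\<xi> i \<omega> * Y \<omega>) * (W (?a (Suc i)) \<omega> - W (?a i) \<omega>)"
  have Yi: "integrable M Y" by (rule integrable_of_square[OF measurable_F_M[OF Y(1) st(1)] Y(2)])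
  have "Y \<omega> * (simple_integral W n \<tau> \<xi> t \<omega> - simple_integral W n \<tau> \<xi> s \<omega>) = (\<Sum>i<n. ?g i \<omega>)" for \<omega>
  proof -
    have w: "W (min t x) \<omega> - W (min s x) \<omega> = W (max s (min t x)) \<omega> - W s \<omega>" for x
    proof (cases "x \<le> s")
      case True
      then have "min t x = x" "min s x = x" "max s x = s" using st by auto
      then show ?thesis by simp
    next
      case False
      then have "min s x = s" "max s (min t x) = min t x" using st by auto
      then show ?thesis by simp
    qed
    have "\<xi> i \<omega> * (W (min t (\<tau> (Suc i))) \<omega> - W (min t (\<tau> i)) \<omega>) - \<xi> i \<omega> * (W (min s (\<tau> (Suc i))) \<omega> - W (min s (\<tau> i)) \<omega>) =
        \<xi> i \<omega> * (W (?a (Suc i)) \<omega> - W (?a i) \<omega>)" for i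
    proof -
      have "W (min t (\<tau> (Suc i))) \<omega> - W (min t (\<tau> i)) \<omega> - (W (min s (\<tau> (Suc i))) \<omega> - W (min s (\<tau> i)) \<omega>) = W (?a (Suc i)) \<omega> - W (?a i) \<omega>"
        using w[of "\<tau> (Suc i)"] w[of "\<tau> i"] by linarith
      then show ?thesis by (simp only: right_diff_distrib[symmetric])
    qed
    then show ?thesis
      by (simp add: simple_integral_def sum_subtractf[symmetric] sum_distrib_left mult_ac)
  qed
  moreover have "integrable M (?g i) \<and> expectation (?g i) = 0" if i: "i < n" for i
  proof (cases "\<tau> i < t")
    case True
    have b: "block (\<xi> i) (\<tau> i) (min t (\<tau> (Suc i)))" by (rule simple_integrand_block[OF si i True])
    obtain C where C: "\<forall>\<omega>\<in>space M. \<bar>\<xi> i \<omega>\<bar> \<le> C" using b by (auto simp: block_def)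
    have a: "0 \<le> ?a i" "?a i \<le> ?a (Suc i)" using si st i by (auto simp: simple_integrand_def less_imp_le intro!: max.mono min.mono)
    have ai: "\<tau> i \<le> ?a i" "s \<le> ?a i" using True by auto
    have m: "(\<lambda>\<omega>. \<xi> i \<omega> * Y \<omega>) \<in> borel_measurable (F (?a i))"
      using b by (intro borel_measurable_times measurable_F_mono[OF Y(1) ai(2)] measurable_F_mono[OF _ ai(1)]) (simp add: block_def)
    have "integrable M (\<lambda>\<omega>. \<xi> i \<omega> * Y \<omega>)"
      by (rule integrable_bounded_mult[OF block_measurable[OF b] C Yi])
    then show ?thesis using integrable_mult_incr[OF a m] expectation_mult_incr[OF a m] by blast
  next
    case False
    moreover have "\<tau> i < \<tau> (Suc i)" using si i by (simp add: simple_integrand_def)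
    ultimately have "?a (Suc i) = ?a i" by auto
    then show ?thesis by simp
  qed
  ultimately show ?thesis by simp
qed

lemma borel_measurable_simple_process:
  assumes "simple_integrand M F n \<tau> \<xi>"
  shows "(\<lambda>(u, \<omega>). simple_process n \<tau> \<xi> u \<omega>) \<in> borel_measurable (lborel \<Otimes>\<^sub>M M)"
proof -
  have [measurable]: "\<xi> i \<in> borel_measurable M" if "i < n" for i
    using assms that simple_integrand_nonneg[OF assms, of i] by (intro measurable_F_M[of _ "\<tau> i"]) (auto simp: simple_integrand_def)
  have "(\<lambda>x. \<xi> i (snd x) * indicator {\<tau> i<..\<tau> (Suc i)} (fst x)) \<in> borel_measurable (borel \<Otimes>\<^sub>M M)" if [simp]: "i < n" for i
    by measurable
  then have "(\<lambda>x. simple_process n \<tau> \<xi> (fst x) (snd x)) \<in> borel_measurable (borel \<Otimes>\<^sub>M M)"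
    unfolding simple_process_def by (intro borel_measurable_sum) simp
  then show ?thesis
    using measurable_cong_sets[OF sets_pair_measure_cong[OF sets_lborel refl] refl] by (simp add: case_prod_beta')
qed

section \<open>From simple integrals to the Ito integral\<close>

lemma nn_square_diff_le:
  fixes f g h :: "real \<times> 'a \<Rightarrow> real"
  assumes [measurable]: "f \<in> borel_measurable (lborel \<Otimes>\<^sub>M M)" "g \<in> borel_measurable (lborel \<Otimes>\<^sub>M M)"
    "h \<in> borel_measurable (lborel \<Otimes>\<^sub>M M)" and A[measurable]: "A \<in> sets borel"
  shows "(\<integral>\<^sup>+\<omega>. (\<integral>\<^sup>+u\<in>A. ennreal ((g (u, \<omega>) - h (u, \<omega>))\<^sup>2) \<partial>lborel) \<partial>M) \<le>
    2 * (\<integral>\<^sup>+\<omega>. (\<integral>\<^sup>+u\<in>A. ennreal ((f (u, \<omega>) - g (u, \<omega>))\<^sup>2) \<partial>lborel) \<partial>M) +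
    2 * (\<integral>\<^sup>+\<omega>. (\<integral>\<^sup>+u\<in>A. ennreal ((f (u, \<omega>) - h (u, \<omega>))\<^sup>2) \<partial>lborel) \<partial>M)"
proof -
  have le: "(x - y)\<^sup>2 \<le> 2 * (z - x)\<^sup>2 + 2 * (z - y)\<^sup>2" for x y z :: real
    using zero_le_power2[of "2 * z - x - y"] by (simp add: power2_eq_square algebra_simps)
  have "ennreal ((x - y)\<^sup>2) \<le> 2 * ennreal ((z - x)\<^sup>2) + 2 * ennreal ((z - y)\<^sup>2)" for x y z :: real
    using le by (auto simp: ennreal_plus[symmetric] ennreal_mult'[symmetric] ennreal_leI simp flip: ennreal_numeral simp del: ennreal_plus)
  then have "(\<integral>\<^sup>+\<omega>. (\<integral>\<^sup>+u\<in>A. ennreal ((g (u, \<omega>) - h (u, \<omega>))\<^sup>2) \<partial>lborel) \<partial>M) \<le>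
      (\<integral>\<^sup>+\<omega>. (\<integral>\<^sup>+u. 2 * (ennreal ((f (u, \<omega>) - g (u, \<omega>))\<^sup>2) * indicator A u) + 2 * (ennreal ((f (u, \<omega>) - h (u, \<omega>))\<^sup>2) * indicator A u) \<partial>lborel) \<partial>M)"
    by (intro nn_integral_mono) (auto simp: indicator_def)
  also have "\<dots> = 2 * (\<integral>\<^sup>+\<omega>. (\<integral>\<^sup>+u\<in>A. ennreal ((f (u, \<omega>) - g (u, \<omega>))\<^sup>2) \<partial>lborel) \<partial>M) +
      2 * (\<integral>\<^sup>+\<omega>. (\<integral>\<^sup>+u\<in>A. ennreal ((f (u, \<omega>) - h (u, \<omega>))\<^sup>2) \<partial>lborel) \<partial>M)"
  proof -
    have inner: "(\<integral>\<^sup>+u. 2 * (ennreal ((f (u, \<omega>) - g (u, \<omega>))\<^sup>2) * indicator A u) + 2 * (ennreal ((f (u, \<omega>) - h (u, \<omega>))\<^sup>2) * indicator A u) \<partial>lborel) =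
        2 * (\<integral>\<^sup>+u\<in>A. ennreal ((f (u, \<omega>) - g (u, \<omega>))\<^sup>2) \<partial>lborel) + 2 * (\<integral>\<^sup>+u\<in>A. ennreal ((f (u, \<omega>) - h (u, \<omega>))\<^sup>2) \<partial>lborel)"
      if [measurable]: "\<omega> \<in> space M" for \<omega>
      by (simp add: nn_integral_add nn_integral_cmult)
    show ?thesis
      by (subst nn_integral_cong[OF inner]) (simp_all add: nn_integral_add nn_integral_cmult)
  qed
  finally show ?thesis .
qed

text \<open>Young's inequality with a free parameter \<open>e\<close>, in place of Cauchy-Schwarz:
  when the second moment of \<open>Z\<close> tends to 0, only a multiple of the arbitrary
  \<open>e\<close> is left.\<close>

lemma abs_expectation_mult_le:
  fixes e :: real
  assumes [measurable]: "Y \<in> borel_measurable M" "Z \<in> borel_measurable M"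
    and Y: "integrable M (\<lambda>\<omega>. (Y \<omega>)\<^sup>2)" and Z: "integrable M (\<lambda>\<omega>. (Z \<omega>)\<^sup>2)" and e: "e > 0"
  shows "\<bar>expectation (\<lambda>\<omega>. Y \<omega> * Z \<omega>)\<bar> \<le> e * expectation (\<lambda>\<omega>. (Y \<omega>)\<^sup>2) + expectation (\<lambda>\<omega>. (Z \<omega>)\<^sup>2) / e"
proof -
  have "\<bar>Y \<omega> * Z \<omega>\<bar> \<le> e * (Y \<omega>)\<^sup>2 + (Z \<omega>)\<^sup>2 / e" for \<omega>
    using abs_mult_le_sum_squares[of "sqrt e * Y \<omega>" "Z \<omega> / sqrt e"] e by (simp add: power_mult_distrib power_divide)
  then have "expectation (\<lambda>\<omega>. \<bar>Y \<omega> * Z \<omega>\<bar>) \<le> expectation (\<lambda>\<omega>. e * (Y \<omega>)\<^sup>2 + (Z \<omega>)\<^sup>2 / e)"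
    using Y Z by (intro integral_mono integrable_abs integrable_mult_squares) auto
  also have "\<dots> = e * expectation (\<lambda>\<omega>. (Y \<omega>)\<^sup>2) + expectation (\<lambda>\<omega>. (Z \<omega>)\<^sup>2) / e" using Y Z by simp
  finally show ?thesis by (rule order_trans[OF integral_abs_bound])
qed

lemma tendsto_zero_ennreal_squeeze:
  fixes f g :: "nat \<Rightarrow> ennreal"
  assumes "\<And>k. f k \<le> g k" "g \<longlonglongrightarrow> 0"
  shows "f \<longlonglongrightarrow> 0"
  using assms by (intro tendsto_sandwich[OF _ _ tendsto_const assms(2)]) auto

text \<open>The integrals over \<open>[0, s]\<close> and \<open>[0, t]\<close> come with unrelated approximating sequences; the
  isometry shows that the one for \<open>[0, t]\<close> also approximates the integral over \<open>[0, s]\<close>.\<close>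

lemma ito_integral_orthogonal:
  assumes H: "(\<lambda>(u, \<omega>). H u \<omega>) \<in> borel_measurable (lborel \<Otimes>\<^sub>M M)"
    and Is: "ito_integral M F W H s Is" and It: "ito_integral M F W H t It" and st: "0 \<le> s" "s \<le> t"
    and Y: "Y \<in> borel_measurable (F s)" "integrable M (\<lambda>\<omega>. (Y \<omega>)\<^sup>2)"
  shows "integrable M (\<lambda>\<omega>. (It \<omega> - Is \<omega>)\<^sup>2)" and "expectation (\<lambda>\<omega>. Y \<omega> * (It \<omega> - Is \<omega>)) = 0"
proof -
  note YM[measurable] = measurable_F_M[OF Y(1) st(1)]
  from It obtain n \<tau> \<xi> where It_m[measurable]: "It \<in> borel_measurable M" and si: "\<And>k::nat. simple_integrand M F (n k) (\<tau> k) (\<xi> k)"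
    and app: "(\<lambda>k. \<integral>\<^sup>+\<omega>. (\<integral>\<^sup>+u\<in>{0..t}. ennreal ((H u \<omega> - simple_process (n k) (\<tau> k) (\<xi> k) u \<omega>)\<^sup>2) \<partial>lborel) \<partial>M) \<longlonglongrightarrow> 0"
    and It_lim: "(\<lambda>k. \<integral>\<^sup>+\<omega>. ennreal ((It \<omega> - simple_integral W (n k) (\<tau> k) (\<xi> k) t \<omega>)\<^sup>2) \<partial>M) \<longlonglongrightarrow> 0"
    unfolding ito_integral_def by blast
  from Is obtain n' \<tau>' \<xi>' where Is_m[measurable]: "Is \<in> borel_measurable M" and si': "\<And>k::nat. simple_integrand M F (n' k) (\<tau>' k) (\<xi>' k)"
    and app': "(\<lambda>k. \<integral>\<^sup>+\<omega>. (\<integral>\<^sup>+u\<in>{0..s}. ennreal ((H u \<omega> - simple_process (n' k) (\<tau>' k) (\<xi>' k) u \<omega>)\<^sup>2) \<partial>lborel) \<partial>M) \<longlonglongrightarrow> 0"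
    and Is_lim: "(\<lambda>k. \<integral>\<^sup>+\<omega>. ennreal ((Is \<omega> - simple_integral W (n' k) (\<tau>' k) (\<xi>' k) s \<omega>)\<^sup>2) \<partial>M) \<longlonglongrightarrow> 0"
    unfolding ito_integral_def by blast
  define S where "S k = simple_integral W (n k) (\<tau> k) (\<xi> k) t" for k
  define R where "R k = simple_integral W (n k) (\<tau> k) (\<xi> k) s" for k
  define R' where "R' k = simple_integral W (n' k) (\<tau>' k) (\<xi>' k) s" for k
  have [measurable]: "S k \<in> borel_measurable M" "R k \<in> borel_measurable M" "R' k \<in> borel_measurable M" for k
    unfolding S_def R_def R'_def by (rule simple_integral_square(1)[OF si] simple_integral_square(1)[OF si'])+
  have S2: "integrable M (\<lambda>\<omega>. (S k \<omega>)\<^sup>2)" and R2: "integrable M (\<lambda>\<omega>. (R k \<omega>)\<^sup>2)" for k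
    unfolding S_def R_def by (rule simple_integral_square(2)[OF si])+
  \<comment> \<open>The error of the k-th approximation to \<open>It - Is\<close>. It equals
    \<open>(It - S k) + (R k - R' k) - (Is - R' k)\<close>, and each part tends to 0 in mean
    square.\<close>
  define A where "A k \<omega> = (It \<omega> - Is \<omega>) - (S k \<omega> - R k \<omega>)" for k \<omega>
  have Am[measurable]: "A k \<in> borel_measurable M" for k unfolding A_def by measurable
  have RR': "(\<lambda>k. \<integral>\<^sup>+\<omega>. ennreal ((R k \<omega> - R' k \<omega>)\<^sup>2) \<partial>M) \<longlonglongrightarrow> 0"
  proof -
    let ?p = "\<lambda>k. \<integral>\<^sup>+\<omega>. (\<integral>\<^sup>+u\<in>{0..t}. ennreal ((H u \<omega> - simple_process (n k) (\<tau> k) (\<xi> k) u \<omega>)\<^sup>2) \<partial>lborel) \<partial>M"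
    let ?q = "\<lambda>k. \<integral>\<^sup>+\<omega>. (\<integral>\<^sup>+u\<in>{0..s}. ennreal ((H u \<omega> - simple_process (n' k) (\<tau>' k) (\<xi>' k) u \<omega>)\<^sup>2) \<partial>lborel) \<partial>M"
    have "(\<integral>\<^sup>+\<omega>. ennreal ((R k \<omega> - R' k \<omega>)\<^sup>2) \<partial>M) \<le> 2 * ?p k + 2 * ?q k" for k
    proof -
      have "(\<integral>\<^sup>+\<omega>. ennreal ((R k \<omega> - R' k \<omega>)\<^sup>2) \<partial>M) \<le>
        2 * (\<integral>\<^sup>+\<omega>. (\<integral>\<^sup>+u\<in>{0..s}. ennreal ((H u \<omega> - simple_process (n k) (\<tau> k) (\<xi> k) u \<omega>)\<^sup>2) \<partial>lborel) \<partial>M) + 2 * ?q k"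
        unfolding R_def R'_def simple_integral_diff_isometry[OF si si']
        using nn_square_diff_le[OF H borel_measurable_simple_process[OF si] borel_measurable_simple_process[OF si'], of "{0..s}"] by simp
      also have "\<dots> \<le> 2 * ?p k + 2 * ?q k"
        using st by (intro add_right_mono mult_left_mono nn_integral_mono) (auto simp: indicator_def)
      finally show ?thesis .
    qed
    moreover have "(\<lambda>k. 2 * ?p k + 2 * ?q k) \<longlonglongrightarrow> 2 * 0 + 2 * 0"
      by (intro tendsto_add ennreal_tendsto_cmult app app') auto
    then have "(\<lambda>k. 2 * ?p k + 2 * ?q k) \<longlonglongrightarrow> 0" by (simp only: mult_zero_right add_0)
    ultimately show ?thesis
      by (rule tendsto_zero_ennreal_squeeze)
  qed
  have A_lim: "(\<lambda>k. \<integral>\<^sup>+\<omega>. ennreal ((A k \<omega>)\<^sup>2) \<partial>M) \<longlonglongrightarrow> 0"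
  proof -
    let ?u = "\<lambda>k. 3 * (\<integral>\<^sup>+\<omega>. ennreal ((It \<omega> - S k \<omega>)\<^sup>2) \<partial>M) + 3 * (\<integral>\<^sup>+\<omega>. ennreal ((R k \<omega> - R' k \<omega>)\<^sup>2) \<partial>M) + 3 * (\<integral>\<^sup>+\<omega>. ennreal ((Is \<omega> - R' k \<omega>)\<^sup>2) \<partial>M)"
    have le: "(x + y - z)\<^sup>2 \<le> 3 * x\<^sup>2 + 3 * y\<^sup>2 + 3 * z\<^sup>2" for x y z :: real
      using zero_le_power2[of "x - y"] zero_le_power2[of "x + z"] zero_le_power2[of "y + z"] by (simp add: power2_eq_square algebra_simps)
    have "(\<integral>\<^sup>+\<omega>. ennreal ((A k \<omega>)\<^sup>2) \<partial>M) \<le> ?u k" for k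
    proof -
      have "(A k \<omega>)\<^sup>2 \<le> 3 * (It \<omega> - S k \<omega>)\<^sup>2 + 3 * (R k \<omega> - R' k \<omega>)\<^sup>2 + 3 * (Is \<omega> - R' k \<omega>)\<^sup>2" for \<omega>
      proof -
        have "A k \<omega> = (It \<omega> - S k \<omega>) + (R k \<omega> - R' k \<omega>) - (Is \<omega> - R' k \<omega>)" by (simp add: A_def)
        then show ?thesis using le by (simp only:)
      qed
      then have "ennreal ((A k \<omega>)\<^sup>2) \<le> 3 * ennreal ((It \<omega> - S k \<omega>)\<^sup>2) + 3 * ennreal ((R k \<omega> - R' k \<omega>)\<^sup>2) + 3 * ennreal ((Is \<omega> - R' k \<omega>)\<^sup>2)" for \<omega>
        by (rule order_trans[OF ennreal_leI eq_refl]) (simp add: ennreal_mult'')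
      then have "(\<integral>\<^sup>+\<omega>. ennreal ((A k \<omega>)\<^sup>2) \<partial>M) \<le>
          (\<integral>\<^sup>+\<omega>. 3 * ennreal ((It \<omega> - S k \<omega>)\<^sup>2) + 3 * ennreal ((R k \<omega> - R' k \<omega>)\<^sup>2) + 3 * ennreal ((Is \<omega> - R' k \<omega>)\<^sup>2) \<partial>M)"
        by (intro nn_integral_mono)
      also have "\<dots> = ?u k" by (simp add: nn_integral_add nn_integral_cmult)
      finally show ?thesis .
    qed
    moreover have "?u \<longlonglongrightarrow> 3 * 0 + 3 * 0 + 3 * 0"
      by (intro tendsto_add ennreal_tendsto_cmult It_lim[folded S_def] Is_lim[folded R'_def] RR') auto
    then have "?u \<longlonglongrightarrow> 0" by (simp only: mult_zero_right add_0)
    ultimately show ?thesis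
      by (rule tendsto_zero_ennreal_squeeze)
  qed
  \<comment> \<open>Neither Ito integral is assumed square integrable. A finite second moment of the
    error for one large \<open>k\<close>, together with that of \<open>S k - R k\<close>, yields it
    for \<open>It - Is\<close>.\<close>
  have A2: "\<forall>\<^sub>F k in sequentially. integrable M (\<lambda>\<omega>. (A k \<omega>)\<^sup>2)"
    using order_tendstoD(2)[OF A_lim, of 1]
  proof (rule eventually_mono)
    fix k assume *: "(\<integral>\<^sup>+\<omega>. ennreal ((A k \<omega>)\<^sup>2) \<partial>M) < 1"
    show "integrable M (\<lambda>\<omega>. (A k \<omega>)\<^sup>2)"
      using less_trans[OF * ennreal_one_less_top] by (intro integrableI_bounded) simp_all
  qed simp_all
  obtain k0 where k0: "integrable M (\<lambda>\<omega>. (A k0 \<omega>)\<^sup>2)"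
    using eventually_happens'[OF sequentially_bot A2] by blast
  have "integrable M (\<lambda>\<omega>. (A k0 \<omega> + (S k0 \<omega> - R k0 \<omega>))\<^sup>2)"
    by (rule integrable_square_diff(2)[OF _ _ k0 integrable_square_diff(1)[OF _ _ S2 R2]]) measurable
  then show I2: "integrable M (\<lambda>\<omega>. (It \<omega> - Is \<omega>)\<^sup>2)" by (simp add: A_def)
  \<comment> \<open>The simple integrals are exactly orthogonal to \<open>Y\<close> for every
    \<open>k\<close>, so only the error contributes.\<close>
  have eq: "expectation (\<lambda>\<omega>. Y \<omega> * (It \<omega> - Is \<omega>)) = expectation (\<lambda>\<omega>. Y \<omega> * A k \<omega>)" for k
  proof -
    have i: "integrable M (\<lambda>\<omega>. Y \<omega> * (It \<omega> - Is \<omega>))" "integrable M (\<lambda>\<omega>. Y \<omega> * (S k \<omega> - R k \<omega>))"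
      by (rule integrable_mult_squares[OF _ _ Y(2)], simp_all add: I2 integrable_square_diff(1)[OF _ _ S2 R2])+
    have "Y \<omega> * A k \<omega> = Y \<omega> * (It \<omega> - Is \<omega>) - Y \<omega> * (S k \<omega> - R k \<omega>)" for \<omega>
      unfolding A_def by (rule right_diff_distrib)
    then show ?thesis
      using i expectation_mult_simple_integral_diff[OF si st Y, of k] by (simp add: S_def R_def)
  qed
  let ?y = "expectation (\<lambda>\<omega>. (Y \<omega>)\<^sup>2)" and ?x = "\<bar>expectation (\<lambda>\<omega>. Y \<omega> * (It \<omega> - Is \<omega>))\<bar>"
  have lim_real: "(\<lambda>k. expectation (\<lambda>\<omega>. (A k \<omega>)\<^sup>2)) \<longlonglongrightarrow> 0"
  proof -
    have "(\<lambda>k. enn2real (\<integral>\<^sup>+\<omega>. ennreal ((A k \<omega>)\<^sup>2) \<partial>M)) \<longlonglongrightarrow> enn2real 0"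
      using A_lim by (intro tendsto_enn2real) auto
    then show ?thesis by (simp add: integral_eq_nn_integral)
  qed
  have bound: "?x \<le> e * ?y" if e: "e > 0" for e
  proof -
    have "(\<lambda>k. e * ?y + expectation (\<lambda>\<omega>. (A k \<omega>)\<^sup>2) / e) \<longlonglongrightarrow> e * ?y + 0 / e"
      using lim_real e by (intro tendsto_intros) auto
    moreover have "\<forall>\<^sub>F k in sequentially. ?x \<le> e * ?y + expectation (\<lambda>\<omega>. (A k \<omega>)\<^sup>2) / e"
      using A2
    proof eventually_elim
      case (elim k)
      then show ?case using abs_expectation_mult_le[OF YM Am Y(2) _ e, of k] unfolding eq[of k] by simp
    qed
    ultimately have "?x \<le> e * ?y + 0 / e" by (intro tendsto_lowerbound) auto
    then show ?thesis by simp
  qed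
  have "?x \<le> 0"
  proof (rule field_le_epsilon)
    fix e :: real assume e: "e > 0"
    have y: "?y \<ge> 0" by (intro Bochner_Integration.integral_nonneg) simp
    have "?x \<le> (e / (?y + 1)) * ?y" by (intro bound divide_pos_pos e add_nonneg_pos y) simp
    also have "\<dots> = e * (?y / (?y + 1))" by simp
    also have "\<dots> \<le> e * 1"
      using e add_nonneg_pos[OF y zero_less_one] by (intro mult_left_mono) (auto simp: pos_divide_le_eq)
    finally show "?x \<le> 0 + e" by simp
  qed
  then show "expectation (\<lambda>\<omega>. Y \<omega> * (It \<omega> - Is \<omega>)) = 0" by simp
qed

end

section \<open>Correlation of a stationary Pearson diffusion\<close>

text \<open>At the outset \<open>c\<close> is merely bounded and measurable. The equation itself
  makes it continuous, hence differentiable with c' = -\<theta> c, so c(t) exp(\<theta> (t - s)) is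
  constant with value c(s) = 1.\<close>

lemma linear_integral_equation_unique:
  fixes c :: "real \<Rightarrow> real"
  assumes m: "c \<in> borel_measurable borel" and bd: "\<And>u. \<bar>c u\<bar> \<le> B"
    and eq: "\<And>t. s \<le> t \<Longrightarrow> c t = 1 - \<theta> * (LINT u:{s..t}|lborel. c u)" and st: "s \<le> t"
  shows "c t = exp (- \<theta> * (t - s))"
proof -
  have "integrable lborel (\<lambda>u. B * indicator {s..x} u :: real)" for x
    by (intro integrable_mult_right integrable_real_indicator) (auto simp: emeasure_lborel_Icc_eq)
  then have si: "set_integrable lborel {s..x} c" for x
    unfolding set_integrable_def
    by (rule Bochner_Integration.integrable_bound)
      (use m bd in \<open>auto simp: indicator_def intro!: AE_I2 intro: order_trans[OF _ abs_ge_self]\<close>)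
  have eq': "c x = 1 - \<theta> * integral {s..x} c" if "s \<le> x" for x
    using eq[OF that] set_borel_integral_eq_integral(2)[OF si] by simp
  have io: "c integrable_on {s..t}"
    using set_borel_integral_eq_integral(1)[OF si] .
  have "continuous_on {s..t} (\<lambda>x. 1 - \<theta> * integral {s..x} c)"
    by (intro continuous_intros indefinite_integral_continuous_1 io)
  then have cont: "continuous_on {s..t} c"
    by (rule continuous_on_cong[THEN iffD1, rotated 2]) (simp_all add: eq')
  have der: "(c has_real_derivative (- \<theta> * c x)) (at x within {s..t})" if x: "x \<in> {s..t}" for x
  proof -
    have "((\<lambda>x. 1 - \<theta> * integral {s..x} c) has_real_derivative (0 - \<theta> * c x)) (at x within {s..t})"
      by (intro DERIV_diff DERIV_const DERIV_cmult integral_has_real_derivative cont x)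
    then have "((\<lambda>x. 1 - \<theta> * integral {s..x} c) has_real_derivative (- \<theta> * c x)) (at x within {s..t})" by simp
    then show ?thesis
      by (rule has_field_derivative_transform_within[OF _ zero_less_one x]) (simp add: eq')
  qed
  have "((\<lambda>x. c x * exp (\<theta> * (x - s))) has_real_derivative 0) (at x within {s..t})" if "x \<in> {s..t}" for x
  proof -
    have "((\<lambda>x. exp (\<theta> * (x - s))) has_real_derivative \<theta> * exp (\<theta> * (x - s))) (at x within {s..t})"
      by (auto intro!: derivative_eq_intros)
    from DERIV_mult[OF der[OF that] this] show ?thesis by (simp add: algebra_simps)
  qed
  then obtain K where K: "\<And>x. x \<in> {s..t} \<Longrightarrow> c x * exp (\<theta> * (x - s)) = K"
    using has_field_derivative_zero_constant[of "{s..t}" "\<lambda>x. c x * exp (\<theta> * (x - s))"] by auto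
  have "c s = 1" using eq'[of s] by simp
  then have "c t * exp (\<theta> * (t - s)) = 1" using K[of s] K[of t] st by simp
  then have "c t * exp (\<theta> * (t - s)) * exp (- \<theta> * (t - s)) = exp (- \<theta> * (t - s))" by simp
  then show ?thesis by (simp add: mult.assoc flip: exp_add)
qed

text \<open>\<open>Q 1\<close> is affine, so its second derivative vanishes and the generator acts
  through the drift alone: the eigenvalue equation becomes linear mean reversion at rate
  \<open>lam 1\<close>.\<close>

lemma pearson_first_eigenfunction:
  assumes "pearson_eigensystem a0 a1 d0 d1 d2 m Q lam"
  obtains k l where "k \<noteq> 0" "poly (Q 1) = (\<lambda>x. k * x + l)" "\<And>x. k * drift a0 a1 x = - lam 1 * (k * x + l)"
proof -
  have deg: "degree (Q 1) = 1" and gen: "\<And>y. pearson_generator a0 a1 d0 d1 d2 (poly (Q 1)) y = - lam 1 * poly (Q 1) y"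
    using assms unfolding pearson_eigensystem_def by auto
  obtain l q where lq: "Q 1 = pCons l q" by (cases "Q 1")
  then have "q \<noteq> 0" "degree q = 0" using deg by (auto split: if_splits)
  then obtain k where Q: "Q 1 = [:l, k:]" and k: "k \<noteq> 0"
    using lq by (auto elim: degree_eq_zeroE)
  have p: "poly (Q 1) = (\<lambda>x. k * x + l)" unfolding Q by (auto simp: mult.commute)
  have d: "deriv (\<lambda>x. k * x + l) = (\<lambda>_. k)"
    by (rule ext, rule DERIV_imp_deriv) (auto intro!: derivative_eq_intros)
  have "k * drift a0 a1 x = - lam 1 * (k * x + l)" for x
    using gen[of x] unfolding p pearson_generator_def d by (simp add: mult.commute)
  then show ?thesis using that k p by blast
qed

context brownian_space
begin

text \<open>This lets the integrand be read at time \<open>max 0 u\<close>, the form in which joint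
  measurability is available.\<close>

lemma ito_integral_cong:
  assumes "\<And>u \<omega>. 0 \<le> u \<Longrightarrow> H u \<omega> = H' u \<omega>" "ito_integral M F W H t I"
  shows "ito_integral M F W H' t I"
proof -
  have "(\<integral>\<^sup>+u\<in>{0..t}. ennreal ((H' u \<omega> - p u \<omega>)\<^sup>2) \<partial>lborel) = (\<integral>\<^sup>+u\<in>{0..t}. ennreal ((H u \<omega> - p u \<omega>)\<^sup>2) \<partial>lborel)" for p \<omega>
    using assms(1) by (intro nn_integral_cong) (auto simp: indicator_def)
  then show ?thesis using assms(2) unfolding ito_integral_def by (simp only:)
qed

end

section \<open>Covariance of the first eigenfunction along the diffusion\<close>

locale stationary_pearson = brownian_space M F W for M :: "'a measure" and F W +
  fixes a0 a1 d0 d1 d2 :: real and m :: "real \<Rightarrow> real" and Q :: "nat \<Rightarrow> real poly" and lam :: "nat \<Rightarrow> real"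
    and X :: "real \<Rightarrow> 'a \<Rightarrow> real" and k l \<theta> :: real
  assumes eig: "pearson_eigensystem a0 a1 d0 d1 d2 m Q lam"
    and pd: "pearson_diffusion M F W a0 a1 d0 d1 d2 X"
    and ss: "steady_state M m X"
    and Q1: "poly (Q 1) = (\<lambda>x. k * x + l)" and drift_eq: "\<And>x. k * drift a0 a1 x = - \<theta> * (k * x + l)"
begin

abbreviation Y :: "real \<Rightarrow> 'a \<Rightarrow> real" where "Y t \<omega> \<equiv> k * X t \<omega> + l"

lemma X_F: "t \<ge> 0 \<Longrightarrow> X t \<in> borel_measurable (F t)"
  using pd unfolding pearson_diffusion_def sde_solution_def by blast

lemma X_measurable: "t \<ge> 0 \<Longrightarrow> X t \<in> borel_measurable M"
  by (rule measurable_F_M[OF X_F])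

lemma X_continuous: "\<omega> \<in> space M \<Longrightarrow> continuous_on {0..} (\<lambda>t. X t \<omega>)"
  using pd unfolding pearson_diffusion_def sde_solution_def by blast

lemma X_right_continuous: "\<omega> \<in> space M \<Longrightarrow> t \<ge> 0 \<Longrightarrow> continuous (at_right t) (\<lambda>u. X u \<omega>)"
proof -
  assume \<omega>: "\<omega> \<in> space M" and t: "t \<ge> 0"
  have "continuous (at t within {0..}) (\<lambda>u. X u \<omega>)"
    using X_continuous[OF \<omega>] t by (simp add: continuous_on_eq_continuous_within)
  then show ?thesis by (rule continuous_within_subset) (use t in auto)
qed

lemma jointly_measurable_X: "(\<lambda>(t, \<omega>). X (max 0 t) \<omega>) \<in> borel_measurable (borel \<Otimes>\<^sub>M M)"
  by (intro right_continuous_jointly_measurable X_measurable X_right_continuous)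

lemma jointly_measurable_X' [measurable (raw)]:
  assumes [measurable]: "f \<in> borel_measurable N" "g \<in> measurable N M"
  shows "(\<lambda>x. X (max 0 (f x)) (g x)) \<in> borel_measurable N"
  using measurable_compose[OF measurable_Pair[OF assms] jointly_measurable_X] by simp

text \<open>The law of \<open>X t\<close> has density \<open>m\<close>, so orthonormality of
  \<open>Q 0\<close> and \<open>Q 1\<close> becomes a statement about moments; \<open>Q 0\<close> is
  a nonzero constant, which gives mean 0.\<close>

lemma
  assumes t: "t \<ge> 0"
  shows integrable_Y_square: "integrable M (\<lambda>\<omega>. (Y t \<omega>)\<^sup>2)"
    and expectation_Y_square: "expectation (\<lambda>\<omega>. (Y t \<omega>)\<^sup>2) = 1"
    and integrable_Y: "integrable M (Y t)"
    and expectation_Y: "expectation (Y t) = 0"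
proof -
  let ?N = "density lborel (\<lambda>y. ennreal (m y))"
  have [measurable]: "X t \<in> borel_measurable M" by (rule X_measurable[OF t])
  have N: "distr M lborel (X t) = ?N"
    using ss t unfolding steady_state_def by (intro distributed_distr_eq_density) auto
  have orth: "\<And>i j. (LINT y|?N. poly (Q i) y * poly (Q j) y) = (if i = j then 1 else 0)" and deg: "\<And>n. degree (Q n) = n"
    using eig unfolding pearson_eigensystem_def orthonormal_basis_L2_def by blast+
  have [measurable]: "poly p \<in> borel_measurable borel" for p :: "real poly"
    by (intro borel_measurable_continuous_onI continuous_intros)
  have E: "expectation (\<lambda>\<omega>. poly (Q i) (X t \<omega>) * poly (Q j) (X t \<omega>)) = (if i = j then 1 else 0)" for i j
    unfolding orth[symmetric] N[symmetric]
    by (subst integral_distr) simp_all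
  show E2: "expectation (\<lambda>\<omega>. (Y t \<omega>)\<^sup>2) = 1"
    using E[of 1 1] unfolding Q1 power2_eq_square by simp
  \<comment> \<open>The integral of a non-integrable function is 0 by convention, so the value 1
    forces integrability.\<close>
  then show I2: "integrable M (\<lambda>\<omega>. (Y t \<omega>)\<^sup>2)"
    by (metis not_integrable_integral_eq zero_neq_one)
  show "integrable M (Y t)" by (rule integrable_of_square[OF _ I2]) measurable
  obtain q where q: "Q 0 = [:q:]" using deg[of 0] by (auto elim: degree_eq_zeroE)
  have "q * q = 1" using E[of 0 0] by (simp add: q prob_space)
  then have "q \<noteq> 0" by auto
  moreover have "q * expectation (Y t) = 0" using E[of 0 1] unfolding Q1 q by simp
  ultimately show "expectation (Y t) = 0" by simp
qed

lemma set_integrable_Y: "\<omega> \<in> space M \<Longrightarrow> 0 \<le> s \<Longrightarrow> set_integrable lborel {s..t} (\<lambda>u. Y u \<omega>)"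
  using continuous_on_subset[OF X_continuous, of \<omega> "{s..t}"]
  by (intro borel_integrable_atLeastAtMost' continuous_intros) auto

lemma set_integral_Y_diff:
  assumes \<omega>: "\<omega> \<in> space M" and st: "0 \<le> s" "s \<le> t"
  shows "(LINT u:{0..t}|lborel. Y u \<omega>) - (LINT u:{0..s}|lborel. Y u \<omega>) = (LINT u:{s..t}|lborel. Y u \<omega>)"
  using set_borel_integral_eq_integral[OF set_integrable_Y[OF \<omega> order_refl, of t]]
    set_borel_integral_eq_integral[OF set_integrable_Y[OF \<omega> order_refl, of s]]
    set_borel_integral_eq_integral[OF set_integrable_Y[OF \<omega> st(1), of t]]
    Henstock_Kurzweil_Integration.integral_combine[OF st, of "\<lambda>u. Y u \<omega>"]
  by simp

lemma
  assumes s: "0 \<le> s"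
  shows integrable_Y_mult_Y: "0 \<le> u \<Longrightarrow> integrable M (\<lambda>\<omega>. Y s \<omega> * Y u \<omega>)"
    and abs_expectation_Y_mult_Y: "0 \<le> u \<Longrightarrow> expectation (\<lambda>\<omega>. \<bar>Y s \<omega> * Y u \<omega>\<bar>) \<le> 2"
proof -
  assume u: "0 \<le> u"
  have [measurable]: "X s \<in> borel_measurable M" "X u \<in> borel_measurable M" by (auto intro!: X_measurable s u)
  show i: "integrable M (\<lambda>\<omega>. Y s \<omega> * Y u \<omega>)"
    by (intro integrable_mult_squares integrable_Y_square s u) auto
  have "expectation (\<lambda>\<omega>. \<bar>Y s \<omega> * Y u \<omega>\<bar>) \<le> expectation (\<lambda>\<omega>. (Y s \<omega>)\<^sup>2 + (Y u \<omega>)\<^sup>2)"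
    by (intro integral_mono integrable_abs i Bochner_Integration.integrable_add integrable_Y_square s u abs_mult_le_sum_squares)
  also have "\<dots> = 2"
    using integrable_Y_square[OF s] integrable_Y_square[OF u] by (simp add: expectation_Y_square s u)
  finally show "expectation (\<lambda>\<omega>. \<bar>Y s \<omega> * Y u \<omega>\<bar>) \<le> 2" .
qed

text \<open>The integral equations at \<open>t\<close> and \<open>s\<close> are subtracted and
  multiplied by \<open>Y s\<close>. By \<open>drift_eq\<close> the drift part is -\<theta> times the
  integral of \<open>Y\<close>, by orthogonality the Ito part has expectation 0, and the square of
  \<open>Y s\<close> has expectation 1.\<close>

lemma expectation_Y_mult_Y_integral_equation:
  assumes st: "0 \<le> s" "s \<le> t"
  shows "expectation (\<lambda>\<omega>. Y s \<omega> * Y t \<omega>) = 1 - \<theta> * (LINT u:{s..t}|lborel. expectation (\<lambda>\<omega>. Y s \<omega> * Y (max 0 u) \<omega>))"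
proof -
  have t: "0 \<le> t" using st by simp
  have Xm[measurable]: "X s \<in> borel_measurable M" "X t \<in> borel_measurable M" by (auto intro!: X_measurable st t)
  obtain \<sigma> where \<sigma>[measurable]: "\<sigma> \<in> borel_measurable borel" and sde: "sde_solution M F W (drift a0 a1) \<sigma> X"
    using pd unfolding pearson_diffusion_def by blast
  obtain Is where Is: "ito_integral M F W (\<lambda>u \<omega>. \<sigma> (X u \<omega>)) s Is"
    and Is_eq: "AE \<omega> in M. X s \<omega> = X 0 \<omega> + (LINT u:{0..s}|lborel. drift a0 a1 (X u \<omega>)) + Is \<omega>"
    using sde st(1) unfolding sde_solution_def by blast
  obtain It where It: "ito_integral M F W (\<lambda>u \<omega>. \<sigma> (X u \<omega>)) t It"
    and It_eq: "AE \<omega> in M. X t \<omega> = X 0 \<omega> + (LINT u:{0..t}|lborel. drift a0 a1 (X u \<omega>)) + It \<omega>"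
    using sde t unfolding sde_solution_def by blast
  let ?H = "\<lambda>u \<omega>. \<sigma> (X (max 0 u) \<omega>)"
  have Hm: "(\<lambda>(u, \<omega>). ?H u \<omega>) \<in> borel_measurable (lborel \<Otimes>\<^sub>M M)" by measurable
  have Is': "ito_integral M F W ?H s Is" and It': "ito_integral M F W ?H t It"
    by (rule ito_integral_cong[OF _ Is] ito_integral_cong[OF _ It], simp add: max_def)+
  have YF: "Y s \<in> borel_measurable (F s)" using X_F[OF st(1)] by measurable
  note orth = ito_integral_orthogonal[OF Hm Is' It' st YF integrable_Y_square[OF st(1)]]
  have [measurable]: "Is \<in> borel_measurable M" "It \<in> borel_measurable M"
    using Is It unfolding ito_integral_def by auto
  let ?J = "\<lambda>\<omega>. LINT u|lborel. indicator {s..t} u * (Y s \<omega> * Y (max 0 u) \<omega>)"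
  have kI: "k * (LINT u:{0..r}|lborel. drift a0 a1 (X u \<omega>)) = - \<theta> * (LINT u:{0..r}|lborel. Y u \<omega>)" for r \<omega>
    unfolding set_lebesgue_integral_def integral_mult_right_zero[symmetric]
    by (intro Bochner_Integration.integral_cong refl) (auto simp: indicator_def drift_eq)
  have AE_eq: "AE \<omega> in M. Y s \<omega> * Y t \<omega> = (Y s \<omega>)\<^sup>2 - \<theta> * ?J \<omega> + k * (Y s \<omega> * (It \<omega> - Is \<omega>))"
    using Is_eq It_eq AE_space
  proof eventually_elim
    case (elim \<omega>)
    have "Y t \<omega> - Y s \<omega> = k * (LINT u:{0..t}|lborel. drift a0 a1 (X u \<omega>)) - k * (LINT u:{0..s}|lborel. drift a0 a1 (X u \<omega>)) + k * (It \<omega> - Is \<omega>)"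
      using elim(1,2) by (simp add: algebra_simps)
    also have "\<dots> = - \<theta> * ((LINT u:{0..t}|lborel. Y u \<omega>) - (LINT u:{0..s}|lborel. Y u \<omega>)) + k * (It \<omega> - Is \<omega>)"
      unfolding kI by (simp add: algebra_simps)
    finally have Yt: "Y t \<omega> = Y s \<omega> - \<theta> * (LINT u:{s..t}|lborel. Y u \<omega>) + k * (It \<omega> - Is \<omega>)"
      unfolding set_integral_Y_diff[OF elim(3) st] by simp
    have "?J \<omega> = Y s \<omega> * (LINT u:{s..t}|lborel. Y u \<omega>)"
      unfolding set_lebesgue_integral_def integral_mult_right_zero[symmetric]
      using st by (intro Bochner_Integration.integral_cong refl) (auto simp: indicator_def max_def)
    then show ?case
      by (subst Yt) (simp add: algebra_simps power2_eq_square)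
  qed
  interpret P: pair_sigma_finite lborel M ..
  have J: "integrable (lborel \<Otimes>\<^sub>M M) (\<lambda>(u, \<omega>). indicator {s..t} u * (Y s \<omega> * Y (max 0 u) \<omega>))"
  proof (rule P.Fubini_integrable)
    show "AE u in lborel. integrable M (\<lambda>\<omega>. case (u, \<omega>) of (u, \<omega>) \<Rightarrow> indicator {s..t} u * (Y s \<omega> * Y (max 0 u) \<omega>))"
      using integrable_Y_mult_Y[OF st(1)] by simp
    have "integrable lborel (\<lambda>u. 2 * indicator {s..t} u :: real)"
      by (intro integrable_mult_right integrable_real_indicator) (auto simp: emeasure_lborel_Icc_eq)
    then show "integrable lborel (\<lambda>u. LINT \<omega>|M. norm (case (u, \<omega>) of (u, \<omega>) \<Rightarrow> indicator {s..t} u * (Y s \<omega> * Y (max 0 u) \<omega>)))"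
      by (rule Bochner_Integration.integrable_bound)
        (use abs_expectation_Y_mult_Y[OF st(1)] in \<open>auto simp: indicator_def intro!: AE_I2\<close>)
  qed measurable
  have i1: "integrable M (\<lambda>\<omega>. Y s \<omega> * (It \<omega> - Is \<omega>))"
    by (intro integrable_mult_squares integrable_Y_square st orth(1)) auto
  have i2: "integrable M ?J" using P.integrable_snd[OF J] .
  have "expectation (\<lambda>\<omega>. Y s \<omega> * Y t \<omega>) = expectation (\<lambda>\<omega>. (Y s \<omega>)\<^sup>2 - \<theta> * ?J \<omega> + k * (Y s \<omega> * (It \<omega> - Is \<omega>)))"
    using i2 AE_eq by (intro integral_cong_AE) auto
  also have "\<dots> = expectation (\<lambda>\<omega>. (Y s \<omega>)\<^sup>2) - \<theta> * expectation ?J + k * expectation (\<lambda>\<omega>. Y s \<omega> * (It \<omega> - Is \<omega>))"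
    using i1 i2 integrable_Y_square[OF st(1)] by simp
  also have "expectation ?J = (LINT u|lborel. LINT \<omega>|M. indicator {s..t} u * (Y s \<omega> * Y (max 0 u) \<omega>))"
    by (rule P.Fubini_integral[OF J])
  finally show ?thesis
    using orth(2) expectation_Y_square[OF st(1)] by (simp add: set_lebesgue_integral_def)
qed

lemma expectation_Y_mult_Y:
  assumes st: "0 \<le> s" "s \<le> t"
  shows "expectation (\<lambda>\<omega>. Y s \<omega> * Y t \<omega>) = exp (- \<theta> * (t - s))"
proof -
  have [measurable]: "X s \<in> borel_measurable M" by (rule X_measurable[OF st(1)])
  let ?c = "\<lambda>u. expectation (\<lambda>\<omega>. Y s \<omega> * Y (max 0 u) \<omega>)"
  have "?c t = exp (- \<theta> * (t - s))"
  proof (rule linear_integral_equation_unique[where B = 2])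
    show "?c \<in> borel_measurable borel" by measurable
    show "\<bar>?c u\<bar> \<le> 2" for u
      using order_trans[OF integral_abs_bound abs_expectation_Y_mult_Y[OF st(1)], of "max 0 u"] by simp
    show "?c r = 1 - \<theta> * (LINT u:{s..r}|lborel. ?c u)" if "s \<le> r" for r
      using expectation_Y_mult_Y_integral_equation[OF st(1) that] st that by (simp add: max_def)
  qed fact
  then show ?thesis using st by (simp add: max_def)
qed

end

section \<open>Independent time changes\<close>

text \<open>Independence concerns laws on a product space of paths, whose sigma-algebra sees only
  countably many coordinates at once. Evaluating one path at a time read from the other is therefore
  expressed by limits along grids, which right continuity justifies. Once X(E) is a measurable
  function of the pair of paths, the single \<omega> may be replaced by independent \<omega> and
  \<omega>'; the uniform bound \<open>B\<close> gives integrability on the product.\<close>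

lemma (in prob_space)
  fixes X E :: "real \<Rightarrow> 'a \<Rightarrow> real" and f :: "real \<times> real \<Rightarrow> real"
  assumes X: "\<And>t. t \<ge> 0 \<Longrightarrow> X t \<in> borel_measurable M"
    and cont: "\<And>t \<omega>. t \<ge> 0 \<Longrightarrow> \<omega> \<in> space M \<Longrightarrow> continuous (at_right t) (\<lambda>u. X u \<omega>)"
    and ind: "indep_processes M X E" and E0: "\<And>t \<omega>. 0 \<le> E t \<omega>"
    and f[measurable]: "f \<in> borel_measurable borel" and st: "0 \<le> s" "0 \<le> t"
    and int: "\<And>a b. a \<ge> 0 \<Longrightarrow> b \<ge> 0 \<Longrightarrow> integrable M (\<lambda>\<omega>. f (X a \<omega>, X b \<omega>))"
    and bd: "\<And>a b. a \<ge> 0 \<Longrightarrow> b \<ge> 0 \<Longrightarrow> expectation (\<lambda>\<omega>. \<bar>f (X a \<omega>, X b \<omega>)\<bar>) \<le> B"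
  shows integrable_time_change: "integrable M (\<lambda>\<omega>. f (X (E s \<omega>) \<omega>, X (E t \<omega>) \<omega>))"
    and expectation_time_change: "expectation (\<lambda>\<omega>. f (X (E s \<omega>) \<omega>, X (E t \<omega>) \<omega>)) =
      expectation (\<lambda>\<omega>'. expectation (\<lambda>\<omega>. f (X (E s \<omega>') \<omega>, X (E t \<omega>') \<omega>)))"
proof -
  define A :: "(real \<Rightarrow> real) measure" where "A = Pi\<^sub>M {0..} (\<lambda>_. borel)"
  define Xp where "Xp \<omega> = (\<lambda>t\<in>{0..}. X t \<omega>)" for \<omega>
  define Ep where "Ep \<omega> = (\<lambda>t\<in>{0..}. E t \<omega>)" for \<omega>
  have iv: "indep_var A Xp A Ep" using ind by (simp add: indep_processes_def A_def Xp_def[abs_def] Ep_def[abs_def])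
  then have [measurable]: "Xp \<in> measurable M A" "Ep \<in> measurable M A"
    and dist: "distr M A Xp \<Otimes>\<^sub>M distr M A Ep = distr M (A \<Otimes>\<^sub>M A) (\<lambda>\<omega>. (Xp \<omega>, Ep \<omega>))"
    by (auto simp: indep_var_distribution_eq)
  have comp: "(\<lambda>x. x r) \<in> borel_measurable A" if "r \<ge> 0" for r
    unfolding A_def by (rule measurable_component_singleton) (use that in simp)
  have E_m: "E r \<in> borel_measurable M" if r: "r \<ge> 0" for r
  proof -
    have "(\<lambda>\<omega>. Ep \<omega> r) \<in> borel_measurable M" using comp[OF r] by measurable
    then show ?thesis using r by (simp add: Ep_def)
  qed
  note [measurable] = E_m[OF st(1)] E_m[OF st(2)]
  let ?k = "\<lambda>n (y::real). nat \<lfloor>real (Suc n) * max 0 y\<rfloor>"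
  \<comment> \<open>Taking \<open>lim\<close> makes this measurable on all pairs of paths; it agrees
    with evaluation when the first path is right-continuous and the time read from the second is
    nonnegative.\<close>
  define v where "v r p = lim (\<lambda>n. fst p ((real (?k n (snd p r)) + 1) / real (Suc n)))" for r and p :: "(real \<Rightarrow> real) \<times> (real \<Rightarrow> real)"
  have v_m: "v r \<in> borel_measurable (A \<Otimes>\<^sub>M A)" if r: "r \<ge> 0" for r
    unfolding v_def
  proof (rule borel_measurable_lim_metric)
    fix n
    have [measurable]: "(\<lambda>x. x r) \<in> borel_measurable A" by (rule comp[OF r])
    show "(\<lambda>p. fst p ((real (?k n (snd p r)) + 1) / real (Suc n))) \<in> borel_measurable (A \<Otimes>\<^sub>M A)"
    proof (rule measurable_compose_countable[where g = "\<lambda>p. ?k n (snd p r)" and f = "\<lambda>k p. fst p ((real k + 1) / real (Suc n))"])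
      show "(\<lambda>p. fst p ((real k + 1) / real (Suc n))) \<in> borel_measurable (A \<Otimes>\<^sub>M A)" for k
        by (rule measurable_compose[OF measurable_fst comp]) simp
    qed measurable
  qed
  have v_eq: "v r (Xp \<omega>, Ep \<omega>') = X (E r \<omega>') \<omega>" if r: "r \<ge> 0" and \<omega>: "\<omega> \<in> space M" for r \<omega> \<omega>'
  proof -
    have "((\<lambda>u. X u \<omega>) \<longlongrightarrow> X (E r \<omega>') \<omega>) (at_right (E r \<omega>'))"
      using cont[OF E0 \<omega>, of r \<omega>'] by (simp add: continuous_within)
    then have "(\<lambda>n. X ((real (nat \<lfloor>real (Suc n) * E r \<omega>'\<rfloor>) + 1) / real (Suc n)) \<omega>) \<longlonglongrightarrow> X (E r \<omega>') \<omega>"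
      by (rule filterlim_compose[OF _ grid_above[OF E0]])
    then have "lim (\<lambda>n. X ((real (nat \<lfloor>real (Suc n) * E r \<omega>'\<rfloor>) + 1) / real (Suc n)) \<omega>) = X (E r \<omega>') \<omega>"
      by (rule limI)
    then show ?thesis using r E0[of r \<omega>'] by (simp add: v_def Xp_def Ep_def max.absorb2)
  qed
  define \<Psi> where "\<Psi> p = f (v s p, v t p)" for p
  have [measurable]: "\<Psi> \<in> borel_measurable (A \<Otimes>\<^sub>M A)"
    unfolding \<Psi>_def using v_m[OF st(1)] v_m[OF st(2)] f unfolding borel_prod[symmetric] by measurable
  interpret PE: prob_space "distr M A Ep" by (rule prob_space_distr) measurable
  interpret P: pair_sigma_finite M M ..
  have "distr M A Xp \<Otimes>\<^sub>M distr M A Ep = distr (M \<Otimes>\<^sub>M M) (A \<Otimes>\<^sub>M A) (\<lambda>(\<omega>, \<omega>'). (Xp \<omega>, Ep \<omega>'))"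
    by (rule pair_measure_distr) (auto intro: PE.sigma_finite_measure_axioms)
  with dist have D: "distr M (A \<Otimes>\<^sub>M A) (\<lambda>\<omega>. (Xp \<omega>, Ep \<omega>)) = distr (M \<Otimes>\<^sub>M M) (A \<Otimes>\<^sub>M A) (\<lambda>(\<omega>, \<omega>'). (Xp \<omega>, Ep \<omega>'))"
    by simp
  let ?g = "\<lambda>\<omega> \<omega>'. f (X (E s \<omega>') \<omega>, X (E t \<omega>') \<omega>)"
  have \<Psi>_eq: "\<Psi> (Xp \<omega>, Ep \<omega>') = ?g \<omega> \<omega>'" if "\<omega> \<in> space M" for \<omega> \<omega>'
    using v_eq st that by (simp add: \<Psi>_def)
  have \<Psi>_eq': "\<Psi> (case x of (\<omega>, \<omega>') \<Rightarrow> (Xp \<omega>, Ep \<omega>')) = case_prod ?g x" if "x \<in> space (M \<Otimes>\<^sub>M M)" for x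
    using that by (auto simp: space_pair_measure \<Psi>_eq)
  have iff: "integrable M (\<lambda>\<omega>. ?g \<omega> \<omega>) \<longleftrightarrow> integrable (M \<Otimes>\<^sub>M M) (case_prod ?g)"
  proof -
    have "integrable M (\<lambda>\<omega>. \<Psi> (Xp \<omega>, Ep \<omega>)) \<longleftrightarrow> integrable (distr M (A \<Otimes>\<^sub>M A) (\<lambda>\<omega>. (Xp \<omega>, Ep \<omega>))) \<Psi>"
      by (rule integrable_distr_eq[symmetric]) measurable
    also have "\<dots> \<longleftrightarrow> integrable (M \<Otimes>\<^sub>M M) (\<lambda>x. \<Psi> (case x of (\<omega>, \<omega>') \<Rightarrow> (Xp \<omega>, Ep \<omega>')))"
      unfolding D by (rule integrable_distr_eq) measurable
    also have "\<dots> \<longleftrightarrow> integrable (M \<Otimes>\<^sub>M M) (case_prod ?g)"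
      by (rule Bochner_Integration.integrable_cong[OF refl \<Psi>_eq'])
    finally show ?thesis by (simp add: \<Psi>_eq cong: Bochner_Integration.integrable_cong)
  qed
  have eq: "expectation (\<lambda>\<omega>. ?g \<omega> \<omega>) = integral\<^sup>L (M \<Otimes>\<^sub>M M) (case_prod ?g)"
  proof -
    have "expectation (\<lambda>\<omega>. \<Psi> (Xp \<omega>, Ep \<omega>)) = integral\<^sup>L (distr M (A \<Otimes>\<^sub>M A) (\<lambda>\<omega>. (Xp \<omega>, Ep \<omega>))) \<Psi>"
      by (rule integral_distr[symmetric]) measurable
    also have "\<dots> = (LINT x|(M \<Otimes>\<^sub>M M). \<Psi> (case x of (\<omega>, \<omega>') \<Rightarrow> (Xp \<omega>, Ep \<omega>')))"
      unfolding D by (rule integral_distr) measurable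
    also have "\<dots> = integral\<^sup>L (M \<Otimes>\<^sub>M M) (case_prod ?g)"
      by (rule Bochner_Integration.integral_cong[OF refl \<Psi>_eq'])
    finally show ?thesis by (simp add: \<Psi>_eq cong: Bochner_Integration.integral_cong)
  qed
  have gm: "case_prod ?g \<in> borel_measurable (M \<Otimes>\<^sub>M M)"
  proof -
    have "(\<lambda>x. \<Psi> (case x of (\<omega>, \<omega>') \<Rightarrow> (Xp \<omega>, Ep \<omega>'))) \<in> borel_measurable (M \<Otimes>\<^sub>M M)" by measurable
    also have "?this \<longleftrightarrow> case_prod ?g \<in> borel_measurable (M \<Otimes>\<^sub>M M)"
      by (rule measurable_cong) (rule \<Psi>_eq')
    finally show ?thesis .
  qed
  have gi: "integrable (M \<Otimes>\<^sub>M M) (case_prod ?g)"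
  proof (rule integrableI_bounded[OF gm])
    have "(\<integral>\<^sup>+x. ennreal (norm (case_prod ?g x)) \<partial>(M \<Otimes>\<^sub>M M)) = (\<integral>\<^sup>+\<omega>'. \<integral>\<^sup>+\<omega>. ennreal \<bar>?g \<omega> \<omega>'\<bar> \<partial>M \<partial>M)"
      using P.nn_integral_snd[of "\<lambda>x. ennreal (norm (case_prod ?g x))"] gm by simp
    also have "\<dots> \<le> (\<integral>\<^sup>+\<omega>'. ennreal B \<partial>M)"
    proof (rule nn_integral_mono)
      fix \<omega>'
      have "(\<integral>\<^sup>+\<omega>. ennreal \<bar>?g \<omega> \<omega>'\<bar> \<partial>M) = ennreal (expectation (\<lambda>\<omega>. \<bar>?g \<omega> \<omega>'\<bar>))"
        by (intro nn_integral_eq_integral integrable_abs int E0) simp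
      also have "\<dots> \<le> ennreal B" by (intro ennreal_leI bd E0)
      finally show "(\<integral>\<^sup>+\<omega>. ennreal \<bar>?g \<omega> \<omega>'\<bar> \<partial>M) \<le> ennreal B" .
    qed
    also have "\<dots> < \<infinity>" by (simp add: emeasure_space_1)
    finally show "(\<integral>\<^sup>+x. ennreal (norm (case_prod ?g x)) \<partial>(M \<Otimes>\<^sub>M M)) < \<infinity>" .
  qed
  then show "integrable M (\<lambda>\<omega>. ?g \<omega> \<omega>)" by (simp add: iff)
  show "expectation (\<lambda>\<omega>. ?g \<omega> \<omega>) = expectation (\<lambda>\<omega>'. expectation (\<lambda>\<omega>. ?g \<omega> \<omega>'))"
    unfolding eq by (rule P.integral_snd[OF gi, symmetric])
qed

text \<open>Measurability of each \<open>E t\<close> is part of what independence of the processes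
  asserts.\<close>

lemma (in prob_space) indep_processes_measurable:
  assumes "indep_processes M X E" "0 \<le> t"
  shows "E t \<in> borel_measurable M"
proof -
  have "(\<lambda>\<omega>. \<lambda>t\<in>{0..}. E t \<omega>) \<in> measurable M (Pi\<^sub>M {0..} (\<lambda>_. borel))"
    using assms(1) by (auto simp: indep_processes_def indep_var_distribution_eq)
  from measurable_compose[OF this measurable_component_singleton[of t]] show ?thesis
    using assms(2) by simp
qed

section \<open>The correlation formula\<close>

lemma continuous_on_integral_Icc:
  fixes g :: "real \<Rightarrow> real"
  assumes g: "integrable lborel (\<lambda>y. indicator {0..T} y * g y)"
  shows "continuous_on {0..T} (\<lambda>r. LINT y|lborel. indicator {0..r} y * g y)"
proof -
  have si: "set_integrable lborel {0..r} g" if "r \<in> {0..T}" for r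
  proof -
    have "integrable lborel (\<lambda>y. indicator {0..r} y *\<^sub>R (indicator {0..T} y * g y))"
      by (rule integrable_mult_indicator[OF _ g]) simp
    moreover have "indicator {0..r} y *\<^sub>R (indicator {0..T} y * g y) = indicator {0..r} y *\<^sub>R g y" for y
      using that by (auto simp: indicator_def)
    ultimately show ?thesis unfolding set_integrable_def by (simp only:)
  qed
  have eq: "(LINT y|lborel. indicator {0..r} y * g y) = integral {0..r} g" if "r \<in> {0..T}" for r
    using set_borel_integral_eq_integral(2)[OF si[OF that]] by (simp add: set_lebesgue_integral_def)
  show ?thesis
  proof (cases "T \<ge> 0")
    case True
    then have "g integrable_on {0..T}" using set_borel_integral_eq_integral(1)[OF si] by auto
    then have "continuous_on {0..T} (\<lambda>r. integral {0..r} g)" by (rule indefinite_integral_continuous_1)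
    then show ?thesis by (rule continuous_on_cong[THEN iffD2, rotated 2]) (simp_all add: eq)
  qed simp
qed

text \<open>The same affine map is applied to both variables, so the sign of \<open>k\<close>
  cancels, and for centred variables of variance one the correlation is the covariance.\<close>

lemma (in prob_space) corr_affine:
  assumes k: "k \<noteq> 0"
    and U: "integrable M (\<lambda>\<omega>. k * U \<omega> + l)" "expectation (\<lambda>\<omega>. k * U \<omega> + l) = 0" "expectation (\<lambda>\<omega>. (k * U \<omega> + l)\<^sup>2) = 1"
    and V: "integrable M (\<lambda>\<omega>. k * V \<omega> + l)" "expectation (\<lambda>\<omega>. k * V \<omega> + l) = 0" "expectation (\<lambda>\<omega>. (k * V \<omega> + l)\<^sup>2) = 1"
  shows "corr M U V = expectation (\<lambda>\<omega>. (k * U \<omega> + l) * (k * V \<omega> + l))"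
proof -
  have centred: "U \<omega> - expectation U = (k * U \<omega> + l) / k"
    if "integrable M (\<lambda>\<omega>. k * U \<omega> + l)" "expectation (\<lambda>\<omega>. k * U \<omega> + l) = 0" for U \<omega>
  proof -
    have "expectation U = expectation (\<lambda>\<omega>. ((k * U \<omega> + l) - l) / k)" using k by simp
    also have "\<dots> = expectation (\<lambda>\<omega>. (k * U \<omega> + l) - l) / k"
      by (simp only: integral_divide_zero)
    also have "expectation (\<lambda>\<omega>. (k * U \<omega> + l) - l) = - l"
      by (subst Bochner_Integration.integral_diff) (use that in \<open>simp_all add: prob_space\<close>)
    finally show ?thesis using k by (simp add: field_simps)
  qed
  have var: "expectation (\<lambda>\<omega>. ((k * U \<omega> + l) / k)\<^sup>2) = 1 / k\<^sup>2" "expectation (\<lambda>\<omega>. ((k * V \<omega> + l) / k)\<^sup>2) = 1 / k\<^sup>2"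
    by (simp_all only: power_divide integral_divide_zero U V)
  have cov: "expectation (\<lambda>\<omega>. (k * U \<omega> + l) / k * ((k * V \<omega> + l) / k)) = expectation (\<lambda>\<omega>. (k * U \<omega> + l) * (k * V \<omega> + l)) / k\<^sup>2"
    by (simp only: times_divide_times_eq integral_divide_zero power2_eq_square)
  have sd: "sqrt (1 / k\<^sup>2 * (1 / k\<^sup>2)) = 1 / k\<^sup>2"
    by (simp only: real_sqrt_abs2) simp
  show ?thesis
    unfolding corr_def centred[OF U(1,2)] centred[OF V(1,2)] var cov sd using k by simp
qed

section \<open>Potential densities for the two-term Laplace exponent\<close>

locale two_term_subordinator = subordinator_exponent M D "\<lambda>z. c1 * z powr \<beta>1 + c2 * z powr \<beta>2"
  for M :: "'a measure" and D c1 c2 \<beta>1 \<beta>2 +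
  assumes c1: "c1 \<ge> 0" and c2: "c2 > 0" and \<beta>1: "0 < \<beta>1" and \<beta>12: "\<beta>1 < \<beta>2"
begin

text \<open>\<open>dens \<theta> y / c2\<close> is the density of the \<theta>-potential measure of
  \<open>D\<close>; at \<theta> = 0 and y > 0 it is \<open>h_fun\<close>.\<close>

abbreviation dens :: "real \<Rightarrow> real \<Rightarrow> real" where
  "dens \<theta> y \<equiv> resolvent_density (\<beta>2 - \<beta>1) \<beta>2 (- (c1 / c2)) (- (\<theta> / c2)) y"

lemma gam_bet: "\<beta>2 - \<beta>1 > 0" "\<beta>2 > 0"
  using \<beta>1 \<beta>12 by auto

lemma laplace_bound:
  obtains z0 where "z0 > 0" "\<And>z. z \<ge> z0 \<Longrightarrow> \<bar>- (c1 / c2)\<bar> * z powr - (\<beta>2 - \<beta>1) + \<bar>- (\<theta> / c2)\<bar> * z powr - \<beta>2 < 1"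
proof -
  obtain z1 where z1: "\<And>z. z \<ge> z1 \<Longrightarrow> \<bar>- (c1 / c2)\<bar> * z powr - (\<beta>2 - \<beta>1) + \<bar>- (\<theta> / c2)\<bar> * z powr - \<beta>2 < 1"
    using eventually_ratio_less[OF gam_bet zero_less_one, of "\<bar>- (c1 / c2)\<bar>" "\<bar>- (\<theta> / c2)\<bar>"]
    unfolding eventually_at_top_linorder by auto
  show ?thesis by (rule that[of "max z1 1"]) (use z1 in auto)
qed

lemma dens_laplace:
  assumes \<theta>: "\<theta> \<ge> 0" and z: "z > 0"
    and q: "\<bar>- (c1 / c2)\<bar> * z powr - (\<beta>2 - \<beta>1) + \<bar>- (\<theta> / c2)\<bar> * z powr - \<beta>2 < 1"
  shows "(LINT y|lborel. indicator {0..} y * (exp (- z * y) * dens \<theta> y)) / c2 =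
    1 / (\<theta> + (c1 * z powr \<beta>1 + c2 * z powr \<beta>2))"
proof -
  have frac: "1 / B / (1 - (- (c1 / c2) * (A / B) + - (\<theta> / c2) * (1 / B))) / c2 = 1 / (\<theta> + (c1 * A + c2 * B))"
    if "A > 0" "B > 0" for A B
  proof -
    have "1 - (- (c1 / c2) * (A / B) + - (\<theta> / c2) * (1 / B)) = (\<theta> + (c1 * A + c2 * B)) / (c2 * B)"
      using that c2 by (simp add: field_simps)
    then show ?thesis using that c2 by simp
  qed
  have "z powr - (\<beta>2 - \<beta>1) = z powr \<beta>1 / z powr \<beta>2" "z powr - \<beta>2 = 1 / z powr \<beta>2"
    using powr_diff[of z \<beta>1 \<beta>2] z by (simp_all add: powr_minus_divide)
  then show ?thesis
    using frac[of "z powr \<beta>1" "z powr \<beta>2"] z unfolding resolvent_density_laplace[OF gam_bet z q] by simp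
qed

lemma integrable_dens:
  assumes w: "\<And>y. y \<ge> 0 \<Longrightarrow> \<bar>w y\<bar> \<le> C * exp (- z * y)" and z: "z > 0"
    and q: "\<bar>- (c1 / c2)\<bar> * z powr - (\<beta>2 - \<beta>1) + \<bar>- (\<theta> / c2)\<bar> * z powr - \<beta>2 < 1"
    and m: "w \<in> borel_measurable borel"
  shows "integrable lborel (\<lambda>y. indicator {0..} y * (w y * dens \<theta> y))"
  by (rule integrable_resolvent_density[OF gam_bet z q w m])

lemma integrable_dens_Icc: "integrable lborel (\<lambda>y. indicator {0..T} y * dens \<theta> y)"
proof -
  obtain z0 where z0: "z0 > 0" and q: "\<And>z. z \<ge> z0 \<Longrightarrow> \<bar>- (c1 / c2)\<bar> * z powr - (\<beta>2 - \<beta>1) + \<bar>- (\<theta> / c2)\<bar> * z powr - \<beta>2 < 1"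
    by (rule laplace_bound[where \<theta> = \<theta>]) blast
  have "integrable lborel (\<lambda>y. indicator {0..} y * (indicator {..T} y * dens \<theta> y))"
  proof (rule integrable_dens[OF _ z0 q[OF order_refl]])
    show "\<bar>indicator {..T} y\<bar> \<le> exp (z0 * T) * exp (- z0 * y)" for y :: real
      using z0 by (auto simp: indicator_def simp flip: exp_add)
  qed simp
  moreover have "indicator {0..} y * (indicator {..T} y * dens \<theta> y) = indicator {0..T} y * dens \<theta> y" for y
    by (auto simp: indicator_def)
  ultimately show ?thesis by simp
qed

text \<open>Used twice: with \<phi> = 1 and \<theta> > 0 it evaluates \<open>Phi\<close>, and with
  \<theta> = 0 and \<phi>(y) = Phi(t - y) it evaluates the integral against the potential
  measure.\<close>

lemma potential_dens:
  assumes \<theta>: "\<theta> \<ge> 0" and \<phi>: "continuous_on {0..s} \<phi>" and s: "s \<ge> 0"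
  shows "(LINT x|(lborel \<Otimes>\<^sub>M M). indicator {0..} (fst x) * exp (- \<theta> * fst x) *
      (indicator {..s} (D (max 0 (fst x)) (snd x)) * \<phi> (D (max 0 (fst x)) (snd x)))) =
    (LINT y|lborel. indicator {0..s} y * (\<phi> y * (dens \<theta> y / c2)))"
proof -
  obtain z0 where z0: "z0 > 0" and q: "\<And>z. z \<ge> z0 \<Longrightarrow> \<bar>- (c1 / c2)\<bar> * z powr - (\<beta>2 - \<beta>1) + \<bar>- (\<theta> / c2)\<bar> * z powr - \<beta>2 < 1"
    by (rule laplace_bound[where \<theta> = \<theta>]) blast
  have eq: "indicator {0..} y * (exp (- z * y) * (dens \<theta> y / c2)) = (indicator {0..} y * (exp (- z * y) * dens \<theta> y)) / c2" for y z
    by simp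
  show ?thesis
  proof (rule potential_truncated_eq[OF \<theta> z0 _ _ \<phi> s])
    show "integrable lborel (\<lambda>y. indicator {0..} y * (exp (- z0 * y) * (dens \<theta> y / c2)))"
      unfolding eq by (intro integrable_divide integrable_dens[OF _ z0 q[OF order_refl], of _ 1]) auto
    show "(LINT y|lborel. indicator {0..} y * (exp (- z * y) * (dens \<theta> y / c2))) = 1 / (\<theta> + (c1 * z powr \<beta>1 + c2 * z powr \<beta>2))"
      if "z \<ge> z0" for z
      unfolding eq integral_divide_zero using that z0 by (intro dens_laplace \<theta> q) auto
  qed
qed

lemma Phi_eq_dens:
  assumes \<theta>: "\<theta> > 0" and r: "r \<ge> 0"
  shows "Phi \<theta> r = 1 - \<theta> / c2 * (LINT y|lborel. indicator {0..r} y * dens \<theta> y)"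
  using potential_dens[of \<theta> r "\<lambda>_. 1"] \<theta> r by (simp add: Phi_def)

lemma Phi_eq_Phi_fun: "\<theta> > 0 \<Longrightarrow> r \<ge> 0 \<Longrightarrow> Phi \<theta> r = Phi_fun c1 c2 \<beta>1 \<beta>2 \<theta> r"
  by (simp only: Phi_eq_dens Phi_fun_eq_resolvent[OF c2 \<beta>1 \<beta>12])

text \<open>Continuity makes y -> Phi(t - y) an admissible test function in
  \<open>potential_dens\<close>. It follows from the integral representation, although the density
  may be unbounded near 0.\<close>

lemma continuous_on_Phi: "\<theta> > 0 \<Longrightarrow> continuous_on {0..T} (Phi \<theta>)"
  by (rule continuous_on_cong[THEN iffD2, OF refl Phi_eq_dens])
    (use c2 in \<open>auto intro!: continuous_intros continuous_on_integral_Icc integrable_dens_Icc\<close>)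

lemma expectation_exp_E_increment_eq:
  assumes \<theta>: "\<theta> > 0" and st: "0 \<le> s" "s \<le> t" and E: "E s \<in> borel_measurable M" "E t \<in> borel_measurable M"
  shows "expectation (\<lambda>\<omega>. exp (- \<theta> * (E t \<omega> - E s \<omega>))) =
    \<theta> * (LINT y:{0..s}|lborel. h_fun c1 c2 \<beta>1 \<beta>2 y * Phi_fun c1 c2 \<beta>1 \<beta>2 \<theta> (t - y)) + Phi_fun c1 c2 \<beta>1 \<beta>2 \<theta> t"
proof -
  have cont: "continuous_on {0..s} (\<lambda>y. Phi \<theta> (t - y))"
    by (rule continuous_on_compose2[OF continuous_on_Phi[OF \<theta>, of t]]) (use st in \<open>auto intro!: continuous_intros\<close>)
  have m: "set_borel_measurable borel {0..s} (\<lambda>y. Phi \<theta> (t - y))"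
    unfolding set_borel_measurable_def using cont by (intro borel_measurable_continuous_on_indicator) auto
  have ae: "AE y in lborel. indicator {0..s} y * (Phi \<theta> (t - y) * (dens 0 y / c2)) =
      indicator {0..s} y *\<^sub>R (h_fun c1 c2 \<beta>1 \<beta>2 y * Phi_fun c1 c2 \<beta>1 \<beta>2 \<theta> (t - y))"
    using AE_lborel_singleton[of 0]
  proof eventually_elim
    case (elim y)
    then show ?case
      using h_fun_eq_resolvent_density[OF c2 \<beta>1 \<beta>12, of y c1] st
      by (auto simp: indicator_def Phi_eq_Phi_fun[OF \<theta>])
  qed
  \<comment> \<open>At \<theta> = 0 the weight in u disappears, and the integral is against the
    potential measure itself.\<close>
  have "(LINT x|(lborel \<Otimes>\<^sub>M M). indicator {0..} (fst x) * exp (- 0 * fst x) *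
      (indicator {..s} (D (max 0 (fst x)) (snd x)) * Phi \<theta> (t - D (max 0 (fst x)) (snd x)))) =
      (LINT y|lborel. indicator {0..s} y * (Phi \<theta> (t - y) * (dens 0 y / c2)))"
    by (rule potential_dens[OF order_refl cont st(1)])
  also have "\<dots> = (LINT y:{0..s}|lborel. h_fun c1 c2 \<beta>1 \<beta>2 y * Phi_fun c1 c2 \<beta>1 \<beta>2 \<theta> (t - y))"
    unfolding set_lebesgue_integral_def
  proof (rule integral_cong_AE[OF _ _ ae])
    have "(\<lambda>y. (indicator {0..s} y *\<^sub>R Phi \<theta> (t - y)) * (dens 0 y / c2)) \<in> borel_measurable borel"
      using m borel_measurable_resolvent_density[OF gam_bet] unfolding set_borel_measurable_def
      by (intro borel_measurable_times borel_measurable_divide) auto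
    then show "(\<lambda>y. indicator {0..s} y * (Phi \<theta> (t - y) * (dens 0 y / c2))) \<in> borel_measurable lborel"
      by (simp add: mult.assoc)
    show "(\<lambda>y. indicator {0..s} y *\<^sub>R (h_fun c1 c2 \<beta>1 \<beta>2 y * Phi_fun c1 c2 \<beta>1 \<beta>2 \<theta> (t - y))) \<in> borel_measurable lborel"
      unfolding h_fun_def Phi_fun_def mittag_leffler_def gen_mittag_leffler_def by measurable
  qed
  finally show ?thesis
    using expectation_exp_E_increment[OF \<theta> st E] Phi_eq_Phi_fun[OF \<theta>, of t] st by simp
qed

end

theorem theorem3p3:
  fixes M :: "'a measure" and F :: "real \<Rightarrow> 'a measure"
    and W X1 D E X :: "real \<Rightarrow> 'a \<Rightarrow> real"
    and a0 a1 d0 d1 d2 :: real and m :: "real \<Rightarrow> real"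
    and Q :: "nat \<Rightarrow> real poly" and lam :: "nat \<Rightarrow> real"
    and \<theta> c1 c2 \<beta>1 \<beta>2 s t :: real
  assumes "prob_space M"
    and "hermite_case d0 d1 d2 m \<or> laguerre_case d0 d1 d2 m \<or> jacobi_case d0 d1 d2 m"
    and "pearson_eigensystem a0 a1 d0 d1 d2 m Q lam"
    and "pearson_diffusion M F W a0 a1 d0 d1 d2 X1"
    and "steady_state M m X1"
    and "\<theta> = lam 1"
    and "c1 \<ge> 0" and "c2 > 0" and "c1 + c2 = 1"
    and "0 < \<beta>1" and "\<beta>1 < \<beta>2" and "\<beta>2 < 1"
    and "subordinator M D"
    and "laplace_exponent M D (\<lambda>z. c1 * z powr \<beta>1 + c2 * z powr \<beta>2)"
    and "E = inverse_subordinator D"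
    and "indep_processes M X1 E"
    and "X = time_change X1 E"
    and "0 \<le> s" and "s \<le> t"
  shows "corr M (X t) (X s) =
    \<theta> * (LINT y:{0..s}|lborel. h_fun c1 c2 \<beta>1 \<beta>2 y * Phi_fun c1 c2 \<beta>1 \<beta>2 \<theta> (t - y))
      + Phi_fun c1 c2 \<beta>1 \<beta>2 \<theta> t"
proof -
  note eig = assms(3) and st = \<open>0 \<le> s\<close> \<open>s \<le> t\<close>
  interpret prob_space M by fact
  obtain k l where k: "k \<noteq> 0" and Q1: "poly (Q 1) = (\<lambda>x. k * x + l)"
    and drift: "\<And>x. k * drift a0 a1 x = - lam 1 * (k * x + l)"
    using pearson_first_eigenfunction[OF eig] by blast
  have "lam 0 = 0" "strict_mono lam" using eig unfolding pearson_eigensystem_def by blast+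
  then have \<theta>: "\<theta> > 0" using strict_monoD[of lam 0 1] \<open>\<theta> = lam 1\<close> by simp
  interpret P: stationary_pearson M F W a0 a1 d0 d1 d2 m Q lam X1 k l \<theta>
    using assms(3-5) Q1 drift \<open>\<theta> = lam 1\<close> assms(4)[unfolded pearson_diffusion_def]
    by unfold_locales auto
  have \<psi>: "c1 * z powr \<beta>1 + c2 * z powr \<beta>2 > 0" if "z > 0" for z
    using that \<open>c1 \<ge> 0\<close> \<open>c2 > 0\<close> by (intro add_nonneg_pos) auto
  interpret S: two_term_subordinator M D c1 c2 \<beta>1 \<beta>2
    using assms(7,8,10,11,13,14) \<psi> by unfold_locales auto
  have E_m: "E r \<in> borel_measurable M" if "r \<ge> 0" for r
    using assms(16) that by (rule indep_processes_measurable)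
  have E0: "0 \<le> E r \<omega>" for r \<omega> unfolding assms(15) by (rule S.E_nonneg)
  have t: "t \<ge> 0" using st by simp
  note tc = P.X_measurable P.X_right_continuous assms(16) E0
  \<comment> \<open>The absolute value is kept because the formula is evaluated at pairs
    \<open>E a\<close>, \<open>E b\<close> whose order is not fixed.\<close>
  have cov: "expectation (\<lambda>\<omega>. P.Y a \<omega> * P.Y b \<omega>) = exp (- \<theta> * \<bar>a - b\<bar>)" if "a \<ge> 0" "b \<ge> 0" for a b
  proof (cases "a \<le> b")
    case True
    then show ?thesis using P.expectation_Y_mult_Y[OF \<open>a \<ge> 0\<close> True] by simp
  next
    case False
    have "expectation (\<lambda>\<omega>. P.Y a \<omega> * P.Y b \<omega>) = expectation (\<lambda>\<omega>. P.Y b \<omega> * P.Y a \<omega>)"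
      by (rule Bochner_Integration.integral_cong[OF refl]) (rule mult.commute)
    then show ?thesis using P.expectation_Y_mult_Y[OF \<open>b \<ge> 0\<close>, of a] False by simp
  qed
  let ?Z = "\<lambda>r \<omega>. k * X1 (E r \<omega>) \<omega> + l"
  let ?f = "\<lambda>p. (k * fst p + l) * (k * snd p + l)"
  \<comment> \<open>Conditioning on the time change: for a frozen path of \<open>E\<close> the
    covariance is that of the diffusion at the times E(a) and E(b).\<close>
  have Z2: "integrable M (\<lambda>\<omega>. ?Z a \<omega> * ?Z b \<omega>)"
    "expectation (\<lambda>\<omega>. ?Z a \<omega> * ?Z b \<omega>) = expectation (\<lambda>\<omega>. exp (- \<theta> * \<bar>E a \<omega> - E b \<omega>\<bar>))" if ab: "a \<ge> 0" "b \<ge> 0" for a b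
  proof -
    have f: "?f \<in> borel_measurable borel" unfolding borel_prod[symmetric] by measurable
    show "integrable M (\<lambda>\<omega>. ?Z a \<omega> * ?Z b \<omega>)"
      using integrable_time_change[OF tc f ab, of 2] P.integrable_Y_mult_Y P.abs_expectation_Y_mult_Y by simp
    show "expectation (\<lambda>\<omega>. ?Z a \<omega> * ?Z b \<omega>) = expectation (\<lambda>\<omega>. exp (- \<theta> * \<bar>E a \<omega> - E b \<omega>\<bar>))"
      using expectation_time_change[OF tc f ab, of 2] P.integrable_Y_mult_Y P.abs_expectation_Y_mult_Y
      by (simp add: cov E0)
  qed
  have Z1: "integrable M (?Z a)" "expectation (?Z a) = 0" "expectation (\<lambda>\<omega>. (?Z a \<omega>)\<^sup>2) = 1" if a: "a \<ge> 0" for a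
  proof -
    have f: "(\<lambda>p. k * fst p + l) \<in> borel_measurable (borel :: (real \<times> real) measure)" unfolding borel_prod[symmetric] by measurable
    have b: "expectation (\<lambda>\<omega>. \<bar>P.Y u \<omega>\<bar>) \<le> 2" if u: "u \<ge> 0" for u
    proof -
      have "expectation (\<lambda>\<omega>. \<bar>P.Y u \<omega>\<bar>) \<le> expectation (\<lambda>\<omega>. (P.Y u \<omega>)\<^sup>2 + 1)"
        using abs_mult_le_sum_squares[of "P.Y u _" 1] P.integrable_Y[OF u] P.integrable_Y_square[OF u]
        by (intro integral_mono) auto
      then show ?thesis using P.integrable_Y_square[OF u] P.expectation_Y_square[OF u] by (simp add: prob_space)
    qed
    show "integrable M (?Z a)"
      using integrable_time_change[OF tc f a a, of 2] P.integrable_Y b by simp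
    show "expectation (?Z a) = 0"
      using expectation_time_change[OF tc f a a, of 2] P.integrable_Y b by (simp add: P.expectation_Y E0)
    \<comment> \<open>For equal times the exponent is 0, so the time-changed process keeps variance
      1.\<close>
    show "expectation (\<lambda>\<omega>. (?Z a \<omega>)\<^sup>2) = 1"
      using Z2(2)[OF a a] by (simp add: power2_eq_square prob_space)
  qed
  have "corr M (X t) (X s) = expectation (\<lambda>\<omega>. ?Z t \<omega> * ?Z s \<omega>)"
    unfolding assms(17) time_change_def[abs_def] using Z1[OF t] Z1[OF st(1)] by (intro corr_affine k)
  also have "\<dots> = expectation (\<lambda>\<omega>. exp (- \<theta> * (E t \<omega> - E s \<omega>)))"
    unfolding Z2(2)[OF t st(1)]
  proof (rule integral_cong_AE)
    \<comment> \<open>Where a path of \<open>D\<close> stays bounded, the default value of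
      \<open>E\<close> can break the order of \<open>E s\<close> and \<open>E t\<close>, hence the
      restriction to almost all paths.\<close>
    show "AE \<omega> in M. exp (- \<theta> * \<bar>E t \<omega> - E s \<omega>\<bar>) = exp (- \<theta> * (E t \<omega> - E s \<omega>))"
      using S.AE_unbounded AE_space
    proof eventually_elim
      case (elim \<omega>)
      then have "E s \<omega> \<le> E t \<omega>" unfolding assms(15) using st by (intro S.E_mono) auto
      then show ?case by simp
    qed
  qed (use E_m[OF t] E_m[OF st(1)] in measurable)
  also have "\<dots> = \<theta> * (LINT y:{0..s}|lborel. h_fun c1 c2 \<beta>1 \<beta>2 y * Phi_fun c1 c2 \<beta>1 \<beta>2 \<theta> (t - y)) + Phi_fun c1 c2 \<beta>1 \<beta>2 \<theta> t"
    using S.expectation_exp_E_increment_eq[OF \<theta> st] E_m[OF t] E_m[OF st(1)] unfolding assms(15) by simp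
  finally show ?thesis .
qed

end
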